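(* Let $n\geq 3$ be even. Then there exist a number field $K$ with $[K:\mathbb{Q}]\leq 2$, a monic polynomial $P$ of degree $n$ and a nonzero polynomial $Q$ of degree at most $n-1$, both with integer coefficients, such that for every integer $t$ the polynomial $P(X)-tQ(X)$ has Galois group over $K$ isomorphic to the alternating group $A_n$.
   Context: The Galois group of a polynomial $f$ over a field $K$ is the Galois group of its splitting field over $K$, viewed as a group of permutations of the roots of $f$. *)

theory Defs
  imports "HOL-Algebra.Algebraic_Closure_Type" "HOL-Algebra.Generated_Fields" "HOL-Algebra.Bij" "HOL-Algebra.Sym_Groups"
    Complex_Main
begin

text \<open>Number fields and splitting fields are realised as subfields of the complex numbers.\<close>

abbreviation complex_ring :: "complex ring" where
  "complex_ring \<equiv> ring_of_type_algebra"

definition number_field :: "complex set \<Rightarrow> bool" where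
  "number_field K \<longleftrightarrow> subfield K complex_ring \<and> ring.finite_dimension complex_ring \<rat> K"

definition degree_over_Rats :: "complex set \<Rightarrow> nat" where
  "degree_over_Rats K = ring.dim complex_ring \<rat> K"

definition complex_roots :: "complex poly \<Rightarrow> complex set" where
  "complex_roots f = {z. poly f z = 0}"

definition splitting_field :: "complex set \<Rightarrow> complex poly \<Rightarrow> complex set" where
  "splitting_field K f = generate_field complex_ring (K \<union> complex_roots f)"

text \<open>As in \<^const>\<open>AutoGroup\<close>, automorphisms are made unique as HOL functions by
  extensionality outside the field, and multiplication is composition.\<close>

definition field_automorphisms :: "complex set \<Rightarrow> complex set \<Rightarrow> (complex \<Rightarrow> complex) set" where
  "field_automorphisms K L =
     {\<sigma> \<in> ring_hom (complex_ring\<lparr>carrier := L\<rparr>) (complex_ring\<lparr>carrier := L\<rparr>) \<inter> Bij L.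
        \<forall>x\<in>K. \<sigma> x = x}"

text \<open>The group of permutations of the roots of \<open>f\<close> induced by the \<open>K\<close>-automorphisms of the
  splitting field of \<open>f\<close>; meaningful for nonzero \<open>f\<close> with coefficients in \<open>K\<close>.\<close>

definition galois_group :: "complex set \<Rightarrow> complex poly \<Rightarrow> (complex \<Rightarrow> complex) monoid" where
  "galois_group K f =
     BijGroup (complex_roots f)
       \<lparr>carrier := (\<lambda>\<sigma>. restrict \<sigma> (complex_roots f)) ` field_automorphisms K (splitting_field K f)\<rparr>"

end

theory Submission
  imports Defs "HOL-Number_Theory.Cong"
begin

text \<open>
  With \<open>n = 2 * k + 2\<close>, consider \<open>f\<^sub>t(Y) = Y^(n-1) (Y + (k+1)\<^sup>2) - t (Y + k\<^sup>2)\<close>. The Wronskian of the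
  two polynomials is \<open>(n-1) Y^(n-2) (Y + k(k+1))\<^sup>2\<close>, so the discriminant of \<open>f\<^sub>t\<close> is a rational
  square times a constant \<open>d = \<plusminus>(n-1)\<close> that does not depend on \<open>t\<close>, and over \<open>\<rat>(\<surd>d)\<close> only even
  permutations of the roots occur. It remains to force the Galois group over \<open>\<rat>\<close> to contain all
  even permutations, which is done by congruence conditions on \<open>t\<close> at two large primes. If \<open>p\<close>
  divides \<open>t\<close> exactly once, then \<open>f\<^sub>t\<close> is Eisenstein-like with \<open>n-1\<close> roots meeting at \<open>0\<close>, and the
  inertia group permutes them transitively while fixing the last root; as \<open>f\<^sub>t\<close> has no rational
  root, the Galois group is doubly transitive. If \<open>q\<close> divides \<open>t - t\<^sub>1\<close> exactly once, where \<open>t\<^sub>1\<close> is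
  the critical value at \<open>-k(k+1)\<close>, then exactly three roots meet there and inertia contains a
  3-cycle. A doubly transitive group containing a 3-cycle contains the alternating group.
\<close>

section \<open>Valuation rings above a prime\<close>

text \<open>The quotient \<open>Y^(n-1) (Y + c) / (Y + a)\<close> has points of multiplicity
  \<open>n-1\<close> at zero and at infinity for all \<open>a\<close> and \<open>c\<close>, and for
  even \<open>n\<close> an \<open>(n-1)\<close>-cycle is an even permutation. What remains is the
  factor \<open>(n-1) Y^2 + (n a + (n-2) c) Y + (n-1) a c\<close> of the Wronskian; two distinct
  roots would give transpositions, and a double root gives a 3-cycle instead. With
  \<open>n = 2 k + 2\<close>, \<open>a = u^2\<close>, \<open>c = v^2\<close> and suitable signs the
  condition becomes \<open>(u - v) ((k+1) u - k v) = 0\<close>. As \<open>u = v\<close> lets the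
  quotient degenerate, \<open>a : c = k^2 : (k+1)^2\<close>, and scaling \<open>Y\<close> does the
  rest. Since every integer parameter must be covered, not just almost every one, Hilbert
  irreducibility would be too weak; the parameter is confined to one residue class in which two
  ramified primes are visible. Ramification is read off from an arbitrary valuation ring of the
  complex numbers above the prime. A prime above \<open>n!\<close> makes inertia tame: its order is
  a unit, and a trace argument shows that it permutes the colliding roots transitively.\<close>

definition is_subring :: "'a::field set \<Rightarrow> bool" where
  "is_subring A \<longleftrightarrow> 1 \<in> A \<and> (\<forall>x\<in>A. \<forall>y\<in>A. x - y \<in> A \<and> x * y \<in> A)"

lemma is_subring_1: "is_subring A \<Longrightarrow> 1 \<in> A"
  and is_subring_diff: "is_subring A \<Longrightarrow> x \<in> A \<Longrightarrow> y \<in> A \<Longrightarrow> x - y \<in> A"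
  and is_subring_mult: "is_subring A \<Longrightarrow> x \<in> A \<Longrightarrow> y \<in> A \<Longrightarrow> x * y \<in> A"
  by (auto simp: is_subring_def)

lemma is_subring_0: "is_subring A \<Longrightarrow> 0 \<in> A"
  using is_subring_diff[of A 1 1] by (simp add: is_subring_1)

lemma is_subring_minus: "is_subring A \<Longrightarrow> x \<in> A \<Longrightarrow> - x \<in> A"
  using is_subring_diff[of A 0 x] by (simp add: is_subring_0)

lemma is_subring_add: "is_subring A \<Longrightarrow> x \<in> A \<Longrightarrow> y \<in> A \<Longrightarrow> x + y \<in> A"
  using is_subring_diff[of A x "- y"] by (simp add: is_subring_minus)

lemma is_subring_power: "is_subring A \<Longrightarrow> x \<in> A \<Longrightarrow> x ^ k \<in> A"
  by (induction k) (auto intro: is_subring_1 is_subring_mult)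

lemma is_subring_sum: "is_subring A \<Longrightarrow> (\<And>i. i \<in> S \<Longrightarrow> f i \<in> A) \<Longrightarrow> sum f S \<in> A"
  by (induction S rule: infinite_finite_induct) (auto intro: is_subring_0 is_subring_add)

lemma is_subring_prod: "is_subring A \<Longrightarrow> (\<And>i. i \<in> S \<Longrightarrow> f i \<in> A) \<Longrightarrow> prod f S \<in> A"
  by (induction S rule: infinite_finite_induct) (auto intro: is_subring_1 is_subring_mult)

lemma is_subring_of_nat: "is_subring A \<Longrightarrow> of_nat k \<in> A"
  by (induction k) (auto intro: is_subring_0 is_subring_1 is_subring_add)

lemma is_subring_of_int: "is_subring A \<Longrightarrow> of_int k \<in> A"
  by (cases k rule: int_diff_cases) (auto intro: is_subring_diff is_subring_of_nat)

lemmas is_subring_closed =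
  is_subring_0 is_subring_1 is_subring_diff is_subring_mult is_subring_minus is_subring_add
  is_subring_power is_subring_sum is_subring_prod is_subring_of_nat is_subring_of_int

section \<open>Polynomials with coefficients in a subring, and simple ring extensions\<close>

definition polys_over :: "'a::field set \<Rightarrow> 'a poly set" where
  "polys_over A = {q. \<forall>i. coeff q i \<in> A}"

lemma polys_over_coeff: "q \<in> polys_over A \<Longrightarrow> coeff q i \<in> A"
  by (simp add: polys_over_def)

lemma polys_over_pCons:
  "a \<in> A \<Longrightarrow> q \<in> polys_over A \<Longrightarrow> pCons a q \<in> polys_over A"
  by (auto simp: polys_over_def coeff_pCons split: nat.splits)

lemma polys_over_closed:
  assumes "is_subring A"
  shows polys_over_0: "0 \<in> polys_over A"
    and polys_over_1: "1 \<in> polys_over A"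
    and polys_over_diff: "q \<in> polys_over A \<Longrightarrow> r \<in> polys_over A \<Longrightarrow> q - r \<in> polys_over A"
    and polys_over_add: "q \<in> polys_over A \<Longrightarrow> r \<in> polys_over A \<Longrightarrow> q + r \<in> polys_over A"
    and polys_over_mult: "q \<in> polys_over A \<Longrightarrow> r \<in> polys_over A \<Longrightarrow> q * r \<in> polys_over A"
    and polys_over_smult: "c \<in> A \<Longrightarrow> q \<in> polys_over A \<Longrightarrow> smult c q \<in> polys_over A"
    and polys_over_monom: "c \<in> A \<Longrightarrow> monom c k \<in> polys_over A"
  using assms
  by (auto simp: polys_over_def coeff_1 coeff_mult coeff_monom intro!: is_subring_closed)

lemma polys_over_sum:
  assumes "is_subring A" "\<And>i. i \<in> S \<Longrightarrow> f i \<in> polys_over A"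
  shows "sum f S \<in> polys_over A"
  using assms by (auto simp: polys_over_def coeff_sum intro!: is_subring_sum)

definition adjoin :: "'a::field set \<Rightarrow> 'a \<Rightarrow> 'a set" where
  "adjoin A x = {poly q x | q. q \<in> polys_over A}"

lemma adjoinE: "y \<in> adjoin A x \<Longrightarrow> (\<And>q. q \<in> polys_over A \<Longrightarrow> y = poly q x \<Longrightarrow> P) \<Longrightarrow> P"
  by (auto simp: adjoin_def)

lemma is_subring_adjoin:
  assumes "is_subring A"
  shows "is_subring (adjoin A x)" "A \<subseteq> adjoin A x" "x \<in> adjoin A x"
proof -
  show "is_subring (adjoin A x)"
    unfolding is_subring_def adjoin_def
  proof (safe, goal_cases)
    case 1
    show ?case by (rule exI[of _ 1]) (use assms polys_over_1 in auto)
  next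
    case (2 _ _ q r)
    show ?case by (rule exI[of _ "q - r"]) (use 2 assms polys_over_diff in auto)
  next
    case (3 _ _ q r)
    show ?case by (rule exI[of _ "q * r"]) (use 3 assms polys_over_mult in auto)
  qed
  show "A \<subseteq> adjoin A x"
  proof
    fix a assume "a \<in> A"
    then have "[:a:] \<in> polys_over A"
      using assms by (intro polys_over_pCons polys_over_0)
    then show "a \<in> adjoin A x"
      unfolding adjoin_def by force
  qed
  have "[:0, 1:] \<in> polys_over A"
    using assms by (intro polys_over_pCons polys_over_0 is_subring_closed)
  then show "x \<in> adjoin A x"
    unfolding adjoin_def by force
qed

lemma poly_shift_power:
  fixes x :: "'a::field"
  assumes "x \<noteq> 0" "degree q \<le> k"
  shows "x ^ k * poly q (inverse x) = (\<Sum>i\<le>degree q. coeff q i * x ^ (k - i))"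
proof -
  have "x ^ k * inverse x ^ i = x ^ (k - i)" if "i \<le> k" for i
    using that assms(1) by (simp add: power_diff field_simps)
  then show ?thesis
    using assms(2) by (auto simp: poly_altdef sum_distrib_left mult.left_commute intro!: sum.cong)
qed

text \<open>The exchange step in Chevalley's extension theorem: a representation of \<open>1\<close> by powers of
  \<open>inverse x\<close> lowers the degree of one by powers of \<open>x\<close>.\<close>

lemma chevalley_exchange:
  fixes x c :: "'a::field"
  assumes A: "is_subring A" and c: "c \<in> A"
    and unit: "\<And>a. a \<in> A \<Longrightarrow> inverse (1 - c * a) \<in> A \<and> 1 - c * a \<noteq> 0"
    and x: "x \<noteq> 0"
    and q: "q \<in> polys_over A" "c * poly q x = 1"
    and r: "r \<in> polys_over A" "c * poly r (inverse x) = 1"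
    and deg: "degree r \<le> degree q"
  shows "\<exists>q'\<in>polys_over A. c * poly q' x = 1 \<and> degree q' < degree q"
proof -
  define k where "k = degree q"
  have k0: "k \<noteq> 0"
  proof
    assume "k = 0"
    then obtain a where a: "q = [:a:]"
      using degree_eq_zeroE unfolding k_def by blast
    then have "a \<in> A"
      using q(1) by (metis coeff_pCons_0 polys_over_coeff)
    then show False
      using unit[of a] q(2) a by simp
  qed
  obtain b s where r_eq: "r = pCons b s"
    by (cases r)
  have b: "b \<in> A" and s: "s \<in> polys_over A"
  proof -
    show "b \<in> A"
      using polys_over_coeff[OF r(1), of 0] r_eq by simp
    show "s \<in> polys_over A"
      using polys_over_coeff[OF r(1), of "Suc i" for i] r_eq by (auto simp: polys_over_def)
  qed
  \<comment> \<open>Moving the constant term of \<open>r\<close> to the other side leaves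
    \<open>u = c * inverse x * poly s (inverse x)\<close> with \<open>u\<close> a unit. Multiplied
    by \<open>x ^ k\<close>, this writes \<open>x ^ k\<close> as \<open>c * poly h x\<close> with
    \<open>degree h < k\<close>, which then replaces the leading power in \<open>q\<close>.\<close>
  define u where "u = 1 - c * b"
  have u: "u \<noteq> 0" "inverse u \<in> A"
    using unit[OF b] by (auto simp: u_def)
  have ds: "degree s \<le> k - 1"
    using deg r_eq unfolding k_def by (cases "s = 0") auto
  define h where "h = (\<Sum>i\<le>degree s. monom (inverse u * coeff s i) (k - 1 - i))"
  have hA: "h \<in> polys_over A"
    unfolding h_def using A u s
    by (intro polys_over_sum polys_over_monom is_subring_mult) (auto simp: polys_over_coeff)
  have "degree h \<le> k - 1"
    unfolding h_def by (intro degree_sum_le) (auto intro: order.trans[OF degree_monom_le])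
  have "u = c * inverse x * poly s (inverse x)"
    using r(2) r_eq by (simp add: u_def algebra_simps)
  then have "u * x ^ k = c * (x ^ (k - 1) * poly s (inverse x))"
    using x k0 by (simp add: power_eq_if)
  also have "\<dots> = c * (\<Sum>i\<le>degree s. coeff s i * x ^ (k - 1 - i))"
    using poly_shift_power[OF x ds] by simp
  also have "\<dots> = u * (c * poly h x)"
    unfolding h_def using u by (simp add: poly_sum poly_monom sum_distrib_left field_simps)
  finally have xk: "x ^ k = c * poly h x"
    using u by simp
  define q1 where "q1 = q - monom (coeff q k) k"
  define q' where "q' = q1 + smult (c * coeff q k) h"
  have q1A: "q1 \<in> polys_over A"
    unfolding q1_def using A q(1)
    by (intro polys_over_diff polys_over_monom) (auto simp: polys_over_coeff)
  have "degree q1 \<le> k - 1"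
  proof (rule degree_le, safe)
    fix i assume "k - 1 < i"
    then show "coeff q1 i = 0"
      by (cases "i = k") (auto simp: q1_def coeff_eq_0 k_def)
  qed
  then have "degree q' \<le> k - 1"
    unfolding q'_def using \<open>degree h \<le> k - 1\<close>
    by (intro degree_add_le) (auto intro: order.trans[OF degree_smult_le])
  moreover have "q' \<in> polys_over A"
    unfolding q'_def using A q1A hA c q(1)
    by (intro polys_over_add polys_over_smult is_subring_mult) (auto simp: polys_over_coeff)
  moreover have "c * poly q' x = 1"
    using q(2) xk by (simp add: q'_def q1_def poly_monom algebra_simps)
  ultimately show ?thesis
    using k0 unfolding k_def by (intro bexI[of _ q']) auto
qed

text \<open>Chevalley's theorem. Among the subrings that omit the inverse of \<open>p\<close>, the
  integers being one, Zorn's lemma gives a maximal one. If \<open>x\<close> is outside it, adjoining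
  \<open>x\<close> must produce that inverse, so \<open>1\<close> is \<open>p\<close> times a
  polynomial in \<open>x\<close>; if \<open>inverse x\<close> is outside as well, two such
  representations of minimal degree contradict the exchange step.\<close>

theorem exists_valuation_ring:
  fixes p :: nat
  assumes "p > 1"
  shows "\<exists>A :: 'a::field_char_0 set. is_subring A \<and> inverse (of_nat p) \<notin> A \<and>
           (\<forall>x. x \<in> A \<or> inverse x \<in> A)"
proof -
  define c where "c = (of_nat p :: 'a)"
  have c0: "c \<noteq> 0"
    using assms by (simp add: c_def)
  define \<A> where "\<A> = {A :: 'a set. is_subring A \<and> inverse c \<notin> A}"
  have "\<int> \<in> \<A>"
  proof -
    have "inverse c \<notin> \<int>"
    proof
      assume "inverse c \<in> \<int>"
      then obtain z :: int where "inverse c = of_int z"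
        by (auto elim: Ints_cases)
      then have "of_int (z * int p) = (1 :: 'a)"
        using c0 by (simp add: c_def field_simps)
      then have "z * int p = 1"
        by (simp only: of_int_eq_1_iff)
      then show False
        using assms by (auto simp: zmult_eq_1_iff)
    qed
    then show ?thesis
      by (auto simp: \<A>_def is_subring_def)
  qed
  moreover have "\<Union> \<C> \<in> \<A>" if "\<C> \<noteq> {}" "subset.chain \<A> \<C>" for \<C>
  proof -
    have mem: "is_subring B \<and> inverse c \<notin> B" if "B \<in> \<C>" for B
      using that \<open>subset.chain \<A> \<C>\<close> unfolding subset_chain_def \<A>_def by auto
    have "x - y \<in> \<Union> \<C> \<and> x * y \<in> \<Union> \<C>" if xy: "x \<in> \<Union> \<C>" "y \<in> \<Union> \<C>" for x y
    proof -
      obtain B Y where "B \<in> \<C>" "x \<in> B" "Y \<in> \<C>" "y \<in> Y"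
        using xy by blast
      moreover have "B \<subseteq> Y \<or> Y \<subseteq> B"
        using \<open>subset.chain \<A> \<C>\<close> \<open>B \<in> \<C>\<close> \<open>Y \<in> \<C>\<close>
        by (simp add: subset_chain_def)
      ultimately obtain Z where "Z \<in> \<C>" "x \<in> Z" "y \<in> Z"
        by blast
      then show ?thesis
        using mem[of Z] is_subring_diff[of Z x y] is_subring_mult[of Z x y] by blast
    qed
    moreover have "1 \<in> \<Union> \<C>"
      using \<open>\<C> \<noteq> {}\<close> mem is_subring_1 by blast
    moreover have "inverse c \<notin> \<Union> \<C>"
      using mem by blast
    ultimately show ?thesis
      by (simp add: \<A>_def is_subring_def)
  qed
  ultimately obtain A where A: "A \<in> \<A>" and max: "\<And>B. B \<in> \<A> \<Longrightarrow> A \<subseteq> B \<Longrightarrow> B = A"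
    using subset_Zorn_nonempty[of \<A>] by blast
  have sub: "is_subring A" and icA: "inverse c \<notin> A"
    using A by (auto simp: \<A>_def)
  have cA: "c \<in> A"
    using sub by (simp add: c_def is_subring_of_nat)
  have rep: "\<exists>q\<in>polys_over A. c * poly q x = 1" if "x \<notin> A" for x
  proof -
    have "adjoin A x \<notin> \<A>"
      using max[of "adjoin A x"] is_subring_adjoin[OF sub, of x] that by auto
    then have "inverse c \<in> adjoin A x"
      using is_subring_adjoin[OF sub, of x] by (auto simp: \<A>_def)
    then show ?thesis
      by (elim adjoinE) (use c0 in \<open>auto simp: field_simps\<close>)
  qed
  \<comment> \<open>The exchange step needs these units. Powers of \<open>u\<close> stay congruent
    to \<open>1\<close> modulo \<open>c\<close>, so a representation
    \<open>c * poly q (inverse u) = 1\<close>, multiplied by a power of \<open>u\<close>, would make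
    \<open>1\<close> a multiple of \<open>c\<close> in \<open>A\<close>.\<close>
  have unit: "inverse (1 - c * a) \<in> A \<and> 1 - c * a \<noteq> 0" if a: "a \<in> A" for a
  proof -
    define u where "u = 1 - c * a"
    have u0: "u \<noteq> 0"
      using icA a inverse_unique[of c a] by (auto simp: u_def)
    have uA: "u \<in> A"
      unfolding u_def using sub cA a by (intro is_subring_closed)
    have "inverse u \<in> A"
    proof (rule ccontr)
      assume "inverse u \<notin> A"
      then obtain q where q: "q \<in> polys_over A" "c * poly q (inverse u) = 1"
        using rep by blast
      have pow: "\<exists>b\<in>A. u ^ k = 1 - c * b" for k
      proof (induction k)
        case 0
        show ?case using is_subring_0[OF sub] by force
      next
        case (Suc k)
        then obtain b where b: "b \<in> A" "u ^ k = 1 - c * b" by blast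
        then have "u ^ Suc k = u * (1 - c * b)"
          by simp
        then have "u ^ Suc k = u - c * (u * b)"
          by (simp only: right_diff_distrib mult_1_right mult.left_commute)
        then have "u ^ Suc k = 1 - c * (a + u * b)"
          by (simp add: u_def algebra_simps)
        then show ?case
          using sub a uA b by (intro bexI[of _ "a + u * b"] is_subring_closed)
      qed
      obtain b where b: "b \<in> A" "u ^ degree q = 1 - c * b"
        using pow by blast
      have "c * (u ^ degree q * poly q (inverse u)) = u ^ degree q * (c * poly q (inverse u))"
        by (simp only: mult.left_commute)
      also have "\<dots> = 1 - c * b"
        using q(2) b(2) by simp
      finally have "c * (u ^ degree q * poly q (inverse u)) = 1 - c * b" .
      then have "c * (u ^ degree q * poly q (inverse u) + b) = 1"
        by (simp add: algebra_simps)
      moreover have "u ^ degree q * poly q (inverse u) + b \<in> A"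
        unfolding poly_shift_power[OF u0 order.refl] using sub b uA q(1)
        by (intro is_subring_closed) (auto simp: polys_over_coeff)
      ultimately show False
        using icA by (metis inverse_unique)
    qed
    then show ?thesis
      using u0 by (simp add: u_def)
  qed
  have "x \<in> A \<or> inverse x \<in> A" for x
  proof (rule ccontr)
    assume neg: "\<not> (x \<in> A \<or> inverse x \<in> A)"
    then have x0: "x \<noteq> 0"
      using sub is_subring_0 by auto
    define S where "S = (\<lambda>y. {q \<in> polys_over A. c * poly q y = 1})"
    have min: "\<exists>q\<in>S y. \<forall>r\<in>S y. degree q \<le> degree r" if y: "y \<notin> A" for y
    proof -
      obtain q0 where "q0 \<in> S y"
        using rep[OF y] by (auto simp: S_def)
      then show ?thesis
        using ex_has_least_nat[of "\<lambda>q. q \<in> S y" q0 degree] by blast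
    qed
    obtain q where q: "q \<in> S x" "\<And>r. r \<in> S x \<Longrightarrow> degree q \<le> degree r"
      using min[of x] neg by blast
    obtain r where r: "r \<in> S (inverse x)" "\<And>q. q \<in> S (inverse x) \<Longrightarrow> degree r \<le> degree q"
      using min[of "inverse x"] neg by blast
    have "degree r \<le> degree q \<or> degree q \<le> degree r"
      by linarith
    then show False
    proof
      assume "degree r \<le> degree q"
      from chevalley_exchange[OF sub cA unit x0 _ _ _ _ this] q r show False
        by (fastforce simp: S_def)
    next
      assume *: "degree q \<le> degree r"
      have "inverse x \<noteq> 0" using x0 by simp
      from chevalley_exchange[OF sub cA unit this _ _ _ _ *] q r show False
        by (fastforce simp: S_def)
    qed
  qed
  then show ?thesis
    using sub icA unfolding c_def by blast
qed

section \<open>The maximal ideal of a valuation ring\<close>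

locale valuation_ring =
  fixes A :: "'a::field set"
  assumes subring: "is_subring A"
    and mem_or_inverse: "x \<in> A \<or> inverse x \<in> A"
begin

text \<open>The nonunits. Zero is listed separately because \<open>inverse 0 = 0\<close> does lie in
  \<open>A\<close>.\<close>

definition M :: "'a set" where
  "M = {x \<in> A. x = 0 \<or> inverse x \<notin> A}"

lemma zero_in_M: "0 \<in> M"
  using subring by (simp add: M_def is_subring_0)

lemma one_notin_M: "1 \<notin> M"
  using subring by (simp add: M_def is_subring_1)

lemma inverse_mem: "x \<in> A \<Longrightarrow> x \<notin> M \<Longrightarrow> inverse x \<in> A"
  by (auto simp: M_def)

lemma M_mult_left:
  assumes "x \<in> A" "y \<in> M"
  shows "x * y \<in> M"
proof (cases "x * y = 0")
  case False
  have "inverse (x * y) \<notin> A"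
  proof
    assume "inverse (x * y) \<in> A"
    then have "x * inverse (x * y) \<in> A"
      using subring assms by (blast intro: is_subring_closed)
    then show False
      using False assms(2) by (auto simp: M_def field_simps)
  qed
  then show ?thesis
    using subring assms by (auto simp: M_def intro: is_subring_closed)
qed (use zero_in_M in auto)

lemma M_mult_right: "x \<in> M \<Longrightarrow> y \<in> A \<Longrightarrow> x * y \<in> M"
  using M_mult_left[of y x] by (simp add: mult.commute)

lemma M_minus: "x \<in> M \<Longrightarrow> - x \<in> M"
  using M_mult_left[of "- 1" x] subring by (auto intro: is_subring_closed)

text \<open>Of \<open>x / y\<close> and \<open>y / x\<close> one lies in \<open>A\<close>, so the
  sum is an \<open>A\<close>-multiple of one of its summands.\<close>

lemma M_add:
  assumes "x \<in> M" "y \<in> M"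
  shows "x + y \<in> M"
proof -
  have aux: "x + y \<in> M" if "x \<in> M" "y \<in> M" "x / y \<in> A" "y \<noteq> 0" for x y
  proof -
    have "(1 + x / y) * y \<in> M"
      using that subring by (intro M_mult_left is_subring_closed)
    then show ?thesis
      using that by (simp add: distrib_right add.commute)
  qed
  show ?thesis
  proof (cases "x = 0 \<or> y = 0")
    case False
    then show ?thesis
      using aux[of x y] aux[of y x] assms mem_or_inverse[of "x / y"] by (auto simp: add.commute)
  qed (use assms in auto)
qed

lemma M_diff: "x \<in> M \<Longrightarrow> y \<in> M \<Longrightarrow> x - y \<in> M"
  using M_add[of x "- y"] M_minus by simp

lemma M_sum: "(\<And>i. i \<in> S \<Longrightarrow> f i \<in> M) \<Longrightarrow> sum f S \<in> M"
  by (induction S rule: infinite_finite_induct) (auto intro: zero_in_M M_add)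

lemma M_prime:
  assumes "x \<in> A" "y \<in> A" "x * y \<in> M"
  shows "x \<in> M \<or> y \<in> M"
proof (rule ccontr)
  assume neg: "\<not> (x \<in> M \<or> y \<in> M)"
  then have "inverse x * inverse y \<in> A"
    using assms subring by (auto intro!: is_subring_closed inverse_mem)
  then have "x * y = 0"
    using assms(3) by (auto simp: M_def mult.commute)
  then show False
    using neg zero_in_M by auto
qed

lemma M_power: "x \<in> A \<Longrightarrow> x ^ k \<in> M \<Longrightarrow> x \<in> M"
proof (induction k)
  case (Suc k)
  then show ?case
    using M_prime[of x "x ^ k"] subring is_subring_power by auto
qed (use one_notin_M in auto)

lemma M_prod_iff:
  assumes "finite S" "\<And>i. i \<in> S \<Longrightarrow> f i \<in> A"
  shows "prod f S \<in> M \<longleftrightarrow> (\<exists>i\<in>S. f i \<in> M)"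
  using assms
proof (induction S)
  case (insert i S)
  have "prod f S \<in> A"
    using insert subring by (auto intro: is_subring_prod)
  then show ?case
    using insert M_prime[of "f i" "prod f S"] M_mult_left[of "f i" "prod f S"]
      M_mult_right[of "f i" "prod f S"] by auto
qed (use one_notin_M in auto)

text \<open>Valuation rings are integrally closed: were \<open>x\<close> outside \<open>A\<close>,
  its inverse would lie in \<open>A\<close>, and the equation divided by
  \<open>x ^ (degree f - 1)\<close> would express \<open>x\<close> through the coefficients and
  powers of \<open>inverse x\<close>.\<close>

lemma integral_root_mem:
  assumes f: "lead_coeff f = 1" "f \<in> polys_over A" and root: "poly f x = 0"
  shows "x \<in> A"
proof (rule ccontr)
  assume x: "x \<notin> A"
  then have x0: "x \<noteq> 0" and ix: "inverse x \<in> A"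
    using subring is_subring_0 mem_or_inverse by auto
  define k where "k = degree f"
  have k: "k \<noteq> 0"
    using f(1) root by (metis degree_eq_zeroE k_def one_neq_zero pCons_0_0 poly_pCons
        coeff_pCons_0 degree_pCons_0 add_cancel_right_right mult_zero_right poly_0)
  have "{..k} = insert k {..<k}"
    by auto
  then have "x ^ k + (\<Sum>i<k. coeff f i * x ^ i) = 0"
    using root f(1) by (simp add: poly_altdef k_def)
  then have "x ^ k * inverse x ^ (k - 1) = - (\<Sum>i<k. coeff f i * x ^ i) * inverse x ^ (k - 1)"
    by (metis eq_neg_iff_add_eq_0)
  also have "\<dots> = - (\<Sum>i<k. coeff f i * inverse x ^ (k - 1 - i))"
  proof -
    have "x ^ i * inverse x ^ (k - 1) = inverse x ^ (k - 1 - i)" if "i < k" for i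
    proof -
      have "inverse x ^ (k - 1) = inverse x ^ i * inverse x ^ (k - 1 - i)"
        using that by (simp flip: power_add)
      then show ?thesis
        using x0 by (simp add: power_mult_distrib[symmetric] mult.assoc[symmetric])
    qed
    then show ?thesis
      by (auto simp: sum_distrib_right mult.assoc intro!: sum.cong)
  qed
  also have "\<dots> \<in> A"
    using subring ix f(2) by (intro is_subring_closed) (auto simp: polys_over_coeff)
  also have "x ^ k * inverse x ^ (k - 1) = x * (x * inverse x) ^ (k - 1)"
    using k by (cases k) (auto simp: power_mult_distrib)
  finally show False
    using x x0 by simp
qed

end

section \<open>Extension of field homomorphisms\<close>

definition is_subfield :: "'a::field set \<Rightarrow> bool" where
  "is_subfield F \<longleftrightarrow> is_subring F \<and> (\<forall>x\<in>F. inverse x \<in> F)"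

lemma is_subfield_subring: "is_subfield F \<Longrightarrow> is_subring F"
  and is_subfield_inverse: "is_subfield F \<Longrightarrow> x \<in> F \<Longrightarrow> inverse x \<in> F"
  by (auto simp: is_subfield_def)

text \<open>The condition at \<open>1\<close> excludes the zero map, which makes such maps injective
  on subfields. Nothing is demanded outside \<open>F\<close>, so extending a homomorphism just means
  agreeing with it on \<open>F\<close>.\<close>

definition is_hom_on :: "'a::field set \<Rightarrow> ('a \<Rightarrow> 'b::field) \<Rightarrow> bool" where
  "is_hom_on F \<phi> \<longleftrightarrow> \<phi> 1 = 1 \<and>
     (\<forall>x\<in>F. \<forall>y\<in>F. \<phi> (x + y) = \<phi> x + \<phi> y \<and> \<phi> (x * y) = \<phi> x * \<phi> y)"

lemma is_hom_on_mono: "is_hom_on F \<phi> \<Longrightarrow> E \<subseteq> F \<Longrightarrow> is_hom_on E \<phi>"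
  unfolding is_hom_on_def by blast

context
  fixes F :: "'a::field set" and \<phi> :: "'a \<Rightarrow> 'b::field"
  assumes F: "is_subring F" and \<phi>: "is_hom_on F \<phi>"
begin

lemma hom_on_1: "\<phi> 1 = 1"
  and hom_on_add: "x \<in> F \<Longrightarrow> y \<in> F \<Longrightarrow> \<phi> (x + y) = \<phi> x + \<phi> y"
  and hom_on_mult: "x \<in> F \<Longrightarrow> y \<in> F \<Longrightarrow> \<phi> (x * y) = \<phi> x * \<phi> y"
  using \<phi> by (auto simp: is_hom_on_def)

lemma hom_on_0: "\<phi> 0 = 0"
  using hom_on_add[of 0 0] is_subring_0[OF F] by (metis add.right_neutral add_left_cancel)

lemma hom_on_minus: "x \<in> F \<Longrightarrow> \<phi> (- x) = - \<phi> x"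
  using hom_on_add[of x "- x"] hom_on_0 is_subring_minus[OF F] by (simp add: eq_neg_iff_add_eq_0 add.commute)

lemma hom_on_diff: "x \<in> F \<Longrightarrow> y \<in> F \<Longrightarrow> \<phi> (x - y) = \<phi> x - \<phi> y"
  using hom_on_add[of x "- y"] hom_on_minus is_subring_minus[OF F] by simp

lemma hom_on_power: "x \<in> F \<Longrightarrow> \<phi> (x ^ k) = \<phi> x ^ k"
  by (induction k) (auto simp: hom_on_1 hom_on_mult is_subring_power[OF F])

lemma hom_on_sum: "(\<And>i. i \<in> S \<Longrightarrow> f i \<in> F) \<Longrightarrow> \<phi> (sum f S) = (\<Sum>i\<in>S. \<phi> (f i))"
  by (induction S rule: infinite_finite_induct) (auto simp: hom_on_0 hom_on_add is_subring_sum[OF F])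

lemma hom_on_prod: "(\<And>i. i \<in> S \<Longrightarrow> f i \<in> F) \<Longrightarrow> \<phi> (prod f S) = (\<Prod>i\<in>S. \<phi> (f i))"
  by (induction S rule: infinite_finite_induct) (auto simp: hom_on_1 hom_on_mult is_subring_prod[OF F])

lemma hom_on_of_nat: "\<phi> (of_nat k) = of_nat k"
  by (induction k) (auto simp: hom_on_0 hom_on_1 hom_on_add is_subring_1[OF F] is_subring_of_nat[OF F])

lemma hom_on_of_int: "\<phi> (of_int k) = of_int k"
  by (cases k rule: int_diff_cases) (auto simp: hom_on_diff hom_on_of_nat is_subring_of_nat[OF F])

lemma hom_on_nonzero:
  assumes "x \<in> F" "inverse x \<in> F" "x \<noteq> 0"
  shows "\<phi> x \<noteq> 0"
  using hom_on_mult[OF assms(1,2)] assms(3) hom_on_1 by auto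

lemma hom_on_inverse:
  assumes "x \<in> F" "inverse x \<in> F"
  shows "\<phi> (inverse x) = inverse (\<phi> x)"
proof (cases "x = 0")
  case False
  then have "\<phi> x * \<phi> (inverse x) = 1"
    using hom_on_mult[OF assms] hom_on_1 by simp
  then show ?thesis
    by (metis inverse_unique)
qed (simp add: hom_on_0)

lemma coeff_map_hom: "coeff (map_poly \<phi> q) i = \<phi> (coeff q i)"
  by (rule coeff_map_poly) (rule hom_on_0)

lemma map_hom_add:
  "q \<in> polys_over F \<Longrightarrow> r \<in> polys_over F \<Longrightarrow> map_poly \<phi> (q + r) = map_poly \<phi> q + map_poly \<phi> r"
  by (rule poly_eqI) (simp add: coeff_map_hom hom_on_add polys_over_coeff)

lemma map_hom_diff:
  "q \<in> polys_over F \<Longrightarrow> r \<in> polys_over F \<Longrightarrow> map_poly \<phi> (q - r) = map_poly \<phi> q - map_poly \<phi> r"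
  by (rule poly_eqI) (simp add: coeff_map_hom hom_on_diff polys_over_coeff)

lemma map_hom_mult:
  assumes "q \<in> polys_over F" "r \<in> polys_over F"
  shows "map_poly \<phi> (q * r) = map_poly \<phi> q * map_poly \<phi> r"
proof (rule poly_eqI)
  fix i
  show "coeff (map_poly \<phi> (q * r)) i = coeff (map_poly \<phi> q * map_poly \<phi> r) i"
    using assms F
    by (simp add: coeff_map_hom coeff_mult hom_on_sum hom_on_mult polys_over_coeff is_subring_mult)
qed

lemma hom_on_poly:
  assumes "q \<in> polys_over F" "x \<in> F"
  shows "\<phi> (poly q x) = poly (map_poly \<phi> q) (\<phi> x)"
  using assms(1)
proof (induction q)
  case (pCons a q)
  have aq: "a \<in> F" "q \<in> polys_over F"
    using polys_over_coeff[OF pCons.prems, of 0] polys_over_coeff[OF pCons.prems, of "Suc i" for i]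
    by (auto simp: polys_over_def)
  have "poly q x \<in> F"
    using aq assms(2) F by (auto simp: poly_altdef polys_over_coeff intro!: is_subring_closed)
  then show ?case
    using pCons.IH[OF aq(2)] aq assms(2) F
    by (simp add: hom_on_add hom_on_mult is_subring_mult map_poly_pCons hom_on_0)
qed (simp add: hom_on_0)

end

section \<open>Minimal polynomials and simple algebraic extensions\<close>

lemma polys_over_division:
  assumes F: "is_subring F" and b: "b \<in> polys_over F" "lead_coeff b = 1" and a: "a \<in> polys_over F"
  shows "\<exists>q\<in>polys_over F. \<exists>r\<in>polys_over F. a = q * b + r \<and> (r = 0 \<or> degree r < degree b)"
  using a
proof (induction "degree a" arbitrary: a rule: less_induct)
  case less
  show ?case
  proof (cases "a = 0 \<or> degree a < degree b")
    case True
    then show ?thesis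
      using less.prems F polys_over_0 by (intro bexI[of _ 0] bexI[of _ a]) auto
  next
    case False
    define k where "k = degree a - degree b"
    define c where "c = monom (lead_coeff a) k"
    define a' where "a' = a - c * b"
    have c: "c \<in> polys_over F"
      unfolding c_def using F less.prems by (intro polys_over_monom) (auto simp: polys_over_coeff)
    have a'F: "a' \<in> polys_over F"
      unfolding a'_def using F less.prems b c by (intro polys_over_diff polys_over_mult)
    have b0: "b \<noteq> 0"
      using b(2) by auto
    have deg: "degree (c * b) = degree a"
      using False b0 by (auto simp: c_def degree_mult_eq degree_monom_eq k_def monom_eq_0_iff)
    have lead: "lead_coeff (c * b) = lead_coeff a"
      unfolding lead_coeff_mult using b False by (simp add: c_def degree_monom_eq)
    show ?thesis
    proof (cases "a' = 0")
      case True
      then show ?thesis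
        using c F polys_over_0 by (intro bexI[of _ c] bexI[of _ 0]) (auto simp: a'_def)
    next
      case a'0: False
      have "degree a' < degree a"
      proof (rule ccontr)
        assume "\<not> degree a' < degree a"
        moreover have "degree a' \<le> degree a"
          unfolding a'_def using deg by (intro degree_diff_le) auto
        ultimately have "degree a' = degree a"
          by simp
        then have "lead_coeff a' = 0"
          using deg lead by (simp add: a'_def)
        then show False
          using a'0 by simp
      qed
      then obtain q r where qr: "q \<in> polys_over F" "r \<in> polys_over F" "a' = q * b + r"
        "r = 0 \<or> degree r < degree b"
        using less.hyps[OF _ a'F] by blast
      show ?thesis
        using qr c F by (intro bexI[of _ "q + c"] bexI[of _ r] polys_over_add)
          (auto simp: a'_def algebra_simps)
    qed
  qed
qed

definition minimal_polynomial :: "'a::field set \<Rightarrow> 'a \<Rightarrow> 'a poly \<Rightarrow> bool" where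
  "minimal_polynomial F x \<mu> \<longleftrightarrow> \<mu> \<in> polys_over F \<and> lead_coeff \<mu> = 1 \<and> poly \<mu> x = 0 \<and>
     (\<forall>q\<in>polys_over F. q \<noteq> 0 \<longrightarrow> poly q x = 0 \<longrightarrow> degree \<mu> \<le> degree q)"

definition algebraic_over :: "'a::field set \<Rightarrow> 'a \<Rightarrow> bool" where
  "algebraic_over F x \<longleftrightarrow> (\<exists>q\<in>polys_over F. q \<noteq> 0 \<and> poly q x = 0)"

lemma algebraic_over_mono: "algebraic_over F x \<Longrightarrow> F \<subseteq> E \<Longrightarrow> algebraic_over E x"
  unfolding algebraic_over_def polys_over_def by blast

lemma minimal_polynomial_exists:
  assumes F: "is_subfield F" and alg: "algebraic_over F x"
  shows "\<exists>\<mu>. minimal_polynomial F x \<mu>"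
proof -
  let ?P = "\<lambda>q. q \<in> polys_over F \<and> q \<noteq> 0 \<and> poly q x = 0"
  obtain q0 where "?P q0"
    using alg by (auto simp: algebraic_over_def)
  then obtain q where q: "?P q" and min: "\<And>r. ?P r \<Longrightarrow> degree q \<le> degree r"
    using ex_has_least_nat[of ?P q0 degree] by blast
  define \<mu> where "\<mu> = smult (inverse (lead_coeff q)) q"
  have "\<mu> \<in> polys_over F"
    unfolding \<mu>_def using F q
    by (intro polys_over_smult) (auto simp: is_subfield_def polys_over_coeff)
  then show ?thesis
    unfolding minimal_polynomial_def using q min
    by (intro exI[of _ \<mu>]) (auto simp: \<mu>_def lead_coeff_smult)
qed

lemma minimal_polynomial_degree: "minimal_polynomial F x \<mu> \<Longrightarrow> degree \<mu> > 0"
  unfolding minimal_polynomial_def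
  by (cases "degree \<mu> = 0") (auto elim!: degree_eq_zeroE)

lemma minimal_polynomial_dvd:
  assumes F: "is_subfield F" and \<mu>: "minimal_polynomial F x \<mu>"
    and q: "q \<in> polys_over F" "poly q x = 0"
  shows "\<exists>s\<in>polys_over F. q = s * \<mu>"
proof -
  obtain s r where sr: "s \<in> polys_over F" "r \<in> polys_over F" "q = s * \<mu> + r"
    "r = 0 \<or> degree r < degree \<mu>"
    using polys_over_division[OF is_subfield_subring[OF F], of \<mu> q] \<mu> q(1)
    unfolding minimal_polynomial_def by blast
  have "poly r x = 0"
    using q(2) sr(3) \<mu> by (simp add: minimal_polynomial_def)
  then have "r = 0"
    using sr \<mu> unfolding minimal_polynomial_def by force
  then show ?thesis
    using sr by auto
qed

text \<open>Inverses come from a one-sided Euclidean descent. Dividing \<open>\<mu>\<close> by a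
  monic \<open>b\<close> of smaller degree gives \<open>poly s x * poly b x = - poly r x\<close>, so
  the inverse of \<open>poly b x\<close> reduces to that of \<open>poly r x\<close> with
  \<open>degree r < degree b\<close>. Minimality of \<open>\<mu>\<close> keeps
  \<open>poly s x\<close> and \<open>poly b x\<close> away from zero.\<close>

lemma is_subfield_adjoin:
  assumes F: "is_subfield F" and alg: "algebraic_over F x"
  shows "is_subfield (adjoin F x)"
proof -
  have sub: "is_subring F"
    using F by (rule is_subfield_subring)
  obtain \<mu> where \<mu>: "minimal_polynomial F x \<mu>"
    using minimal_polynomial_exists[OF assms] by blast
  have \<mu>F: "\<mu> \<in> polys_over F" "lead_coeff \<mu> = 1" "poly \<mu> x = 0"
    using \<mu> by (auto simp: minimal_polynomial_def)
  note ring = is_subring_adjoin[OF sub, of x]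
  have inv: "inverse (poly q x) \<in> adjoin F x"
    if "q \<in> polys_over F" "q \<noteq> 0" "degree q < degree \<mu>" for q
    using that
  proof (induction "degree q" arbitrary: q rule: less_induct)
    case less
    define c where "c = inverse (lead_coeff q)"
    define b where "b = smult c q"
    have c: "c \<noteq> 0" "c \<in> F"
      using less.prems F by (auto simp: c_def is_subfield_def polys_over_coeff)
    have bF: "b \<in> polys_over F" "lead_coeff b = 1"
      unfolding b_def using less.prems c sub
      by (auto intro!: polys_over_smult simp: c_def lead_coeff_smult)
    have degb: "degree b = degree q"
      using c by (simp add: b_def)
    have "inverse (poly b x) \<in> adjoin F x"
    proof (cases "degree q = 0")
      case True
      then have "b = 1"
        using bF degb by (metis degree_eq_zeroE lead_coeff_pCons(2) one_pCons)
      then show ?thesis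
        using ring(1) is_subring_1 by simp
    next
      case False
      obtain s r where sr: "s \<in> polys_over F" "r \<in> polys_over F" "\<mu> = s * b + r"
        "r = 0 \<or> degree r < degree b"
        using polys_over_division[OF sub bF \<mu>F(1)] by blast
      have b0: "b \<noteq> 0"
        using bF by auto
      have s0: "s \<noteq> 0"
        using sr less.prems(3) degb by auto
      have "degree r < degree (s * b)" if "r \<noteq> 0"
        using that sr s0 b0 by (auto simp: degree_mult_eq)
      then have "degree \<mu> = degree (s * b)"
        using sr(3) by (metis add.right_neutral degree_add_eq_left)
      then have "degree s < degree \<mu>"
        using s0 b0 False degb by (simp add: degree_mult_eq)
      then have ps: "poly s x \<noteq> 0"
        using \<mu> sr(1) s0 unfolding minimal_polynomial_def by force
      have pb: "poly b x \<noteq> 0"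
        using \<mu> bF(1) b0 degb less.prems(3) unfolding minimal_polynomial_def by force
      have pr: "poly r x = - (poly s x * poly b x)"
        using \<mu>F(3) sr(3) by (simp add: add_eq_0_iff)
      then have "r \<noteq> 0"
        using ps pb by auto
      then have "inverse (poly r x) \<in> adjoin F x"
        using less.hyps[of r] sr degb less.prems(3) by auto
      moreover have "poly s x \<in> adjoin F x"
        using sr(1) by (auto simp: adjoin_def)
      ultimately have "- (poly s x * inverse (poly r x)) \<in> adjoin F x"
        using ring(1) by (intro is_subring_closed)
      then show ?thesis
        using ps pb by (simp add: pr field_simps)
    qed
    moreover have "poly q x = inverse c * poly b x"
      using c by (simp add: b_def)
    ultimately show ?case
      using c ring is_subring_mult by (auto simp: inverse_mult_distrib)
  qed
  have "inverse y \<in> adjoin F x" if "y \<in> adjoin F x" for y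
    using that
  proof (rule adjoinE)
    fix q assume q: "q \<in> polys_over F" "y = poly q x"
    obtain s r where sr: "r \<in> polys_over F" "q = s * \<mu> + r" "r = 0 \<or> degree r < degree \<mu>"
      using polys_over_division[OF sub \<mu>F(1,2) q(1)] by blast
    then have "y = poly r x"
      using q(2) \<mu>F(3) by simp
    then show ?thesis
      using sr inv[of r] ring(1) is_subring_0 by (cases "r = 0") auto
  qed
  then show ?thesis
    using ring by (auto simp: is_subfield_def)
qed

text \<open>The extension evaluates at \<open>y\<close> the image of a chosen representing
  polynomial. Two representatives of an element differ by a multiple of \<open>\<mu>\<close>, whose
  image vanishes at \<open>y\<close>, so the choice does not matter.\<close>

theorem extend_hom:
  assumes F: "is_subfield F" and \<phi>: "is_hom_on F \<phi>"
    and \<mu>: "minimal_polynomial F x \<mu>" and y: "poly (map_poly \<phi> \<mu>) y = 0"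
  shows "\<exists>\<psi>. is_hom_on (adjoin F x) \<psi> \<and> (\<forall>z\<in>F. \<psi> z = \<phi> z) \<and> \<psi> x = y"
proof -
  have sub: "is_subring F"
    using F by (rule is_subfield_subring)
  note hom = hom_on_0[OF sub \<phi>] hom_on_1[OF sub \<phi>]
  define rep where "rep = (\<lambda>z. SOME q. q \<in> polys_over F \<and> z = poly q x)"
  define \<psi> where "\<psi> = (\<lambda>z. poly (map_poly \<phi> (rep z)) y)"
  have eq: "\<psi> (poly q x) = poly (map_poly \<phi> q) y" if q: "q \<in> polys_over F" for q
  proof -
    have r: "rep (poly q x) \<in> polys_over F" "poly q x = poly (rep (poly q x)) x"
      unfolding rep_def using someI[of "\<lambda>r. r \<in> polys_over F \<and> poly q x = poly r x" q] q by auto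
    have "poly (q - rep (poly q x)) x = 0"
      using r(2) by simp
    then obtain s where s: "s \<in> polys_over F" "q - rep (poly q x) = s * \<mu>"
      using minimal_polynomial_dvd[OF F \<mu>, of "q - rep (poly q x)"] polys_over_diff[OF sub q r(1)]
      by blast
    have "map_poly \<phi> q - map_poly \<phi> (rep (poly q x)) = map_poly \<phi> (s * \<mu>)"
      using map_hom_diff[OF sub \<phi> q r(1)] s(2) by simp
    also have "\<dots> = map_poly \<phi> s * map_poly \<phi> \<mu>"
      using map_hom_mult[OF sub \<phi> s(1)] \<mu> by (simp add: minimal_polynomial_def)
    finally have "poly (map_poly \<phi> q) y - poly (map_poly \<phi> (rep (poly q x))) y = 0"
      using y by (metis poly_diff mult_zero_right poly_mult)
    then show ?thesis
      by (simp add: \<psi>_def)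
  qed
  have "is_hom_on (adjoin F x) \<psi>"
    unfolding is_hom_on_def
  proof (intro conjI ballI)
    show "\<psi> 1 = 1"
      using eq[of 1] polys_over_1[OF sub] hom by (simp add: map_poly_1)
    fix a b assume "a \<in> adjoin F x" "b \<in> adjoin F x"
    then obtain q r where qr: "q \<in> polys_over F" "a = poly q x" "r \<in> polys_over F" "b = poly r x"
      by (auto elim!: adjoinE)
    show "\<psi> (a + b) = \<psi> a + \<psi> b"
      using eq[of "q + r"] eq[of q] eq[of r] qr polys_over_add[OF sub] map_hom_add[OF sub \<phi>]
      by simp
    show "\<psi> (a * b) = \<psi> a * \<psi> b"
      using eq[of "q * r"] eq[of q] eq[of r] qr polys_over_mult[OF sub] map_hom_mult[OF sub \<phi>]
      by simp
  qed
  moreover have "\<psi> z = \<phi> z" if "z \<in> F" for z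
    using eq[of "[:z:]"] polys_over_pCons[OF that polys_over_0[OF sub]] hom
    by (simp add: map_poly_pCons)
  moreover have "\<psi> x = y"
    using eq[of "[:0, 1:]"] hom is_subring_0[OF sub] is_subring_1[OF sub] polys_over_0[OF sub]
    by (simp add: map_poly_pCons polys_over_pCons)
  ultimately show ?thesis
    by blast
qed

text \<open>The target is the complex numbers, where the image of each minimal polynomial has a
  root; the elements of \<open>S\<close> can therefore be adjoined one at a time.\<close>

lemma extend_hom_finite:
  fixes \<phi> :: "'a::field \<Rightarrow> complex"
  assumes "finite S" "is_subfield F" "is_hom_on F \<phi>" "\<And>x. x \<in> S \<Longrightarrow> algebraic_over F x"
  shows "\<exists>E \<psi>. is_subfield E \<and> F \<subseteq> E \<and> S \<subseteq> E \<and> is_hom_on E \<psi> \<and> (\<forall>z\<in>F. \<psi> z = \<phi> z)"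
  using assms
proof (induction S)
  case (insert x S)
  then obtain E \<psi> where E: "is_subfield E" "F \<subseteq> E" "S \<subseteq> E" "is_hom_on E \<psi>"
    "\<forall>z\<in>F. \<psi> z = \<phi> z"
    by auto
  have alg: "algebraic_over E x"
    using insert.prems E(2) algebraic_over_mono by blast
  then obtain \<mu> where \<mu>: "minimal_polynomial E x \<mu>"
    using minimal_polynomial_exists E(1) by blast
  have sub: "is_subring E"
    using E(1) by (rule is_subfield_subring)
  \<comment> \<open>The image must be nonconstant to have a root; being monic, \<open>\<mu>\<close>
    keeps its degree.\<close>
  have "coeff (map_poly \<psi> \<mu>) (degree \<mu>) = 1"
    using \<mu> by (simp add: coeff_map_hom[OF sub E(4)] minimal_polynomial_def hom_on_1[OF sub E(4)])
  then have "degree (map_poly \<psi> \<mu>) > 0"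
    using minimal_polynomial_degree[OF \<mu>] le_degree[of "map_poly \<psi> \<mu>" "degree \<mu>"] by simp
  then obtain y where "poly (map_poly \<psi> \<mu>) y = 0"
    using fundamental_theorem_of_algebra[of "map_poly \<psi> \<mu>"] by (auto simp: constant_degree)
  then obtain \<psi>' where \<psi>': "is_hom_on (adjoin E x) \<psi>'" "\<forall>z\<in>E. \<psi>' z = \<psi> z"
    using extend_hom[OF E(1,4) \<mu>] by blast
  show ?case
    using is_subfield_adjoin[OF E(1) alg] is_subring_adjoin[OF sub, of x] \<psi>' E
    by (intro exI[of _ "adjoin E x"] exI[of _ \<psi>']) auto
qed blast

section \<open>Automorphisms of splitting fields over the rationals\<close>

lemma complex_ring_simps [simp]:
  "carrier complex_ring = UNIV" "monoid.mult complex_ring = (*)" "one complex_ring = 1"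
  "zero complex_ring = 0" "add complex_ring = (+)"
  by (auto simp: ring_of_type_algebra_def fun_eq_iff)

lemma field_complex_ring: "field complex_ring"
  by (rule field_from_type_algebra)

lemma ring_complex_ring: "ring complex_ring"
  using field_complex_ring by (simp add: field_def domain_def cring_def)

lemma complex_ring_a_inv [simp]: "\<ominus>\<^bsub>complex_ring\<^esub> x = - x"
  proof -
  interpret CR: field complex_ring by (rule field_complex_ring)
  show ?thesis
    using CR.minus_equality[of "- x" x] by simp
qed

lemma complex_ring_m_inv [simp]: "x \<noteq> 0 \<Longrightarrow> inv\<^bsub>complex_ring\<^esub> x = inverse x"
  proof -
  interpret CR: field complex_ring by (rule field_complex_ring)
  show "x \<noteq> 0 \<Longrightarrow> ?thesis"
    using CR.inv_char[of x "inverse x"] by simp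
qed

lemma subfield_complex_ring_iff: "subfield F complex_ring \<longleftrightarrow> is_subfield F"
proof
  assume F: "subfield F complex_ring"
  have r: "subring F complex_ring"
    using F by (rule subfieldE)
  have closed: "1 \<in> F" "\<And>x. x \<in> F \<Longrightarrow> - x \<in> F" "\<And>x y. x \<in> F \<Longrightarrow> y \<in> F \<Longrightarrow> x * y \<in> F"
    "\<And>x y. x \<in> F \<Longrightarrow> y \<in> F \<Longrightarrow> x + y \<in> F" "0 \<in> F"
    using subringE[OF r] by auto
  have "x - y \<in> F" if "x \<in> F" "y \<in> F" for x y
    using closed(4)[OF that(1) closed(2)[OF that(2)]] by simp
  moreover have "inverse x \<in> F" if "x \<in> F" for x
    using ring.subfield_m_inv(1)[OF ring_complex_ring F, of x] that closed(5) by (cases "x = 0") auto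
  ultimately show "is_subfield F"
    using closed by (auto simp: is_subfield_def is_subring_def)
next
  assume F: "is_subfield F"
  then have r: "is_subring F"
    by (rule is_subfield_subring)
  show "subfield F complex_ring"
  proof (rule field.subfieldI'[OF field_complex_ring])
    show "subring F complex_ring"
      by (rule ring.subringI[OF ring_complex_ring]) (use r in \<open>auto intro: is_subring_closed\<close>)
  qed (use F is_subfield_inverse in auto)
qed

lemma is_subfield_generate: "is_subfield (generate_field complex_ring H)"
  using field.generate_field_is_subfield[OF field_complex_ring, of H] by (simp add: subfield_complex_ring_iff)

lemma generate_field_least: "is_subfield F \<Longrightarrow> H \<subseteq> F \<Longrightarrow> generate_field complex_ring H \<subseteq> F"
  using field.generate_field_min_subfield1[OF field_complex_ring, of H F] by (simp add: subfield_complex_ring_iff)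

lemma is_subfield_Rats: "is_subfield (\<rat> :: complex set)"
  by (auto simp: is_subfield_def is_subring_def)

lemma field_automorphisms_iff:
  "\<sigma> \<in> field_automorphisms K L \<longleftrightarrow> is_hom_on L \<sigma> \<and> \<sigma> \<in> Bij L \<and> (\<forall>x\<in>K. \<sigma> x = x)"
  unfolding field_automorphisms_def is_hom_on_def ring_hom_def
  by (auto simp: Bij_def bij_betw_def)

lemma eval_complex_ring: "ring.eval complex_ring p x = poly (Poly (rev p)) x"
proof -
  have pow: "x [^]\<^bsub>complex_ring\<^esub> k = x ^ k" for x :: complex and k :: nat
    by (induction k) auto
  show ?thesis
    by (induction p)
      (auto simp: Poly_append poly_monom pow ring.eval.simps[OF ring_complex_ring])
qed

text \<open>The algebraic numbers form a subfield by \<open>subfield_of_algebraics\<close>. The work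
  lies in matching two notions of polynomial: the record version uses coefficient lists with the
  leading coefficient first, hence the reversals.\<close>

lemma algebraic_over_Rats_generate:
  assumes "\<And>x. x \<in> H \<Longrightarrow> algebraic_over \<rat> x" and "x \<in> generate_field complex_ring H"
  shows "algebraic_over \<rat> x"
proof -
  interpret CR: field complex_ring by (rule field_complex_ring)
  have Q: "subfield \<rat> complex_ring"
    using is_subfield_Rats by (simp add: subfield_complex_ring_iff)
  have iff: "(CR.algebraic over \<rat>) y \<longleftrightarrow> algebraic_over \<rat> y" for y
  proof
    assume "(CR.algebraic over \<rat>) y"
    then obtain p where p: "p \<in> carrier (\<rat>[X]\<^bsub>complex_ring\<^esub>)" "p \<noteq> []" "CR.eval p y = 0"
      using CR.algebraicE[OF subfieldE(1)[OF Q], of y] by auto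
    have pl: "set p \<subseteq> \<rat>" "hd p \<noteq> 0"
      using p by (auto simp: univ_poly_def polynomial_def)
    have "coeff (Poly (rev p)) (length p - 1) = hd p"
      using p(2) by (simp add: nth_default_def rev_nth hd_conv_nth)
    then have "Poly (rev p) \<noteq> 0"
      using pl(2) by force
    moreover have "coeff (Poly (rev p)) i \<in> \<rat>" for i
      using pl(1) by (auto simp: nth_default_def rev_nth)
    ultimately show "algebraic_over \<rat> y"
      using p(3) unfolding algebraic_over_def polys_over_def eval_complex_ring by blast
  next
    assume "algebraic_over \<rat> y"
    then obtain q where q: "q \<in> polys_over \<rat>" "q \<noteq> 0" "poly q y = 0"
      by (auto simp: algebraic_over_def)
    have "set (rev (coeffs q)) \<subseteq> range (coeff q)"
      by (auto simp: range_coeff)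
    also have "\<dots> \<subseteq> \<rat>"
      using q(1) by (auto simp: polys_over_def)
    finally have "set (rev (coeffs q)) \<subseteq> \<rat>" .
    then have "rev (coeffs q) \<in> carrier (\<rat>[X]\<^bsub>complex_ring\<^esub>)"
      using q(2) by (auto simp: univ_poly_def polynomial_def hd_rev last_coeffs_eq_coeff_degree)
    moreover have "CR.eval (rev (coeffs q)) y = 0"
      using q(3) by (simp add: eval_complex_ring)
    ultimately show "(CR.algebraic over \<rat>) y"
      using CR.algebraicI[of "rev (coeffs q)" \<rat> y] q(2) by simp
  qed
  have "subfield {y. algebraic_over \<rat> y} complex_ring"
    using CR.subfield_of_algebraics[OF Q] by (simp add: iff)
  then show ?thesis
    using generate_field_least[of "{y. algebraic_over \<rat> y}" H] assms
    by (auto simp: subfield_complex_ring_iff)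
qed

lemma hom_on_Rats:
  fixes \<phi> :: "complex \<Rightarrow> complex"
  assumes F: "is_subfield F" and \<phi>: "is_hom_on F \<phi>" and x: "x \<in> \<rat>"
  shows "\<phi> x = x"
proof -
  have sub: "is_subring F"
    using F by (rule is_subfield_subring)
  obtain a b :: int where ab: "x = of_int a / of_int b"
    using x by (auto elim!: Rats_cases' )
  have mem: "of_int a \<in> F" "of_int b \<in> F" "inverse (of_int b) \<in> F"
    using F sub by (auto intro: is_subring_of_int is_subfield_inverse)
  have "\<phi> (of_int a * inverse (of_int b)) = of_int a * inverse (of_int b)"
    using mem by (simp add: hom_on_mult[OF sub \<phi>] hom_on_inverse[OF sub \<phi>] hom_on_of_int[OF sub \<phi>])
  then show ?thesis
    by (simp add: ab divide_inverse)
qed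

lemma Rats_subset_subfield:
  assumes "is_subfield F"
  shows "(\<rat> :: complex set) \<subseteq> F"
proof
  fix x :: complex assume "x \<in> \<rat>"
  then obtain a b :: int where ab: "x = of_int a / of_int b"
    by (auto elim!: Rats_cases')
  then show "x \<in> F"
    using assms by (auto simp: divide_inverse is_subfield_def intro!: is_subring_closed)
qed

section \<open>The Galois group of a rational polynomial\<close>

locale rational_poly =
  fixes f :: "complex poly"
  assumes f_Rats: "f \<in> polys_over \<rat>" and f_nonzero: "f \<noteq> 0"
begin

definition S :: "complex set" where "S = complex_roots f"
definition L :: "complex set" where "L = splitting_field \<rat> f"
definition G :: "(complex \<Rightarrow> complex) set" where "G = field_automorphisms \<rat> L"

lemma finite_S: "finite S"
  using poly_roots_finite[OF f_nonzero] by (simp add: S_def complex_roots_def)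

lemma subfield_L: "is_subfield L"
  unfolding L_def splitting_field_def by (rule is_subfield_generate)

lemma subring_L: "is_subring L"
  using subfield_L by (rule is_subfield_subring)

lemma S_subset_L: "S \<subseteq> L"
  unfolding L_def S_def splitting_field_def using generate_field.incl[of _ "\<rat> \<union> complex_roots f"] by blast

lemma Rats_subset_L: "\<rat> \<subseteq> L"
  using subfield_L by (rule Rats_subset_subfield)

lemma L_least: "is_subfield F \<Longrightarrow> S \<subseteq> F \<Longrightarrow> L \<subseteq> F"
  unfolding L_def splitting_field_def S_def
  by (intro generate_field_least) (auto dest: Rats_subset_subfield)

lemma algebraic_L:
  assumes "x \<in> L"
  shows "algebraic_over \<rat> x"
proof (rule algebraic_over_Rats_generate[of "\<rat> \<union> S"])
  show "x \<in> generate_field complex_ring (\<rat> \<union> S)"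
    using assms by (simp add: L_def splitting_field_def S_def)
  fix y assume "y \<in> \<rat> \<union> S"
  then show "algebraic_over \<rat> y"
  proof
    assume "y \<in> \<rat>"
    then have "[:- y, 1:] \<in> polys_over \<rat>"
      by (intro polys_over_pCons polys_over_0) (auto intro: is_subfield_subring is_subfield_Rats)
    then show ?thesis
      unfolding algebraic_over_def by (intro bexI[of _ "[:- y, 1:]"]) auto
  next
    assume "y \<in> S"
    then show ?thesis
      using f_Rats f_nonzero by (auto simp: algebraic_over_def S_def complex_roots_def)
  qed
qed

lemma G_iff: "\<sigma> \<in> G \<longleftrightarrow> is_hom_on L \<sigma> \<and> \<sigma> \<in> Bij L"
  using hom_on_Rats[OF subfield_L] by (auto simp: G_def field_automorphisms_iff)

lemma G_hom: "\<sigma> \<in> G \<Longrightarrow> is_hom_on L \<sigma>"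
  by (simp add: G_iff)

lemma G_mem_L: "\<sigma> \<in> G \<Longrightarrow> x \<in> L \<Longrightarrow> \<sigma> x \<in> L"
  by (auto simp: G_iff Bij_def bij_betw_def)

lemma G_inj: "\<sigma> \<in> G \<Longrightarrow> inj_on \<sigma> L"
  by (auto simp: G_iff Bij_def bij_betw_def)

lemma G_Rats: "\<sigma> \<in> G \<Longrightarrow> x \<in> \<rat> \<Longrightarrow> \<sigma> x = x"
  using hom_on_Rats[OF subfield_L G_hom] by blast

lemma hom_inj:
  fixes \<psi> :: "complex \<Rightarrow> complex"
  assumes "is_hom_on L \<psi>"
  shows "inj_on \<psi> L"
proof (rule inj_onI, rule ccontr)
  fix x y assume xy: "x \<in> L" "y \<in> L" "\<psi> x = \<psi> y" "x \<noteq> y"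
  have "x - y \<in> L"
    using xy subring_L by (intro is_subring_closed)
  then have "\<psi> (x - y) \<noteq> 0"
    using hom_on_nonzero[OF subring_L assms, of "x - y"] xy is_subfield_inverse[OF subfield_L] by auto
  then show False
    using xy hom_on_diff[OF subring_L assms] by simp
qed

lemma hom_root:
  fixes \<psi> :: "complex \<Rightarrow> complex"
  assumes \<psi>: "is_hom_on L \<psi>" and x: "x \<in> S"
  shows "\<psi> x \<in> S"
proof -
  have fL: "f \<in> polys_over L"
    using f_Rats Rats_subset_L by (auto simp: polys_over_def)
  have "map_poly \<psi> f = f"
    using hom_on_Rats[OF subfield_L \<psi>] f_Rats
    by (intro poly_eqI) (simp add: coeff_map_hom[OF subring_L \<psi>] polys_over_coeff)
  then have "poly f (\<psi> x) = \<psi> (poly f x)"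
    using hom_on_poly[OF subring_L \<psi> fL, of x] x S_subset_L by auto
  then show ?thesis
    using x hom_on_0[OF subring_L \<psi>] by (simp add: S_def complex_roots_def)
qed

lemma hom_image_S:
  fixes \<psi> :: "complex \<Rightarrow> complex"
  assumes \<psi>: "is_hom_on L \<psi>"
  shows "\<psi> ` S = S"
proof (rule card_subset_eq[OF finite_S])
  show "\<psi> ` S \<subseteq> S"
    using hom_root[OF \<psi>] by auto
  show "card (\<psi> ` S) = card S"
    using hom_inj[OF \<psi>] S_subset_L by (intro card_image) (auto dest: inj_on_subset)
qed

text \<open>Normality of the splitting field. An embedding of \<open>L\<close> permutes the roots,
  so both its image and the set of elements that it keeps inside \<open>L\<close> are subfields
  containing \<open>S\<close>; by minimality of \<open>L\<close> each contains
  \<open>L\<close>.\<close>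

lemma hom_restrict_G:
  fixes \<psi> :: "complex \<Rightarrow> complex"
  assumes \<psi>: "is_hom_on L \<psi>"
  shows "restrict \<psi> L \<in> G"
proof -
  note hom = hom_on_1[OF subring_L \<psi>] hom_on_diff[OF subring_L \<psi>] hom_on_mult[OF subring_L \<psi>]
  have "is_subfield (\<psi> ` L)"
    unfolding is_subfield_def is_subring_def
  proof (intro conjI ballI)
    show "1 \<in> \<psi> ` L"
      using hom(1) is_subring_1[OF subring_L] by (metis imageI)
    fix y assume "y \<in> \<psi> ` L"
    then obtain x where x: "y = \<psi> x" "x \<in> L" by blast
    have "inverse x \<in> L"
      using x subfield_L is_subfield_inverse by blast
    then show "inverse y \<in> \<psi> ` L"
      using hom_on_inverse[OF subring_L \<psi> x(2)] x by (metis imageI)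
    fix y' assume "y' \<in> \<psi> ` L"
    then obtain x' where x': "y' = \<psi> x'" "x' \<in> L" by blast
    have "x - x' \<in> L" "x * x' \<in> L"
      using x x' subring_L by (auto intro: is_subring_closed)
    then show "y - y' \<in> \<psi> ` L" "y * y' \<in> \<psi> ` L"
      using hom x x' by (metis imageI)+
  qed
  moreover have "S \<subseteq> \<psi> ` L"
    using hom_image_S[OF \<psi>] S_subset_L by blast
  ultimately have "L \<subseteq> \<psi> ` L"
    by (rule L_least)
  moreover have "\<psi> ` L \<subseteq> L"
  proof -
    define E where "E = {x \<in> L. \<psi> x \<in> L}"
    have "is_subfield E"
      using subfield_L subring_L hom hom_on_inverse[OF subring_L \<psi>]
      unfolding is_subfield_def is_subring_def E_def by auto
    moreover have "S \<subseteq> E"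
      using S_subset_L hom_root[OF \<psi>] by (auto simp: E_def)
    ultimately show ?thesis
      using L_least by (auto simp: E_def)
  qed
  ultimately have "bij_betw \<psi> L L"
    using hom_inj[OF \<psi>] by (auto simp: bij_betw_def)
  then have "restrict \<psi> L \<in> Bij L"
    by (auto simp: Bij_def bij_betw_def inj_on_def)
  moreover have "is_hom_on L (restrict \<psi> L)"
    using \<psi> subring_L unfolding is_hom_on_def by (auto intro: is_subring_closed)
  ultimately show ?thesis
    by (simp add: G_iff)
qed

lemma G_compose: "\<sigma> \<in> G \<Longrightarrow> \<tau> \<in> G \<Longrightarrow> compose L \<sigma> \<tau> \<in> G"
  unfolding compose_def
proof (rule hom_restrict_G)
  assume "\<sigma> \<in> G" "\<tau> \<in> G"
  then show "is_hom_on L (\<lambda>x. \<sigma> (\<tau> x))"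
    using G_mem_L[of \<tau>] G_hom[of \<sigma>] G_hom[of \<tau>] by (auto simp: is_hom_on_def)
qed

lemma G_id: "restrict id L \<in> G"
  by (rule hom_restrict_G) (auto simp: is_hom_on_def)

text \<open>The elements on which two automorphisms agree form a subfield, which contains
  \<open>L\<close> as soon as it contains the roots.\<close>

lemma G_eqI:
  assumes \<sigma>: "\<sigma> \<in> G" and \<tau>: "\<tau> \<in> G" and eq: "\<And>x. x \<in> S \<Longrightarrow> \<sigma> x = \<tau> x"
  shows "\<sigma> = \<tau>"
proof -
  note h\<sigma> = G_hom[OF \<sigma>] and h\<tau> = G_hom[OF \<tau>]
  define E where "E = {x \<in> L. \<sigma> x = \<tau> x}"
  have "is_subfield E"
    using subfield_L subring_L
      hom_on_diff[OF subring_L h\<sigma>] hom_on_mult[OF subring_L h\<sigma>] hom_on_inverse[OF subring_L h\<sigma>]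
      hom_on_diff[OF subring_L h\<tau>] hom_on_mult[OF subring_L h\<tau>] hom_on_inverse[OF subring_L h\<tau>]
      hom_on_1[OF subring_L h\<tau>] hom_on_1[OF subring_L h\<sigma>]
    unfolding is_subfield_def is_subring_def E_def by auto
  moreover have "S \<subseteq> E"
    using S_subset_L eq by (auto simp: E_def)
  ultimately have "L \<subseteq> E"
    by (rule L_least)
  then show ?thesis
    using \<sigma> \<tau> by (intro extensionalityI[of _ L]) (auto simp: G_iff Bij_def E_def)
qed

definition root_perm :: "(complex \<Rightarrow> complex) \<Rightarrow> complex \<Rightarrow> complex" where
  "root_perm \<sigma> = (\<lambda>x. if x \<in> S then \<sigma> x else x)"

lemma root_perm_permutes:
  assumes "\<sigma> \<in> G"
  shows "root_perm \<sigma> permutes S"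
proof -
  have "bij_betw (root_perm \<sigma>) S S"
    using hom_image_S[OF G_hom[OF assms]] G_inj[OF assms] S_subset_L
    by (auto simp: bij_betw_def inj_on_def root_perm_def)
  then show ?thesis
    by (intro bij_imp_permutes) (auto simp: root_perm_def)
qed

lemma inj_on_root_perm: "inj_on root_perm G"
proof (rule inj_onI)
  fix \<sigma> \<tau> assume "\<sigma> \<in> G" "\<tau> \<in> G" "root_perm \<sigma> = root_perm \<tau>"
  then show "\<sigma> = \<tau>"
    by (intro G_eqI) (auto simp: root_perm_def fun_eq_iff split: if_splits)
qed

text \<open>The action on the roots is faithful. The explicit bound is what later turns a prime
  above \<open>fact (card S)\<close> into one that does not divide the order of any inertia
  group.\<close>

lemma finite_G: "finite G" and card_G_le: "card G \<le> fact (card S)"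
proof -
  have sub: "root_perm ` G \<subseteq> {\<pi>. \<pi> permutes S}"
    using root_perm_permutes by auto
  have fin: "finite {\<pi>. \<pi> permutes S}"
    by (rule finite_permutations[OF finite_S])
  show "finite G"
    using finite_subset[OF sub fin] inj_on_root_perm by (simp add: finite_image_iff)
  have "card G = card (root_perm ` G)"
    using inj_on_root_perm by (simp add: card_image)
  also have "\<dots> \<le> card {\<pi>. \<pi> permutes S}"
    by (rule card_mono[OF fin sub])
  also have "\<dots> = fact (card S)"
    by (rule card_permutations[OF refl finite_S])
  finally show "card G \<le> fact (card S)" .
qed

text \<open>Every root \<open>y\<close> of the minimal polynomial is the image of \<open>x\<close>
  under an embedding of \<open>L\<close>, and this restricts to an element of \<open>G\<close>;
  hence \<open>y = x\<close> and the minimal polynomial is a power of one linear factor. An exponent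
  above \<open>1\<close> would make its derivative an annihilator of \<open>x\<close> of smaller
  degree.\<close>

theorem fixed_field:
  assumes x: "x \<in> L" and fixed: "\<And>\<sigma>. \<sigma> \<in> G \<Longrightarrow> \<sigma> x = x"
  shows "x \<in> \<rat>"
proof -
  have Q: "is_subfield (\<rat> :: complex set)"
    by (rule is_subfield_Rats)
  obtain \<mu> where \<mu>: "minimal_polynomial \<rat> x \<mu>"
    using minimal_polynomial_exists[OF Q algebraic_L[OF x]] by blast
  have \<mu>': "\<mu> \<in> polys_over \<rat>" "lead_coeff \<mu> = 1"
    using \<mu> by (auto simp: minimal_polynomial_def)
  have only: "y = x" if y: "poly \<mu> y = 0" for y
  proof -
    have hid: "is_hom_on \<rat> (\<lambda>z::complex. z)"
      by (simp add: is_hom_on_def)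
    have "poly (map_poly (\<lambda>z. z) \<mu>) y = 0"
      using y by (simp add: map_poly_idI)
    then obtain \<psi> where \<psi>: "is_hom_on (adjoin \<rat> x) \<psi>" "\<psi> x = y"
      using extend_hom[OF Q hid \<mu>] by blast
    have alg: "algebraic_over (adjoin \<rat> x) z" if "z \<in> S" for z
    proof (rule algebraic_over_mono)
      show "algebraic_over \<rat> z"
        using that S_subset_L algebraic_L by blast
    qed (rule is_subring_adjoin(2)[OF is_subfield_subring[OF Q]])
    obtain E \<psi>' where E: "is_subfield E" "adjoin \<rat> x \<subseteq> E" "S \<subseteq> E" "is_hom_on E \<psi>'"
      "\<forall>z\<in>adjoin \<rat> x. \<psi>' z = \<psi> z"
      using extend_hom_finite[OF finite_S is_subfield_adjoin[OF Q algebraic_L[OF x]] \<psi>(1) alg]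
      by blast
    have "is_hom_on L \<psi>'"
      using is_hom_on_mono[OF E(4) L_least[OF E(1,3)]] .
    then have "restrict \<psi>' L \<in> G"
      by (rule hom_restrict_G)
    then have "\<psi>' x = x"
      using fixed x by force
    moreover have "\<psi>' x = \<psi> x"
      using E(5) is_subring_adjoin(3)[OF is_subfield_subring[OF Q]] by blast
    ultimately show ?thesis
      using \<psi>(2) by simp
  qed
  obtain r where r: "smult (lead_coeff \<mu>) (\<Prod>i<degree \<mu>. [:- r i, 1:]) = \<mu>"
    by (rule complex_poly_decompose')
  have prod: "\<mu> = (\<Prod>i<degree \<mu>. [:- r i, 1:])"
    using r \<mu>'(2) by simp
  have "r i = x" if "i < degree \<mu>" for i
  proof (rule only)
    have "poly (\<Prod>i<degree \<mu>. [:- r i, 1:]) (r i) = 0"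
      unfolding poly_prod using that by auto
    then show "poly \<mu> (r i) = 0"
      using prod by simp
  qed
  then have pow: "\<mu> = [:- x, 1:] ^ degree \<mu>"
    using prod by simp
  have "degree \<mu> = 1"
  proof (rule ccontr)
    assume "degree \<mu> \<noteq> 1"
    then obtain k where k: "degree \<mu> = Suc (Suc k)"
      using minimal_polynomial_degree[OF \<mu>] by (metis One_nat_def gr0_conv_Suc not0_implies_Suc)
    have "poly (pderiv \<mu>) x = 0"
      by (subst pow, subst k) (simp add: pderiv_power_Suc poly_power del: power_Suc)
    moreover have "pderiv \<mu> \<in> polys_over \<rat>"
      using \<mu>'(1) by (auto simp: polys_over_def coeff_pderiv)
    moreover have "pderiv \<mu> \<noteq> 0"
      using k by (simp add: pderiv_eq_0_iff)
    ultimately have "degree \<mu> \<le> degree (pderiv \<mu>)"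
      using \<mu> unfolding minimal_polynomial_def by blast
    then show False
      using k by (simp add: degree_pderiv)
  qed
  then have "\<mu> = [:- x, 1:]"
    using pow by simp
  then have "- x \<in> \<rat>"
    using polys_over_coeff[OF \<mu>'(1), of 0] by simp
  then show ?thesis
    by simp
qed

text \<open>Left translation by an element of \<open>G\<close> only permutes the summands.\<close>

lemma trace_rational:
  assumes x: "x \<in> L"
  shows "(\<Sum>\<sigma>\<in>G. \<sigma> x) \<in> \<rat>"
proof (rule fixed_field)
  show "(\<Sum>\<sigma>\<in>G. \<sigma> x) \<in> L"
    using x G_mem_L subring_L by (intro is_subring_closed)
  fix \<tau> assume \<tau>: "\<tau> \<in> G"
  have inj: "inj_on (compose L \<tau>) G"
  proof (rule inj_onI)
    fix \<sigma> \<sigma>' assume \<sigma>: "\<sigma> \<in> G" "\<sigma>' \<in> G" and eq: "compose L \<tau> \<sigma> = compose L \<tau> \<sigma>'"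
    have "\<sigma> z = \<sigma>' z" if "z \<in> S" for z
    proof -
      have z: "z \<in> L" using that S_subset_L by blast
      then have "\<tau> (\<sigma> z) = \<tau> (\<sigma>' z)"
        using fun_cong[OF eq, of z] by (simp add: compose_def)
      then show ?thesis
        using inj_onD[OF G_inj[OF \<tau>]] \<sigma> z G_mem_L by blast
    qed
    then show "\<sigma> = \<sigma>'"
      using \<sigma> by (intro G_eqI)
  qed
  have img: "compose L \<tau> ` G = G"
    using G_compose[OF \<tau>] by (intro card_subset_eq[OF finite_G]) (auto simp: card_image[OF inj])
  have "\<tau> (\<Sum>\<sigma>\<in>G. \<sigma> x) = (\<Sum>\<sigma>\<in>G. \<tau> (\<sigma> x))"
    using x G_mem_L by (intro hom_on_sum[OF subring_L G_hom[OF \<tau>]])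
  also have "\<dots> = (\<Sum>\<sigma>\<in>G. compose L \<tau> \<sigma> x)"
    using x by (simp add: compose_def)
  also have "\<dots> = (\<Sum>\<sigma>\<in>compose L \<tau> ` G. \<sigma> x)"
    using inj by (simp add: sum.reindex)
  finally show "\<tau> (\<Sum>\<sigma>\<in>G. \<sigma> x) = (\<Sum>\<sigma>\<in>G. \<sigma> x)"
    by (simp add: img)
qed

end

section \<open>Inertia\<close>

context valuation_ring
begin

lemma M_diff_iff: "x - y \<in> M \<Longrightarrow> x \<in> M \<longleftrightarrow> y \<in> M"
  using M_diff[of x "x - y"] M_add[of "x - y" y] by auto

lemma M_prod_cong:
  assumes "finite S" "\<And>i. i \<in> S \<Longrightarrow> f i \<in> A" "\<And>i. i \<in> S \<Longrightarrow> g i \<in> A"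
    "\<And>i. i \<in> S \<Longrightarrow> f i - g i \<in> M"
  shows "prod f S - prod g S \<in> M"
  using assms
proof (induction S)
  case (insert i S)
  have "prod f S \<in> A"
    using insert.prems subring by (intro is_subring_prod) auto
  then have "(f i - g i) * prod f S + g i * (prod f S - prod g S) \<in> M"
    using insert by (intro M_add M_mult_left M_mult_right) auto
  then show ?case
    using insert by (simp add: algebra_simps)
qed (simp add: zero_in_M)

text \<open>Modulo \<open>M\<close> a root in \<open>M\<close> contributes a factor \<open>X\<close>
  and any other root a factor with unit constant term. The number of roots in \<open>M\<close> is
  thus the index of the first coefficient outside \<open>M\<close>, which is how the coefficients of
  a polynomial count colliding roots.\<close>

lemma coeff_prod_linear:
  fixes Z :: "'a set"
  assumes "finite Z" "Z \<subseteq> A"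
  defines "g \<equiv> (\<Prod>x\<in>Z. [:- x, 1:])"
  shows "(\<forall>j. coeff g j \<in> A) \<and> (\<forall>j<card (Z \<inter> M). coeff g j \<in> M) \<and> coeff g (card (Z \<inter> M)) \<notin> M"
  using assms(1,2) unfolding g_def
proof (induction Z)
  case empty
  then show ?case
    using subring one_notin_M by (auto simp: coeff_1 intro: is_subring_0 is_subring_1)
next
  case (insert x Z)
  define h where "h = (\<Prod>x\<in>Z. [:- x, 1:])"
  define k where "k = card (Z \<inter> M)"
  have IH: "\<And>j. coeff h j \<in> A" "\<And>j. j < k \<Longrightarrow> coeff h j \<in> M" "coeff h k \<notin> M"
    using insert by (auto simp: h_def k_def)
  have x: "x \<in> A"
    using insert by auto
  have co: "coeff ([:- x, 1:] * h) j = (if j = 0 then 0 else coeff h (j - 1)) - x * coeff h j" for j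
    by (cases j) auto
  have inA: "coeff ([:- x, 1:] * h) j \<in> A" for j
    unfolding co using IH x subring by (auto intro!: is_subring_closed)
  have "(\<forall>j<card (insert x Z \<inter> M). coeff ([:- x, 1:] * h) j \<in> M) \<and>
      coeff ([:- x, 1:] * h) (card (insert x Z \<inter> M)) \<notin> M"
  proof (cases "x \<in> M")
    case True
    have c: "card (insert x Z \<inter> M) = Suc k"
      using True insert by (simp add: k_def)
    have xh: "x * coeff h j \<in> M" for j
      using True IH(1) by (intro M_mult_right)
    have "coeff ([:- x, 1:] * h) j \<in> M" if "j < Suc k" for j
      unfolding co using that xh IH(2)[of "j - 1"] zero_in_M by (intro M_diff) auto
    moreover have "coeff ([:- x, 1:] * h) (Suc k) - coeff h k \<in> M"
      unfolding co using M_minus[OF xh] by simp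
    ultimately show ?thesis
      unfolding c using IH(3) M_diff_iff by blast
  next
    case False
    have c: "card (insert x Z \<inter> M) = k"
      using False by (simp add: k_def)
    have lower: "(if j = 0 then 0 else coeff h (j - 1)) \<in> M" if "j \<le> k" for j
      using that IH(2)[of "j - 1"] zero_in_M by auto
    have "coeff ([:- x, 1:] * h) j \<in> M" if "j < k" for j
      unfolding co using lower[of j] that IH(2)[of j] x by (intro M_diff M_mult_left) auto
    moreover have "x * coeff h k \<notin> M"
      using M_prime[OF x IH(1)] False IH(3) by blast
    then have "coeff ([:- x, 1:] * h) k \<notin> M"
      unfolding co using M_diff[OF lower[of k], of "(if k = 0 then 0 else coeff h (k - 1)) - x * coeff h k"]
      by auto
    ultimately show ?thesis
      unfolding c by blast
  qed
  then show ?case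
    using inA insert.hyps by (simp add: h_def)
qed

end

text \<open>\<open>A\<close> plays the role of a prime of the splitting field above
  \<open>p\<close>. The size of \<open>p\<close> encodes tameness: every subgroup of
  \<open>G\<close> has order below \<open>p\<close>.\<close>

locale tame_prime = rational_poly f + valuation_ring A
  for f :: "complex poly" and A :: "complex set" +
  fixes p :: nat
  assumes prime_p: "prime p" and p_notunit: "inverse (of_nat p) \<notin> A"
    and p_large: "fact (card S) < p"
begin

lemma of_nat_p_in_M: "of_nat p \<in> M"
  using p_notunit subring by (auto simp: M_def is_subring_of_nat)

lemma of_int_in_M_iff: "of_int k \<in> M \<longleftrightarrow> int p dvd k"
proof
  assume "int p dvd k"
  then obtain c where c: "k = int p * c" by auto
  have "of_nat p * of_int c \<in> M"
    using of_nat_p_in_M subring by (intro M_mult_right is_subring_of_int)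
  then show "of_int k \<in> M"
    by (simp add: c)
next
  assume k: "of_int k \<in> M"
  show "int p dvd k"
  proof (rule ccontr)
    assume "\<not> int p dvd k"
    then have "coprime (int p) k"
      using prime_p by (simp add: prime_imp_coprime)
    then obtain u v where "u * int p + v * k = 1"
      using coprime_iff_gcd_eq_1 bezout_int by metis
    then have "(of_int u * of_nat p + of_int v * of_int k :: complex) = 1"
      by (metis of_int_1 of_int_add of_int_mult of_int_of_nat_eq)
    moreover have "of_int u * of_nat p + of_int v * of_int k \<in> M"
      using k of_nat_p_in_M subring by (intro M_add M_mult_left) (auto intro: is_subring_of_int)
    ultimately show False
      using one_notin_M by simp
  qed
qed

text \<open>On rational numbers the valuation is the \<open>p\<close>-adic one, so positive
  valuation already means divisibility by \<open>p\<close>. For general elements of \<open>M\<close>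
  ramification prevents this, which is why traces are taken.\<close>

lemma rational_in_M:
  assumes "x \<in> M" "x \<in> \<rat>"
  shows "x / of_nat p \<in> A"
proof -
  obtain a b :: int where ab: "b > 0" "coprime a b" "x = of_int a / of_int b"
    using assms(2) by (auto elim!: Rats_cases')
  have a_eq: "(of_int a :: complex) = of_int b * x"
    using ab by simp
  have "of_int b * x \<in> M"
    using assms(1) subring by (intro M_mult_left is_subring_of_int)
  then have "int p dvd a"
    by (simp only: a_eq[symmetric] of_int_in_M_iff)
  then obtain c where c: "a = int p * c" by auto
  have "\<not> int p dvd b"
    using \<open>int p dvd a\<close> ab(2) prime_p by (metis coprime_common_divisor not_prime_unit prime_nat_int_transfer)
  then have "of_int b \<notin> M"
    using of_int_in_M_iff[of b] by blast
  then have "inverse (of_int b) \<in> A"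
    using subring by (intro inverse_mem is_subring_of_int)
  then have "of_int c * inverse (of_int b) \<in> A"
    using subring by (intro is_subring_closed)
  moreover have "x / of_nat p = of_int c * inverse (of_int b)"
    using ab c prime_p by (simp add: field_simps)
  ultimately show ?thesis
    by simp
qed

text \<open>The intersection of all conjugates of \<open>A \<inter> L\<close>. It is stable under
  \<open>G\<close> and serves as the ring of \<open>p\<close>-integral elements of
  \<open>L\<close>.\<close>

definition R :: "complex set" where
  "R = {x \<in> L. \<forall>\<sigma>\<in>G. \<sigma> x \<in> A}"

text \<open>The inertia group of the prime ideal \<open>R \<inter> M\<close>. Because
  \<open>R\<close> itself is stable under \<open>G\<close>, closure under composition is immediate
  and no decomposition group has to be introduced.\<close>

definition I :: "(complex \<Rightarrow> complex) set" where
  "I = {\<tau> \<in> G. \<forall>x\<in>R. \<tau> x - x \<in> M}"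

lemma R_subset_L: "R \<subseteq> L"
  by (auto simp: R_def)

lemma R_subset_A: "R \<subseteq> A"
  using G_id by (force simp: R_def)

lemma subring_R: "is_subring R"
proof -
  have "x - y \<in> R \<and> x * y \<in> R" if "x \<in> R" "y \<in> R" for x y
    using that subring subring_L
    by (auto simp: R_def hom_on_diff[OF subring_L G_hom] hom_on_mult[OF subring_L G_hom]
        intro: is_subring_diff is_subring_mult)
  moreover have "1 \<in> R"
    using subring subring_L by (auto simp: R_def hom_on_1[OF subring_L G_hom] intro: is_subring_1)
  ultimately show ?thesis
    by (auto simp: is_subring_def)
qed

lemma G_mem_R: "\<sigma> \<in> G \<Longrightarrow> x \<in> R \<Longrightarrow> \<sigma> x \<in> R"
  using G_mem_L G_compose by (force simp: R_def compose_def)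

lemma S_subset_R:
  assumes "lead_coeff f = 1" "f \<in> polys_over \<int>"
  shows "S \<subseteq> R"
proof
  fix x assume x: "x \<in> S"
  have "y \<in> A" if "y \<in> \<int>" for y
    using that by (cases rule: Ints_cases) (simp add: is_subring_of_int[OF subring])
  then have "f \<in> polys_over A"
    using assms(2) by (simp add: polys_over_def)
  then have "y \<in> A" if "y \<in> S" for y
    using integral_root_mem[OF assms(1), of y] that by (simp add: S_def complex_roots_def)
  then show "x \<in> R"
    using x S_subset_L hom_root[OF G_hom] by (auto simp: R_def)
qed

lemma I_subset_G: "I \<subseteq> G"
  by (auto simp: I_def)

lemma id_in_I: "restrict id L \<in> I"
  using G_id R_subset_L zero_in_M by (auto simp: I_def)

lemma I_compose: "\<sigma> \<in> I \<Longrightarrow> \<tau> \<in> I \<Longrightarrow> compose L \<sigma> \<tau> \<in> I"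
proof -
  assume \<sigma>: "\<sigma> \<in> I" and \<tau>: "\<tau> \<in> I"
  have "\<sigma> (\<tau> x) - x \<in> M" if "x \<in> R" for x
  proof -
    have "\<tau> x \<in> R"
      using G_mem_R \<tau> that by (auto simp: I_def)
    then have "(\<sigma> (\<tau> x) - \<tau> x) + (\<tau> x - x) \<in> M"
      using \<sigma> \<tau> that by (intro M_add) (auto simp: I_def)
    then show ?thesis by simp
  qed
  then show ?thesis
    using \<sigma> \<tau> G_compose R_subset_L by (auto simp: I_def compose_def)
qed

text \<open>The fixed field of the inertia group is unramified at \<open>p\<close>. For \<open>\<sigma>\<close> outside the inertia
  group choose \<open>y \<sigma>\<close> with \<open>\<sigma> (y \<sigma>) - y \<sigma>\<close> a unit. Expanding the product of the
  \<open>\<sigma> (y \<sigma>) \<otimes> 1 - 1 \<otimes> y \<sigma>\<close> as a sum of \<open>a \<otimes> b\<close>, the sum of the \<open>a * trace (b * z)\<close> is both a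
  multiple of \<open>p\<close> and a unit multiple of \<open>z\<close>.\<close>

theorem inertia_invariant_divisible:
  assumes z: "z \<in> R" and inv: "\<And>\<tau>. \<tau> \<in> I \<Longrightarrow> \<tau> z = z" and zM: "\<And>\<sigma>. \<sigma> \<in> G \<Longrightarrow> \<sigma> z \<in> M"
  shows "z / of_nat p \<in> A"
proof -
  define N where "N = G - I"
  have finN: "finite N"
    using finite_G by (simp add: N_def)
  have "\<forall>\<sigma>\<in>N. \<exists>y\<in>R. \<sigma> y - y \<notin> M"
    by (auto simp: N_def I_def)
  then obtain y where y: "\<And>\<sigma>. \<sigma> \<in> N \<Longrightarrow> y \<sigma> \<in> R" "\<And>\<sigma>. \<sigma> \<in> N \<Longrightarrow> \<sigma> (y \<sigma>) - y \<sigma> \<notin> M"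
    by metis
  \<comment> \<open>\<open>D\<close> is, up to a unit and modulo \<open>M\<close>, the indicator
    function of inertia: for \<open>\<tau>\<close> in \<open>N\<close> the factor with
    \<open>\<sigma> = \<tau>\<close> is zero, and for \<open>\<tau>\<close> in \<open>I\<close> each
    factor is congruent to \<open>\<sigma> (y \<sigma>) - y \<sigma>\<close>, which is not in
    \<open>M\<close>.\<close>
  define D where "D = (\<lambda>\<tau>. \<Prod>\<sigma>\<in>N. \<sigma> (y \<sigma>) - \<tau> (y \<sigma>))"
  define a where "a = (\<lambda>B. \<Prod>\<sigma>\<in>B. \<sigma> (y \<sigma>))"
  define b where "b = (\<lambda>B. \<Prod>\<sigma>\<in>N - B. - y \<sigma>)"
  have yA: "\<tau> (y \<sigma>) \<in> A" if "\<sigma> \<in> N" "\<tau> \<in> G" for \<sigma> \<tau>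
    using y(1)[OF that(1)] that(2) by (auto simp: R_def)
  have yyA: "\<sigma> (y \<sigma>) - \<tau> (y \<sigma>) \<in> A" if "\<sigma> \<in> N" "\<tau> \<in> G" for \<sigma> \<tau>
    using yA[of \<sigma> \<sigma>] yA[of \<sigma> \<tau>] that subring by (auto simp: N_def intro: is_subring_diff)
  have bR: "b B \<in> R" for B
    unfolding b_def using y(1) subring_R by (intro is_subring_closed) auto
  have aA: "a B \<in> A" if "B \<subseteq> N" for B
    unfolding a_def using that yA subring by (intro is_subring_prod) (auto simp: N_def)
  have expand: "D \<tau> = (\<Sum>B\<in>Pow N. a B * \<tau> (b B))" if \<tau>: "\<tau> \<in> G" for \<tau>
  proof -
    have yL: "y \<sigma> \<in> L" if "\<sigma> \<in> N" for \<sigma>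
      using y(1)[OF that] R_subset_L by blast
    have "\<tau> (b B) = (\<Prod>\<sigma>\<in>N - B. - \<tau> (y \<sigma>))" for B
      unfolding b_def using yL subring_L
      by (subst hom_on_prod[OF subring_L G_hom[OF \<tau>]])
        (auto simp: hom_on_minus[OF subring_L G_hom[OF \<tau>]] intro: is_subring_minus)
    moreover have "D \<tau> = (\<Prod>\<sigma>\<in>N. \<sigma> (y \<sigma>) + - \<tau> (y \<sigma>))"
      by (simp add: D_def)
    ultimately show ?thesis
      unfolding a_def using prod_add[OF finN, of "\<lambda>\<sigma>. \<sigma> (y \<sigma>)" "\<lambda>\<sigma>. - \<tau> (y \<sigma>)"] by simp
  qed
  define T where "T = (\<lambda>B. \<Sum>\<tau>\<in>G. \<tau> (b B * z))"
  have zL: "z \<in> L" and bL: "b B \<in> L" for B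
    using z bR[of B] R_subset_L by auto
  have sum1: "(\<Sum>\<tau>\<in>G. \<tau> z * D \<tau>) = (\<Sum>B\<in>Pow N. a B * T B)"
  proof -
    have "(\<Sum>\<tau>\<in>G. \<tau> z * D \<tau>) = (\<Sum>\<tau>\<in>G. \<Sum>B\<in>Pow N. a B * \<tau> (b B * z))"
      using zL bL by (auto intro!: sum.cong
          simp: expand sum_distrib_left hom_on_mult[OF subring_L G_hom] mult_ac)
    also have "\<dots> = (\<Sum>B\<in>Pow N. a B * T B)"
      unfolding T_def by (subst sum.swap) (simp add: sum_distrib_left)
    finally show ?thesis .
  qed
  \<comment> \<open>Here it matters that all conjugates of \<open>z\<close> lie in \<open>M\<close>,
    not just \<open>z\<close>: the whole trace lies in \<open>M\<close>, and being rational it is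
    divisible by \<open>p\<close>.\<close>
  have TA: "T B / of_nat p \<in> A" for B
  proof (rule rational_in_M)
    have "b B * z \<in> L"
      using zL bL subring_L by (intro is_subring_closed)
    then show "T B \<in> \<rat>"
      unfolding T_def by (rule trace_rational)
    show "T B \<in> M"
      unfolding T_def
    proof (rule M_sum)
      fix \<tau> assume \<tau>: "\<tau> \<in> G"
      have "\<tau> (b B) \<in> A"
        using bR[of B] \<tau> by (auto simp: R_def)
      then show "\<tau> (b B * z) \<in> M"
        using zM[OF \<tau>] by (simp add: hom_on_mult[OF subring_L G_hom[OF \<tau>] bL zL] M_mult_left)
    qed
  qed
  have "(\<Sum>\<tau>\<in>G. \<tau> z * D \<tau>) / of_nat p = (\<Sum>B\<in>Pow N. a B * (T B / of_nat p))"
    unfolding sum1 by (simp add: sum_divide_distrib)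
  also have "\<dots> \<in> A"
    using aA TA subring by (intro is_subring_closed) auto
  finally have divA: "(\<Sum>\<tau>\<in>G. \<tau> z * D \<tau>) / of_nat p \<in> A" .
  define s where "s = (\<Sum>\<tau>\<in>I. D \<tau>)"
  have "(\<Sum>\<tau>\<in>G. \<tau> z * D \<tau>) = (\<Sum>\<tau>\<in>I. \<tau> z * D \<tau>)"
  proof (rule sum.mono_neutral_right[OF finite_G I_subset_G], rule ballI)
    fix \<tau> assume "\<tau> \<in> G - I"
    then have "D \<tau> = 0"
      unfolding D_def using finN by (intro prod_zero) (auto simp: N_def)
    then show "\<tau> z * D \<tau> = 0"
      by simp
  qed
  also have "\<dots> = z * s"
    by (simp add: s_def inv sum_distrib_left)
  finally have zs: "z * s / of_nat p \<in> A"
    using divA by simp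
  have finI: "finite I"
    using finite_subset[OF I_subset_G finite_G] .
  define d where "d = (\<Prod>\<sigma>\<in>N. \<sigma> (y \<sigma>) - y \<sigma>)"
  have RA: "x \<in> R \<Longrightarrow> x \<in> A" for x
    using R_subset_A by blast
  have yyA': "\<sigma> (y \<sigma>) - y \<sigma> \<in> A" if "\<sigma> \<in> N" for \<sigma>
    using yA[of \<sigma> \<sigma>] that y(1)[OF that] RA subring by (auto simp: N_def intro: is_subring_diff)
  have dA: "d \<in> A"
    unfolding d_def using yyA' subring by (intro is_subring_prod)
  have dM: "d \<notin> M"
    unfolding d_def using M_prod_iff[of N "\<lambda>\<sigma>. \<sigma> (y \<sigma>) - y \<sigma>"] finN yyA' y(2) by simp
  have "D \<tau> - d \<in> M" if "\<tau> \<in> I" for \<tau>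
    unfolding D_def d_def
  proof (rule M_prod_cong[OF finN])
    fix \<sigma> assume \<sigma>: "\<sigma> \<in> N"
    show "\<sigma> (y \<sigma>) - \<tau> (y \<sigma>) \<in> A" "\<sigma> (y \<sigma>) - y \<sigma> \<in> A"
      using yyA yyA' \<sigma> that I_subset_G by auto
    have "- (\<tau> (y \<sigma>) - y \<sigma>) \<in> M"
      using that y(1)[OF \<sigma>] by (intro M_minus) (auto simp: I_def)
    then show "\<sigma> (y \<sigma>) - \<tau> (y \<sigma>) - (\<sigma> (y \<sigma>) - y \<sigma>) \<in> M"
      by simp
  qed
  then have "(\<Sum>\<tau>\<in>I. D \<tau> - d) \<in> M"
    by (rule M_sum)
  \<comment> \<open>Tameness enters here: \<open>card I\<close> is positive and below
    \<open>p\<close>, hence outside \<open>M\<close>, so \<open>s\<close> is a unit and can be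
    cancelled from \<open>z * s / of_nat p\<close>.\<close>
  then have sd: "s - of_nat (card I) * d \<in> M"
    by (simp add: s_def sum_subtractf)
  have "card I > 0"
    using finI id_in_I by (auto simp: card_gt_0_iff)
  moreover have "card I < p"
    using card_mono[OF finite_G I_subset_G] card_G_le p_large by linarith
  ultimately have "\<not> int p dvd int (card I)"
    using zdvd_not_zless[of "int (card I)" "int p"] by auto
  then have cM: "of_nat (card I) \<notin> M"
    using of_int_in_M_iff[of "int (card I)"] by simp
  have "of_nat (card I) * d \<notin> M"
    using M_prime[OF is_subring_of_nat[OF subring] dA] cM dM by blast
  then have sM: "s \<notin> M"
    using M_diff_iff[OF sd] by blast
  have "s \<in> A"
    unfolding s_def D_def using yyA I_subset_G subring
    by (intro is_subring_sum is_subring_prod) auto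
  then have "z * s / of_nat p * inverse s \<in> A"
    using zs sM subring by (intro is_subring_mult inverse_mem)
  moreover have "s \<noteq> 0"
    using sM zero_in_M by auto
  ultimately show ?thesis
    by (simp add: mult.assoc)
qed

text \<open>An Eisenstein criterion for inertia. If the orbit of \<open>x\<close> missed
  \<open>y\<close>, the product of the orbit and of all elements outside \<open>M\<close> would be
  inertia-invariant with every conjugate in \<open>M\<close>, hence divisible by \<open>p\<close>.
  The complementary product contains \<open>y\<close> and lies in \<open>M\<close>, so the constant
  term divided by \<open>p\<close> would lie in \<open>M\<close>, against \<open>c0\<close>.\<close>

theorem inertia_transitive:
  assumes Z: "finite Z" "Z \<subseteq> R" and stable: "\<And>\<sigma> x. \<sigma> \<in> G \<Longrightarrow> x \<in> Z \<Longrightarrow> \<sigma> x \<in> Z"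
  defines "g \<equiv> (\<Prod>x\<in>Z. [:- x, 1:])"
  assumes low: "\<And>j. j < k \<Longrightarrow> coeff g j \<in> M" and top: "coeff g k \<notin> M"
    and c0: "coeff g 0 / of_nat p \<notin> M"
  shows "card (Z \<inter> M) = k" "\<And>x y. x \<in> Z \<inter> M \<Longrightarrow> y \<in> Z \<inter> M \<Longrightarrow> \<exists>\<tau>\<in>I. \<tau> x = y"
proof -
  have ZA: "Z \<subseteq> A"
    using Z R_subset_A by blast
  note co = coeff_prod_linear[OF Z(1) ZA, folded g_def]
  show card: "card (Z \<inter> M) = k"
    using co low top by (metis linorder_neqE_nat)
  fix x y assume xy: "x \<in> Z \<inter> M" "y \<in> Z \<inter> M"
  show "\<exists>\<tau>\<in>I. \<tau> x = y"
  proof (rule ccontr)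
    assume neg: "\<not> (\<exists>\<tau>\<in>I. \<tau> x = y)"
    define Orb where "Orb = (\<lambda>\<tau>. \<tau> x) ` I"
    \<comment> \<open>A conjugate of \<open>Orb\<close> alone could avoid \<open>M\<close>. With
      \<open>Z - M\<close> added, the set has more elements than \<open>Z - M\<close>, so each of
      its images under \<open>G\<close> meets \<open>M\<close>.\<close>
    define W where "W = Orb \<union> (Z - M)"
    have tauM: "\<tau> w \<in> M \<longleftrightarrow> w \<in> M" if "\<tau> \<in> I" "w \<in> Z" for \<tau> w
      using that Z M_diff_iff[of "\<tau> w" w] by (auto simp: I_def)
    have OZ: "Orb \<subseteq> Z \<inter> M"
      unfolding Orb_def using xy tauM stable I_subset_G by auto
    have WZ: "W \<subseteq> Z" and finW: "finite W"
      using OZ Z by (auto simp: W_def intro: finite_subset)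
    have WL: "W \<subseteq> L"
      using WZ Z R_subset_L by blast
    define z where "z = \<Prod>W"
    have zR: "z \<in> R"
      unfolding z_def using WZ Z subring_R by (intro is_subring_prod) auto
    have act: "\<sigma> z = \<Prod>(\<sigma> ` W)" if "\<sigma> \<in> G" for \<sigma>
    proof -
      have "\<sigma> z = (\<Prod>w\<in>W. \<sigma> w)"
        unfolding z_def using WL by (intro hom_on_prod[OF subring_L G_hom[OF that]]) auto
      also have "\<dots> = \<Prod>(\<sigma> ` W)"
        using inj_on_subset[OF G_inj[OF that] WL] by (simp add: prod.reindex)
      finally show ?thesis .
    qed
    have cardW: "card (\<sigma> ` W) = card W" if "\<sigma> \<in> G" for \<sigma>
      using inj_on_subset[OF G_inj[OF that] WL] by (rule card_image)
    have "z / of_nat p \<in> A"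
    proof (rule inertia_invariant_divisible[OF zR])
      fix \<tau> assume \<tau>: "\<tau> \<in> I"
      have "\<tau> w \<in> Orb" if "w \<in> Orb" for w
      proof -
        obtain \<rho> where \<rho>: "\<rho> \<in> I" "w = \<rho> x"
          using \<open>w \<in> Orb\<close> by (auto simp: Orb_def)
        have "x \<in> L"
          using xy Z R_subset_L by blast
        then have "compose L \<tau> \<rho> x = \<tau> w"
          using \<rho> by (simp add: compose_def)
        then show ?thesis
          unfolding Orb_def using I_compose[OF \<tau> \<rho>(1)] by (metis imageI)
      qed
      moreover have "\<tau> w \<in> Z - M" if "w \<in> Z - M" for w
        using that tauM[OF \<tau>] stable \<tau> I_subset_G by auto
      ultimately have "\<tau> ` W \<subseteq> W"
        by (auto simp: W_def)
      then have "\<tau> ` W = W"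
        using cardW[of \<tau>] \<tau> I_subset_G finW by (intro card_subset_eq) auto
      then show "\<tau> z = z"
        using act[of \<tau>] \<tau> I_subset_G by (auto simp: z_def)
    next
      fix \<sigma> assume \<sigma>: "\<sigma> \<in> G"
      have "\<sigma> ` W \<subseteq> Z"
        using WZ stable[OF \<sigma>] by auto
      have "\<exists>w\<in>\<sigma> ` W. w \<in> M"
      proof (rule ccontr)
        assume "\<not> ?thesis"
        then have "\<sigma> ` W \<subseteq> Z - M"
          using \<open>\<sigma> ` W \<subseteq> Z\<close> by auto
        then have "card W \<le> card (Z - M)"
          using cardW[OF \<sigma>] card_mono[of "Z - M" "\<sigma> ` W"] Z by simp
        moreover have "card W = card Orb + card (Z - M)"
          unfolding W_def using OZ Z by (intro card_Un_disjoint) (auto intro: finite_subset)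
        moreover have "card Orb > 0"
          using OZ Z id_in_I by (auto simp: card_gt_0_iff Orb_def intro: finite_subset)
        ultimately show False
          by simp
      qed
      then show "\<sigma> z \<in> M"
        using M_prod_iff[of "\<sigma> ` W" "\<lambda>x. x"] act[OF \<sigma>] finW \<open>\<sigma> ` W \<subseteq> Z\<close> ZA by auto
    qed
    moreover have "\<Prod>(Z - W) \<in> M"
    proof -
      have "y \<in> Z - W"
        using xy neg by (auto simp: W_def Orb_def)
      then show ?thesis
        using M_prod_iff[of "Z - W" "\<lambda>x. x"] Z ZA xy by auto
    qed
    ultimately have "z / of_nat p * \<Prod>(Z - W) \<in> M"
      by (rule M_mult_left)
    then have "(- 1) ^ card Z * (z / of_nat p * \<Prod>(Z - W)) \<in> M"
      by (rule M_mult_left[rotated]) (intro is_subring_closed subring)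
    moreover have "coeff g 0 = (\<Prod>x\<in>Z. - x)"
      by (simp add: g_def flip: poly_0_coeff_0) (simp add: poly_prod)
    then have "coeff g 0 = (- 1) ^ card Z * \<Prod>Z"
      by (simp add: prod_uminus)
    moreover have "\<Prod>Z = \<Prod>(Z - W) * z"
      unfolding z_def using prod.subset_diff[OF WZ Z(1), of "\<lambda>x. x"] .
    ultimately show False
      using c0 by (simp add: mult_ac)
  qed
qed

end

section \<open>Permutation groups containing a 3-cycle\<close>

lemma cycle3_apply:
  assumes "distinct [a, b, c]"
  shows "cycle_of_list [a, b, c] x = (if x = a then b else if x = b then c else if x = c then a else x)"
  using assms by (auto simp: transpose_def)

lemma cycle3_rotate: "distinct [a, b, c] \<Longrightarrow> cycle_of_list [b, c, a] = cycle_of_list [a, b, c]"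
  by (rule ext) (subst cycle3_apply, simp, subst cycle3_apply, auto)

lemma cycle3_square:
  assumes "distinct [a, b, c]"
  shows "cycle_of_list [a, b, c] \<circ> cycle_of_list [a, b, c] = cycle_of_list [a, c, b]"
proof
  fix x
  have "distinct [a, c, b]"
    using assms by auto
  then show "(cycle_of_list [a, b, c] \<circ> cycle_of_list [a, b, c]) x = cycle_of_list [a, c, b] x"
    unfolding comp_apply cycle3_apply[OF assms] cycle3_apply[OF \<open>distinct [a, c, b]\<close>]
    using assms by auto
qed

locale permutation_group =
  fixes D :: "'a set" and \<Gamma> :: "('a \<Rightarrow> 'a) set"
  assumes permutes: "\<pi> \<in> \<Gamma> \<Longrightarrow> \<pi> permutes D"
    and comp_closed: "\<pi> \<in> \<Gamma> \<Longrightarrow> \<rho> \<in> \<Gamma> \<Longrightarrow> \<pi> \<circ> \<rho> \<in> \<Gamma>"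
    and inv_closed: "\<pi> \<in> \<Gamma> \<Longrightarrow> inv' \<pi> \<in> \<Gamma>"
    and id_closed: "id \<in> \<Gamma>"
begin

lemma apply_mem: "\<pi> \<in> \<Gamma> \<Longrightarrow> x \<in> D \<Longrightarrow> \<pi> x \<in> D"
  using permutes permutes_in_image by metis

lemma apply_eq_iff: "\<pi> \<in> \<Gamma> \<Longrightarrow> \<pi> x = \<pi> y \<longleftrightarrow> x = y"
  using permutes permutes_inj by (metis injD)

lemma inv_apply: "\<pi> \<in> \<Gamma> \<Longrightarrow> inv' \<pi> (\<pi> x) = x"
  using permutes permutes_inverses(2) by metis

lemma cycle3_conj:
  assumes "cycle_of_list [a, b, c] \<in> \<Gamma>" "distinct [a, b, c]" "\<pi> \<in> \<Gamma>"
  shows "cycle_of_list [\<pi> a, \<pi> b, \<pi> c] \<in> \<Gamma>"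
proof -
  have "\<pi> \<circ> cycle_of_list [a, b, c] \<circ> inv' \<pi> \<in> \<Gamma>"
    using assms by (intro comp_closed inv_closed)
  moreover have "\<pi> \<circ> cycle_of_list [a, b, c] \<circ> inv' \<pi> = cycle_of_list (map \<pi> [a, b, c])"
    using conjugation_of_cycle[of "[a, b, c]" \<pi>] assms permutes_bij[OF permutes] by simp
  ultimately show ?thesis
    by simp
qed

text \<open>An element taking \<open>a\<close> to \<open>b\<close> is a 3-cycle or the transposition
  of \<open>a\<close> and \<open>b\<close>; likewise for \<open>a\<close> and \<open>c\<close>. If
  both are transpositions, their product is the 3-cycle.\<close>

lemma exists_cycle3:
  assumes T: "distinct [a, b, c]"
    and trans: "\<And>x y. x \<in> {a, b, c} \<Longrightarrow> y \<in> {a, b, c} \<Longrightarrow> \<exists>\<pi>\<in>\<Gamma>. \<pi> x = y \<and> (\<forall>z. z \<notin> {a, b, c} \<longrightarrow> \<pi> z = z)"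
  shows "cycle_of_list [a, b, c] \<in> \<Gamma>"
proof -
  have img: "\<pi> x \<in> {a, b, c}" if "\<pi> \<in> \<Gamma>" "\<forall>z. z \<notin> {a, b, c} \<longrightarrow> \<pi> z = z" "x \<in> {a, b, c}" for \<pi> x
    using that apply_eq_iff[OF that(1), of x "\<pi> x"] by metis
  obtain \<pi> where \<pi>: "\<pi> \<in> \<Gamma>" "\<pi> a = b" "\<forall>z. z \<notin> {a, b, c} \<longrightarrow> \<pi> z = z"
    using trans[of a b] by auto
  obtain \<rho> where \<rho>: "\<rho> \<in> \<Gamma>" "\<rho> a = c" "\<forall>z. z \<notin> {a, b, c} \<longrightarrow> \<rho> z = z"
    using trans[of a c] by auto
  note ap = img[OF \<pi>(1,3)] apply_eq_iff[OF \<pi>(1)]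
  note ar = img[OF \<rho>(1,3)] apply_eq_iff[OF \<rho>(1)]
  have "\<pi> b \<in> {a, b, c}" "\<pi> c \<in> {a, b, c}" "\<pi> b \<noteq> b" "\<pi> c \<noteq> b" "\<pi> b \<noteq> \<pi> c"
    using ap(1)[of b] ap(1)[of c] ap(2)[of b a] ap(2)[of c a] ap(2)[of b c] \<pi>(2) T by auto
  then consider "\<pi> b = c" "\<pi> c = a" | "\<pi> b = a" "\<pi> c = c"
    by auto
  then show ?thesis
  proof cases
    case 1
    have "\<pi> = cycle_of_list [a, b, c]"
      by (rule ext, subst cycle3_apply[OF T]) (use 1 \<pi> in auto)
    then show ?thesis
      using \<pi>(1) by simp
  next
    case 2
    have "\<rho> b \<in> {a, b, c}" "\<rho> c \<in> {a, b, c}" "\<rho> b \<noteq> c" "\<rho> c \<noteq> c" "\<rho> b \<noteq> \<rho> c"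
      using ar(1)[of b] ar(1)[of c] ar(2)[of b a] ar(2)[of c a] ar(2)[of b c] \<rho>(2) T by auto
    then consider "\<rho> b = a" "\<rho> c = b" | "\<rho> b = b" "\<rho> c = a"
      by auto
    then show ?thesis
    proof cases
      case 1
      have "distinct [a, c, b]"
        using T by auto
      have "\<rho> = cycle_of_list [a, c, b]"
        by (rule ext, subst cycle3_apply[OF \<open>distinct [a, c, b]\<close>]) (use 1 \<rho> in auto)
      then have "cycle_of_list [a, c, b] \<circ> cycle_of_list [a, c, b] \<in> \<Gamma>"
        using \<rho>(1) comp_closed by simp
      then show ?thesis
        using cycle3_square[OF \<open>distinct [a, c, b]\<close>] by simp
    next
      case r: 2
      have "\<rho> \<circ> \<pi> = cycle_of_list [a, b, c]"
        by (rule ext, subst cycle3_apply[OF T]) (use 2 r \<pi> \<rho> in auto)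
      then show ?thesis
        using comp_closed[OF \<rho>(1) \<pi>(1)] by simp
    qed
  qed
qed

text \<open>Transitivity comes first: a point other than \<open>e\<close> is moved by the stabiliser
  to \<open>\<kappa> e\<close> and from there to \<open>e\<close> by the inverse of
  \<open>\<kappa>\<close>. Both pairs can then be brought to have first entry \<open>e\<close>,
  where the stabiliser matches the second entries.\<close>

lemma two_transitive:
  assumes e: "e \<in> D"
    and stab: "\<And>x y. x \<in> D - {e} \<Longrightarrow> y \<in> D - {e} \<Longrightarrow> \<exists>\<pi>\<in>\<Gamma>. \<pi> e = e \<and> \<pi> x = y"
    and moved: "\<exists>\<pi>\<in>\<Gamma>. \<pi> e \<noteq> e"
    and xy: "x \<in> D" "y \<in> D" "x \<noteq> y" and uv: "u \<in> D" "v \<in> D" "u \<noteq> v"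
  shows "\<exists>\<pi>\<in>\<Gamma>. \<pi> x = u \<and> \<pi> y = v"
proof -
  obtain \<kappa> where \<kappa>: "\<kappa> \<in> \<Gamma>" "\<kappa> e \<noteq> e"
    using moved by blast
  have to_e: "\<exists>\<pi>\<in>\<Gamma>. \<pi> z = e" if z: "z \<in> D" for z
  proof (cases "z = e")
    case True
    then show ?thesis
      by (intro bexI[of _ id] id_closed) simp
  next
    case False
    then obtain \<rho> where \<rho>: "\<rho> \<in> \<Gamma>" "\<rho> z = \<kappa> e"
      using stab[of z "\<kappa> e"] z \<kappa> apply_mem e by auto
    then have "(inv' \<kappa> \<circ> \<rho>) z = e"
      using inv_apply[OF \<kappa>(1)] by simp
    then show ?thesis
      using comp_closed[OF inv_closed[OF \<kappa>(1)] \<rho>(1)] by blast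
  qed
  obtain \<pi> where \<pi>: "\<pi> \<in> \<Gamma>" "\<pi> x = e"
    using to_e xy by blast
  obtain \<rho> where \<rho>: "\<rho> \<in> \<Gamma>" "\<rho> u = e"
    using to_e uv by blast
  have "\<pi> y \<in> D - {e}" "\<rho> v \<in> D - {e}"
    using \<pi> \<rho> xy uv apply_mem apply_eq_iff[OF \<pi>(1), of x y] apply_eq_iff[OF \<rho>(1), of u v] by auto
  then obtain \<tau> where \<tau>: "\<tau> \<in> \<Gamma>" "\<tau> e = e" "\<tau> (\<pi> y) = \<rho> v"
    using stab by blast
  have "inv' \<rho> \<circ> (\<tau> \<circ> \<pi>) \<in> \<Gamma>"
    using \<pi> \<rho> \<tau> by (intro comp_closed inv_closed)
  moreover have "(inv' \<rho> \<circ> (\<tau> \<circ> \<pi>)) x = u"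
    using \<pi> \<rho> \<tau> inv_apply[OF \<rho>(1), of u] by simp
  moreover have "(inv' \<rho> \<circ> (\<tau> \<circ> \<pi>)) y = v"
    using \<pi> \<rho> \<tau> inv_apply[OF \<rho>(1), of v] by simp
  ultimately show ?thesis
    by blast
qed

text \<open>Double transitivity conjugates the given 3-cycle to one starting with any prescribed
  pair, but its third entry is arbitrary. Two such cycles, through \<open>x, y\<close> and through
  \<open>x, w\<close>, are combined by conjugation until the unwanted third entries are
  gone.\<close>

lemma all_cycle3:
  assumes trans: "\<And>x y u v. x \<in> D \<Longrightarrow> y \<in> D \<Longrightarrow> x \<noteq> y \<Longrightarrow> u \<in> D \<Longrightarrow> v \<in> D \<Longrightarrow> u \<noteq> v \<Longrightarrow>
      \<exists>\<pi>\<in>\<Gamma>. \<pi> x = u \<and> \<pi> y = v"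
    and abc: "a \<in> D" "b \<in> D" "distinct [a, b, c]" "cycle_of_list [a, b, c] \<in> \<Gamma>"
    and xyw: "x \<in> D" "y \<in> D" "w \<in> D" "distinct [x, y, w]"
  shows "cycle_of_list [x, y, w] \<in> \<Gamma>"
proof -
  have ex: "\<exists>z. distinct [x, y, z] \<and> cycle_of_list [x, y, z] \<in> \<Gamma>"
    if xy: "x \<in> D" "y \<in> D" "x \<noteq> y" for x y
  proof -
    obtain \<pi> where \<pi>: "\<pi> \<in> \<Gamma>" "\<pi> a = x" "\<pi> b = y"
      using trans[of a b x y] abc xy by auto
    have "distinct [\<pi> a, \<pi> b, \<pi> c]"
      using apply_eq_iff[OF \<pi>(1)] abc(3) by auto
    then show ?thesis
      using cycle3_conj[OF abc(4,3) \<pi>(1)] \<pi> by auto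
  qed
  have flip: "cycle_of_list [x, y, w] \<in> \<Gamma>" if "cycle_of_list [x, w, y] \<in> \<Gamma>"
    using comp_closed[OF that that] cycle3_square[of x w y] xyw(4) by auto
  obtain z where z: "distinct [x, y, z]" "cycle_of_list [x, y, z] \<in> \<Gamma>"
    using ex[of x y] xyw by auto
  obtain v where v: "distinct [x, w, v]" "cycle_of_list [x, w, v] \<in> \<Gamma>"
    using ex[of x w] xyw by auto
  consider "z = w" | "v = y" | "z \<noteq> w" "v = z" | "z \<noteq> w" "v \<noteq> y" "v \<noteq> z"
    by blast
  then show ?thesis
  proof cases
    case 1
    then show ?thesis using z by simp
  next
    case 2
    then show ?thesis using v flip by simp
  next
    case 3
    have d: "distinct [x, w, y]"
      using xyw by auto
    \<comment> \<open>With \<open>v = z\<close>, conjugation by \<open>(x w z)\<close> sends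
      \<open>x, y, z\<close> to \<open>w, y, x\<close>, so \<open>z\<close> disappears at
      once.\<close>
    have "cycle_of_list [cycle_of_list [x, w, v] x, cycle_of_list [x, w, v] y, cycle_of_list [x, w, v] z] \<in> \<Gamma>"
      by (rule cycle3_conj[OF z(2,1) v(2)])
    then have "cycle_of_list [w, y, x] \<in> \<Gamma>"
      unfolding cycle3_apply[OF v(1)] using 3 z v xyw by (auto split: if_splits)
    then show ?thesis
      using flip cycle3_rotate[OF d] by simp
  next
    case 4
    have d: "distinct [w, y, z]"
      using xyw z 4 by auto
    \<comment> \<open>Now \<open>y\<close> and \<open>z\<close> are fixed by \<open>(x w v)\<close>,
      so \<open>(x y z)\<close> becomes \<open>(w y z)\<close>. The square \<open>(w z y)\<close> of
      this fixes \<open>x\<close> and sends \<open>y, z\<close> to \<open>w, y\<close>, so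
      conjugating \<open>(x y z)\<close> by it yields \<open>(x w y)\<close>.\<close>
    have "cycle_of_list [cycle_of_list [x, w, v] x, cycle_of_list [x, w, v] y, cycle_of_list [x, w, v] z] \<in> \<Gamma>"
      by (rule cycle3_conj[OF z(2,1) v(2)])
    then have "cycle_of_list [w, y, z] \<in> \<Gamma>"
      unfolding cycle3_apply[OF v(1)] using 4 z v xyw by (auto split: if_splits)
    then have h: "cycle_of_list [w, z, y] \<in> \<Gamma>"
      using comp_closed cycle3_square[OF d] by metis
    have d': "distinct [w, z, y]"
      using d by auto
    have "cycle_of_list [cycle_of_list [w, z, y] x, cycle_of_list [w, z, y] y, cycle_of_list [w, z, y] z] \<in> \<Gamma>"
      by (rule cycle3_conj[OF z(2,1) h])
    then have "cycle_of_list [x, w, y] \<in> \<Gamma>"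
      unfolding cycle3_apply[OF d'] using 4 z v xyw by (auto split: if_splits)
    then show ?thesis
      by (rule flip)
  qed
qed

end

lemma alt_group_least:
  fixes \<Gamma> :: "(nat \<Rightarrow> nat) set"
  assumes "permutation_group {1..n} \<Gamma>"
    and three: "\<And>x y w. {x, y, w} \<subseteq> {1..n} \<Longrightarrow> distinct [x, y, w] \<Longrightarrow> cycle_of_list [x, y, w] \<in> \<Gamma>"
  shows "carrier (alt_group n) \<subseteq> \<Gamma>"
proof -
  interpret permutation_group "{1..n}" \<Gamma>
    by fact
  have three_mem: "h \<in> \<Gamma>" if "h \<in> three_cycles n" for h
  proof -
    obtain cs where cs: "h = cycle_of_list cs" "cycle cs" "length cs = 3" "set cs \<subseteq> {1..n}"
      using \<open>h \<in> three_cycles n\<close> by auto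
    then obtain x y w where "cs = [x, y, w]"
      by (metis stupid_lemma)
    then show ?thesis
      using three[of x y w] cs by auto
  qed
  have "h \<in> \<Gamma>" if "h \<in> generate (alt_group n) (three_cycles n)" for h
    using that
  proof (induction h rule: generate.induct)
    case one
    show ?case
      by (subst alt_group_one) (rule id_closed)
  next
    case (incl h)
    then show ?case
      by (rule three_mem)
  next
    case (inv h)
    then have "h \<in> carrier (alt_group n)"
      using three_cycles_incl by blast
    then show ?case
      using three_mem[OF inv] inv_closed alt_group_inv_equality by metis
  next
    case (eng h1 h2)
    then show ?case
      unfolding alt_group_mult by (intro comp_closed)
  qed
  then show ?thesis
    using alt_group_carrier_as_three_cycles by blast
qed

text \<open>The interface to the Galois side: \<open>stab\<close> is to come from inertia at the
  first prime, \<open>moved\<close> from the absence of rational roots, and \<open>three\<close>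
  from inertia at the second prime.\<close>

theorem alt_group_subset:
  fixes \<Gamma> :: "(nat \<Rightarrow> nat) set"
  assumes \<Gamma>: "permutation_group {1..n} \<Gamma>"
    and e: "e \<in> {1..n}"
    and stab: "\<And>x y. x \<in> {1..n} - {e} \<Longrightarrow> y \<in> {1..n} - {e} \<Longrightarrow> \<exists>\<pi>\<in>\<Gamma>. \<pi> e = e \<and> \<pi> x = y"
    and moved: "\<exists>\<pi>\<in>\<Gamma>. \<pi> e \<noteq> e"
    and T: "T \<subseteq> {1..n}" "card T = 3"
    and three: "\<And>x y. x \<in> T \<Longrightarrow> y \<in> T \<Longrightarrow> \<exists>\<pi>\<in>\<Gamma>. \<pi> x = y \<and> (\<forall>z. z \<notin> T \<longrightarrow> \<pi> z = z)"
  shows "carrier (alt_group n) \<subseteq> \<Gamma>"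
proof (rule alt_group_least[OF \<Gamma>])
  interpret permutation_group "{1..n}" \<Gamma>
    by fact
  obtain a b c where abc: "T = {a, b, c}" "distinct [a, b, c]"
    using T(2) by (auto simp: card_3_iff)
  have cyc: "cycle_of_list [a, b, c] \<in> \<Gamma>"
    using exists_cycle3[OF abc(2)] three unfolding abc(1) by blast
  show "cycle_of_list [x, y, w] \<in> \<Gamma>" if "{x, y, w} \<subseteq> {1..n}" "distinct [x, y, w]" for x y w
    by (rule all_cycle3[OF two_transitive[OF e stab moved] _ _ abc(2) cyc])
      (use abc(1) T(1) that in auto)
qed

text \<open>In a finite set closed under composition left translation is injective, hence onto, and
  so it reaches \<open>id\<close>; inverses come for free.\<close>

lemma permutation_groupI:
  assumes fin: "finite D" and perm: "\<And>\<pi>. \<pi> \<in> \<Gamma> \<Longrightarrow> \<pi> permutes D"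
    and comp: "\<And>\<pi> \<rho>. \<pi> \<in> \<Gamma> \<Longrightarrow> \<rho> \<in> \<Gamma> \<Longrightarrow> \<pi> \<circ> \<rho> \<in> \<Gamma>" and id: "id \<in> \<Gamma>"
  shows "permutation_group D \<Gamma>"
proof
  fix \<pi> assume \<pi>: "\<pi> \<in> \<Gamma>"
  have fin\<Gamma>: "finite \<Gamma>"
    using finite_subset[OF _ finite_permutations[OF fin]] perm by blast
  have "inj_on (\<lambda>\<rho>. \<pi> \<circ> \<rho>) \<Gamma>"
    using permutes_inj[OF perm[OF \<pi>]] by (auto intro!: inj_onI simp: fun_eq_iff inj_eq)
  then have "(\<lambda>\<rho>. \<pi> \<circ> \<rho>) ` \<Gamma> = \<Gamma>"
    using comp[OF \<pi>] by (intro card_subset_eq[OF fin\<Gamma>]) (auto simp: card_image)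
  then obtain \<rho> where \<rho>: "\<rho> \<in> \<Gamma>" "\<pi> \<circ> \<rho> = id"
    using id by (metis imageE)
  have "inv' \<pi> = inv' \<pi> \<circ> (\<pi> \<circ> \<rho>)"
    using \<rho> by simp
  also have "\<dots> = \<rho>"
    using permutes_inv_o(2)[OF perm[OF \<pi>]] by (simp add: o_assoc)
  finally show "inv' \<pi> \<in> \<Gamma>"
    using \<rho> by simp
qed (use assms in auto)

section \<open>The Galois group over a quadratic field\<close>

definition vandermonde :: "nat \<Rightarrow> (nat \<Rightarrow> complex) \<Rightarrow> complex" where
  "vandermonde n x = (\<Prod>j\<in>{1..n}. \<Prod>i\<in>{1..<j}. x j - x i)"

text \<open>The factor for the pair \<open>1, 2\<close> changes sign, and for each
  \<open>j \<ge> 3\<close> the transposition merely permutes the inner product. This one odd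
  permutation decides the sign of all others in \<open>fixes_vandermonde_iff_even\<close>.\<close>

lemma vandermonde_transpose:
  assumes "n \<ge> 2"
  shows "vandermonde n (x \<circ> transpose 1 2) = - vandermonde n x"
proof -
  let ?\<tau> = "transpose 1 (2::nat)"
  have split: "{1..n} = {1, 2} \<union> {3..n}"
    using assms by auto
  have V: "vandermonde n y = (y 2 - y 1) * (\<Prod>j\<in>{3..n}. \<Prod>i\<in>{1..<j}. y j - y i)" for y
  proof -
    have "{1..<2} = {1::nat}"
      by auto
    then show ?thesis
      unfolding vandermonde_def split by (subst prod.union_disjoint) auto
  qed
  have "(\<Prod>i\<in>{1..<j}. (x \<circ> ?\<tau>) j - (x \<circ> ?\<tau>) i) = (\<Prod>i\<in>{1..<j}. x j - x i)" if "j \<in> {3..n}" for j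
  proof -
    have "?\<tau> permutes {1..<j}"
      using that by (intro permutes_swap_id) auto
    then have "(\<Prod>i\<in>{1..<j}. x j - x i) = (\<Prod>i\<in>{1..<j}. x j - x (?\<tau> i))"
      using prod.permute[of ?\<tau> "{1..<j}" "\<lambda>i. x j - x i"] by (simp add: comp_def)
    moreover have "?\<tau> j = j"
      using that by (auto simp: transpose_def)
    ultimately show ?thesis
      by simp
  qed
  then show ?thesis
    unfolding V by (simp add: left_diff_distrib)
qed

text \<open>For the roots of a monic separable polynomial the left side is the product of the
  derivative over the roots. Each unordered pair occurs in both orders; the resulting sign keeps its
  exponent as a sum because \<open>disc_const\<close> has it in the same form.\<close>

lemma prod_differences:
  "(\<Prod>i\<in>{1..n}. \<Prod>k\<in>{1..n} - {i}. x i - x k) = (- 1) ^ (\<Sum>j\<in>{1..n}. j - 1) * (vandermonde n x)\<^sup>2"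
proof -
  have "(\<Prod>k\<in>{1..n} - {i}. x i - x k) = (\<Prod>k\<in>{1..<i}. x i - x k) * (\<Prod>k\<in>{i<..n}. x i - x k)"
    if "i \<in> {1..n}" for i
  proof -
    have eq: "{1..n} - {i} = {1..<i} \<union> {i<..n}"
      using that by auto
    show ?thesis
      unfolding eq by (rule prod.union_disjoint) auto
  qed
  then have "(\<Prod>i\<in>{1..n}. \<Prod>k\<in>{1..n} - {i}. x i - x k) =
      vandermonde n x * (\<Prod>i\<in>{1..n}. \<Prod>k\<in>{i<..n}. x i - x k)"
    by (simp add: vandermonde_def prod.distrib)
  also have "(\<Prod>i\<in>{1..n}. \<Prod>k\<in>{i<..n}. x i - x k) = (\<Prod>k\<in>{1..n}. \<Prod>i\<in>{1..<k}. x i - x k)"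
  proof -
    have "(\<Prod>i\<in>{1..n}. \<Prod>k\<in>{i<..n}. x i - x k) = (\<Prod>i\<in>{1..n}. \<Prod>k | k \<in> {1..n} \<and> i < k. x i - x k)"
      by (intro prod.cong) auto
    also have "\<dots> = (\<Prod>k\<in>{1..n}. \<Prod>i | i \<in> {1..n} \<and> i < k. x i - x k)"
      by (rule prod.swap_restrict) auto
    also have "\<dots> = (\<Prod>k\<in>{1..n}. \<Prod>i\<in>{1..<k}. x i - x k)"
      by (intro prod.cong) auto
    finally show ?thesis .
  qed
  also have "\<dots> = (\<Prod>k\<in>{1..n}. (- 1) ^ (k - 1) * (\<Prod>i\<in>{1..<k}. x k - x i))"
  proof (rule prod.cong[OF refl])
    fix k
    have "(\<Prod>i\<in>{1..<k}. x i - x k) = (\<Prod>i\<in>{1..<k}. (- 1) * (x k - x i))"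
      by simp
    also have "\<dots> = (- 1) ^ (k - 1) * (\<Prod>i\<in>{1..<k}. x k - x i)"
      by (subst prod.distrib) simp
    finally show "(\<Prod>i\<in>{1..<k}. x i - x k) = (- 1) ^ (k - 1) * (\<Prod>i\<in>{1..<k}. x k - x i)" .
  qed
  also have "\<dots> = (- 1) ^ (\<Sum>j\<in>{1..n}. j - 1) * vandermonde n x"
    by (simp add: prod.distrib vandermonde_def power_sum)
  finally show ?thesis
    by (simp add: power2_eq_square mult_ac)
qed

section \<open>The Galois group as permutations of indices\<close>

locale enumerated_roots = rational_poly f for f :: "complex poly" +
  fixes n :: nat and e :: "nat \<Rightarrow> complex"
  assumes bij_e: "bij_betw e {1..n} S"
begin

lemma e_mem: "i \<in> {1..n} \<Longrightarrow> e i \<in> S"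
  using bij_betw_imp_surj_on[OF bij_e] by blast

lemma e_eq_iff: "i \<in> {1..n} \<Longrightarrow> j \<in> {1..n} \<Longrightarrow> e i = e j \<longleftrightarrow> i = j"
  using inj_on_eq_iff[OF bij_betw_imp_inj_on[OF bij_e]] by blast

lemma e_surj: "x \<in> S \<Longrightarrow> \<exists>i\<in>{1..n}. e i = x"
  using bij_betw_imp_surj_on[OF bij_e] by (metis imageE)

text \<open>It reads \<open>\<sigma>\<close> only at the roots, so it takes the same value at an
  automorphism and at its restriction to \<open>S\<close>, which is the form of the elements of
  \<open>galois_group\<close>.\<close>

definition index_perm :: "(complex \<Rightarrow> complex) \<Rightarrow> nat \<Rightarrow> nat" where
  "index_perm \<sigma> = (\<lambda>i. if i \<in> {1..n} then inv_into {1..n} e (\<sigma> (e i)) else i)"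

definition \<Gamma> :: "(nat \<Rightarrow> nat) set" where "\<Gamma> = index_perm ` G"

lemma index_perm_apply:
  assumes "\<sigma> \<in> G" "i \<in> {1..n}"
  shows "index_perm \<sigma> i \<in> {1..n}" "e (index_perm \<sigma> i) = \<sigma> (e i)"
proof -
  have mem: "\<sigma> (e i) \<in> e ` {1..n}"
    using hom_root[OF G_hom[OF assms(1)] e_mem[OF assms(2)]] bij_betw_imp_surj_on[OF bij_e] by simp
  have eq: "index_perm \<sigma> i = inv_into {1..n} e (\<sigma> (e i))"
    unfolding index_perm_def using assms(2) by (rule if_P)
  show "index_perm \<sigma> i \<in> {1..n}"
    unfolding eq by (rule inv_into_into[OF mem])
  show "e (index_perm \<sigma> i) = \<sigma> (e i)"
    unfolding eq by (rule f_inv_into_f[OF mem])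
qed

lemma index_perm_outside: "i \<notin> {1..n} \<Longrightarrow> index_perm \<sigma> i = i"
  unfolding index_perm_def by (rule if_not_P)

lemma index_perm_eqI:
  assumes "\<sigma> \<in> G" "\<And>i. i \<in> {1..n} \<Longrightarrow> \<pi> i \<in> {1..n} \<and> e (\<pi> i) = \<sigma> (e i)"
    "\<And>i. i \<notin> {1..n} \<Longrightarrow> \<pi> i = i"
  shows "index_perm \<sigma> = \<pi>"
proof
  fix i
  show "index_perm \<sigma> i = \<pi> i"
  proof (cases "i \<in> {1..n}")
    case True
    then show ?thesis
      using index_perm_apply[OF assms(1) True] assms(2)[OF True] e_eq_iff by metis
  next
    case False
    then show ?thesis
      using assms(3) index_perm_outside by simp
  qed
qed

lemma e_in_L: "i \<in> {1..n} \<Longrightarrow> e i \<in> L"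
  using e_mem S_subset_L by blast

lemma index_perm_compose:
  assumes "\<sigma> \<in> G" "\<tau> \<in> G"
  shows "index_perm (compose L \<sigma> \<tau>) = index_perm \<sigma> \<circ> index_perm \<tau>"
proof (rule index_perm_eqI[OF G_compose[OF assms]])
  fix i assume i: "i \<in> {1..n}"
  show "(index_perm \<sigma> \<circ> index_perm \<tau>) i \<in> {1..n} \<and>
      e ((index_perm \<sigma> \<circ> index_perm \<tau>) i) = compose L \<sigma> \<tau> (e i)"
    using index_perm_apply[OF assms(2) i] index_perm_apply[OF assms(1), of "index_perm \<tau> i"]
      e_in_L[OF i] by (simp add: compose_def)
qed (simp add: index_perm_outside del: atLeastAtMost_iff)

lemma index_perm_id: "index_perm (restrict id L) = id"
  by (rule index_perm_eqI[OF G_id]) (use e_in_L in auto)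

lemma index_perm_permutes:
  assumes "\<sigma> \<in> G"
  shows "index_perm \<sigma> permutes {1..n}"
proof -
  have "inj_on (index_perm \<sigma>) {1..n}"
  proof (rule inj_onI)
    fix i j assume ij: "i \<in> {1..n}" "j \<in> {1..n}" "index_perm \<sigma> i = index_perm \<sigma> j"
    then have "\<sigma> (e i) = \<sigma> (e j)"
      using index_perm_apply[OF assms] by metis
    then have "e i = e j"
      using inj_onD[OF G_inj[OF assms]] e_in_L ij by blast
    then show "i = j"
      using e_eq_iff ij by blast
  qed
  moreover have "index_perm \<sigma> ` {1..n} \<subseteq> {1..n}"
    using index_perm_apply(1)[OF assms] by blast
  ultimately have "bij_betw (index_perm \<sigma>) {1..n} {1..n}"
    by (simp add: bij_betw_def endo_inj_surj)
  then show ?thesis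
    using index_perm_outside by (rule bij_imp_permutes)
qed

text \<open>A general \<open>H\<close> is allowed because both \<open>G\<close> and the stabiliser
  of the Vandermonde product are needed.\<close>

lemma permutation_group_image:
  assumes "H \<subseteq> G" "restrict id L \<in> H" "\<And>\<sigma> \<tau>. \<sigma> \<in> H \<Longrightarrow> \<tau> \<in> H \<Longrightarrow> compose L \<sigma> \<tau> \<in> H"
  shows "permutation_group {1..n} (index_perm ` H)"
proof (rule permutation_groupI)
  show "id \<in> index_perm ` H"
    using assms(2) index_perm_id by (metis imageI)
  show "\<pi> permutes {1..n}" if "\<pi> \<in> index_perm ` H" for \<pi>
    using that assms(1) index_perm_permutes by blast
  fix \<pi> \<rho> assume "\<pi> \<in> index_perm ` H" "\<rho> \<in> index_perm ` H"
  then obtain \<sigma> \<tau> where \<sigma>: "\<sigma> \<in> H" "\<pi> = index_perm \<sigma>" and \<tau>: "\<tau> \<in> H" "\<rho> = index_perm \<tau>"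
    by blast
  then have "\<pi> \<circ> \<rho> = index_perm (compose L \<sigma> \<tau>)"
    using index_perm_compose assms(1) by (metis subsetD)
  then show "\<pi> \<circ> \<rho> \<in> index_perm ` H"
    using assms(3) \<sigma> \<tau> by blast
qed simp

lemma permutation_group_\<Gamma>: "permutation_group {1..n} \<Gamma>"
  unfolding \<Gamma>_def using permutation_group_image[OF subset_refl G_id G_compose] .

lemma vandermonde_in_L: "vandermonde n e \<in> L"
  unfolding vandermonde_def using e_in_L subring_L
  by (intro is_subring_prod is_subring_diff) auto

lemma G_vandermonde:
  assumes "\<sigma> \<in> G"
  shows "\<sigma> (vandermonde n e) = vandermonde n (e \<circ> index_perm \<sigma>)"
proof -
  note hom = G_hom[OF assms]
  have mem: "e j - e i \<in> L" if "j \<in> {1..n}" "i \<in> {1..<j}" for i j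
    using that e_in_L subring_L by (intro is_subring_diff) auto
  have "\<sigma> (vandermonde n e) = (\<Prod>j\<in>{1..n}. \<sigma> (\<Prod>i\<in>{1..<j}. e j - e i))"
    unfolding vandermonde_def using mem subring_L
    by (intro hom_on_prod[OF subring_L hom] is_subring_prod) auto
  also have "\<dots> = (\<Prod>j\<in>{1..n}. \<Prod>i\<in>{1..<j}. \<sigma> (e j - e i))"
    using mem by (intro prod.cong refl hom_on_prod[OF subring_L hom]) auto
  also have "\<dots> = (\<Prod>j\<in>{1..n}. \<Prod>i\<in>{1..<j}. \<sigma> (e j) - \<sigma> (e i))"
    using e_in_L by (intro prod.cong refl hom_on_diff[OF subring_L hom]) auto
  also have "\<dots> = vandermonde n (e \<circ> index_perm \<sigma>)"
    unfolding vandermonde_def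
    by (intro prod.cong refl arg_cong2[of _ _ _ _ "(-)"]) (auto simp: index_perm_apply(2)[OF assms])
  finally show ?thesis .
qed

text \<open>As its square is rational, the Vandermonde product is only ever multiplied by a sign.
  Its stabiliser contains all 3-cycles, hence the alternating group, and one odd element in it would
  bring in the transposition of \<open>1\<close> and \<open>2\<close>, which negates the nonzero
  product.\<close>

lemma fixes_vandermonde_iff_even:
  assumes n: "n \<ge> 2" and alt: "carrier (alt_group n) \<subseteq> \<Gamma>"
    and sq: "(vandermonde n e)\<^sup>2 \<in> \<rat>" and nz: "vandermonde n e \<noteq> 0" and \<sigma>: "\<sigma> \<in> G"
  shows "\<sigma> (vandermonde n e) = vandermonde n e \<longleftrightarrow> evenperm (index_perm \<sigma>)"
proof -
  let ?V = "vandermonde n e"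
  define H where "H = {\<sigma> \<in> G. \<sigma> ?V = ?V}"
  have sign: "\<tau> ?V = ?V \<or> \<tau> ?V = - ?V" if \<tau>: "\<tau> \<in> G" for \<tau>
  proof -
    have "(\<tau> ?V)\<^sup>2 = \<tau> (?V\<^sup>2)"
      using hom_on_power[OF subring_L G_hom[OF \<tau>] vandermonde_in_L] by simp
    also have "\<dots> = ?V\<^sup>2"
      using G_Rats[OF \<tau> sq] .
    finally show ?thesis
      by (simp add: power2_eq_iff)
  qed
  have VL: "compose L \<sigma> \<tau> ?V = \<sigma> (\<tau> ?V)" for \<sigma> \<tau>
    using vandermonde_in_L by (simp add: compose_def)
  have neg: "\<tau> (- ?V) = - \<tau> ?V" if "\<tau> \<in> G" for \<tau>
    using hom_on_minus[OF subring_L G_hom[OF that] vandermonde_in_L] .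
  have HP: "permutation_group {1..n} (index_perm ` H)"
  proof (rule permutation_group_image)
    show "restrict id L \<in> H"
      using G_id vandermonde_in_L by (simp add: H_def)
    show "compose L \<sigma> \<tau> \<in> H" if "\<sigma> \<in> H" "\<tau> \<in> H" for \<sigma> \<tau>
      using that by (simp add: H_def VL G_compose)
  qed (auto simp: H_def)
  then interpret H: permutation_group "{1..n}" "index_perm ` H" .
  have altH: "carrier (alt_group n) \<subseteq> index_perm ` H"
  proof (rule alt_group_least[OF HP])
    fix x y w :: nat assume xyw: "{x, y, w} \<subseteq> {1..n}" "distinct [x, y, w]"
    have "cycle_of_list [x, y, w] \<in> three_cycles n"
      using xyw by (intro CollectI exI[of _ "[x, y, w]"]) simp
    then have "cycle_of_list [x, y, w] \<in> carrier (alt_group n)"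
      using three_cycles_incl[of n] by blast
    then obtain \<tau> where \<tau>: "\<tau> \<in> G" "cycle_of_list [x, y, w] = index_perm \<tau>"
      using alt by (auto simp: \<Gamma>_def simp del: cycle_of_list.simps)
    \<comment> \<open>A square fixes the Vandermonde product whatever the sign of
      \<open>\<tau>\<close>, and a 3-cycle is its own fourth power.\<close>
    define \<rho> where "\<rho> = compose L \<tau> \<tau>"
    have \<rho>: "\<rho> \<in> G"
      unfolding \<rho>_def using \<tau>(1) by (intro G_compose)
    have "\<rho> ?V = ?V"
      unfolding \<rho>_def VL using sign[OF \<tau>(1)] neg[OF \<tau>(1)] by auto
    then have "compose L \<rho> \<rho> \<in> H"
      using \<rho> by (simp add: H_def VL G_compose)
    moreover have "index_perm (compose L \<rho> \<rho>) = cycle_of_list [x, y, w]"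
    proof -
      have "distinct [x, w, y]"
        using xyw by auto
      have "index_perm \<rho> = cycle_of_list [x, w, y]"
        unfolding \<rho>_def index_perm_compose[OF \<tau>(1,1)] \<tau>(2)[symmetric]
        by (rule cycle3_square[OF xyw(2)])
      then show ?thesis
        unfolding index_perm_compose[OF \<rho> \<rho>] using cycle3_square[OF \<open>distinct [x, w, y]\<close>] by simp
    qed
    ultimately show "cycle_of_list [x, y, w] \<in> index_perm ` H"
      by (metis imageI)
  qed
  have inj: "\<sigma> = \<tau>" if "\<sigma> \<in> G" "\<tau> \<in> G" "index_perm \<sigma> = index_perm \<tau>" for \<sigma> \<tau>
  proof (rule G_eqI[OF that(1,2)])
    fix x assume "x \<in> S"
    then obtain i where "i \<in> {1..n}" "e i = x"
      using e_surj by blast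
    then show "\<sigma> x = \<tau> x"
      using index_perm_apply(2)[OF that(1)] index_perm_apply(2)[OF that(2)] that(3) by metis
  qed
  let ?\<tau> = "transpose 1 (2::nat)"
  have \<tau>: "?\<tau> permutes {1..n}" "\<not> evenperm ?\<tau>" "permutation ?\<tau>"
    using n permutes_swap_id[of 1 "{1..n}" 2] by (auto simp: evenperm_swap permutation_swap_id)
  have perm: "permutation (index_perm \<sigma>)"
    using index_perm_permutes[OF \<sigma>] permutation_permutes by blast
  show ?thesis
  proof
    assume even: "evenperm (index_perm \<sigma>)"
    then have "index_perm \<sigma> \<in> carrier (alt_group n)"
      using index_perm_permutes[OF \<sigma>] by (simp add: alt_group_carrier)
    then obtain \<tau> where "\<tau> \<in> H" "index_perm \<sigma> = index_perm \<tau>"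
      using altH by blast
    then show "\<sigma> ?V = ?V"
      using inj[OF \<sigma>, of \<tau>] by (simp add: H_def)
  next
    assume fix_V: "\<sigma> ?V = ?V"
    show "evenperm (index_perm \<sigma>)"
    proof (rule ccontr)
      assume odd: "\<not> evenperm (index_perm \<sigma>)"
      have "index_perm \<sigma> \<circ> ?\<tau> \<in> carrier (alt_group n)"
        using odd \<tau> perm permutes_compose[OF \<tau>(1) index_perm_permutes[OF \<sigma>]]
        by (simp add: alt_group_carrier evenperm_comp)
      then have "index_perm \<sigma> \<circ> ?\<tau> \<in> index_perm ` H"
        using altH by blast
      moreover have "index_perm \<sigma> \<in> index_perm ` H"
        using \<sigma> fix_V by (auto simp: H_def)
      ultimately have "inv' (index_perm \<sigma>) \<circ> (index_perm \<sigma> \<circ> ?\<tau>) \<in> index_perm ` H"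
        using H.comp_closed H.inv_closed by blast
      then have "?\<tau> \<in> index_perm ` H"
        using permutes_inv_o(2)[OF index_perm_permutes[OF \<sigma>]] by (simp add: o_assoc)
      then obtain \<rho> where \<rho>: "\<rho> \<in> H" "index_perm \<rho> = ?\<tau>"
        by (metis imageE)
      then have "?V = vandermonde n (e \<circ> ?\<tau>)"
        using G_vandermonde[of \<rho>] by (simp add: H_def)
      also have "\<dots> = - ?V"
        by (rule vandermonde_transpose[OF n])
      finally show False
        using nz by simp
    qed
  qed
qed

text \<open>Since \<open>w\<close> is a rational multiple of the Vandermonde product,
  \<open>K\<close> lies in \<open>L\<close>, the splitting field does not grow, and fixing
  \<open>K\<close> means fixing that product, which is to be even. It makes no difference whether
  \<open>\<Gamma>\<close> is the alternating or the full symmetric group.\<close>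

theorem galois_group_alt:
  assumes n: "n \<ge> 2" and alt: "carrier (alt_group n) \<subseteq> \<Gamma>"
    and c: "c \<in> \<rat>" "c \<noteq> 0" "vandermonde n e = c * w" and w: "w \<noteq> 0" "w\<^sup>2 \<in> \<rat>"
    and K: "K = {a + b * w | a b. a \<in> \<rat> \<and> b \<in> \<rat>}"
  shows "galois_group K f \<cong> alt_group n"
proof -
  let ?V = "vandermonde n e"
  have w_eq: "w = inverse c * ?V"
    using c by simp
  have cL: "inverse c \<in> L" "c \<in> L"
    using c Rats_subset_L by auto
  have wL: "w \<in> L"
    unfolding w_eq using cL vandermonde_in_L subring_L by (intro is_subring_mult)
  have KL: "K \<subseteq> L"
    unfolding K using wL Rats_subset_L subring_L by (auto intro!: is_subring_add is_subring_mult)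
  have QK: "\<rat> \<subseteq> K"
  proof
    fix a :: complex assume "a \<in> \<rat>"
    then show "a \<in> K"
      unfolding K by (intro CollectI exI[of _ a] exI[of _ 0]) simp
  qed
  have split: "splitting_field K f = L"
  proof
    show "splitting_field K f \<subseteq> L"
      unfolding splitting_field_def using KL S_subset_L
      by (intro generate_field_least[OF subfield_L]) (auto simp: S_def)
    have "is_subfield (splitting_field K f)"
      unfolding splitting_field_def by (rule is_subfield_generate)
    moreover have "S \<subseteq> splitting_field K f"
      unfolding splitting_field_def S_def by (auto intro: generate_field.incl)
    ultimately show "L \<subseteq> splitting_field K f"
      by (rule L_least)
  qed
  define H where "H = field_automorphisms K L"
  have sq: "?V\<^sup>2 \<in> \<rat>"
    using c w by (simp add: power_mult_distrib)
  have nz: "?V \<noteq> 0"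
    using c w by simp
  have H_iff: "\<sigma> \<in> H \<longleftrightarrow> \<sigma> \<in> G \<and> evenperm (index_perm \<sigma>)" for \<sigma>
  proof -
    have "(\<forall>x\<in>K. \<sigma> x = x) \<longleftrightarrow> \<sigma> ?V = ?V" if \<sigma>: "\<sigma> \<in> G"
    proof -
      note hom = G_hom[OF \<sigma>]
      have "?V \<in> K"
        unfolding K using c(1,3) by (intro CollectI exI[of _ 0] exI[of _ c]) simp
      moreover have "\<sigma> x = x" if fix_V: "\<sigma> ?V = ?V" and x: "x \<in> K" for x
      proof -
        obtain a b where ab: "x = a + b * w" "a \<in> \<rat>" "b \<in> \<rat>"
          using x K by auto
        have "\<sigma> w = w"
          unfolding w_eq using hom_on_mult[OF subring_L hom cL(1) vandermonde_in_L] fix_V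
            G_Rats[OF \<sigma>, of "inverse c"] c by simp
        moreover have "a \<in> L" "b \<in> L" "b * w \<in> L"
          using ab Rats_subset_L wL subring_L by (auto intro: is_subring_mult)
        ultimately show ?thesis
          using ab G_Rats[OF \<sigma>] wL
          by (simp add: hom_on_add[OF subring_L hom] hom_on_mult[OF subring_L hom])
      qed
      ultimately show ?thesis
        by metis
    qed
    moreover have "\<sigma> \<in> H \<longleftrightarrow> \<sigma> \<in> G \<and> (\<forall>x\<in>K. \<sigma> x = x)"
      using QK by (auto simp: H_def G_def field_automorphisms_iff)
    ultimately show ?thesis
      using fixes_vandermonde_iff_even[OF n alt sq nz] by metis
  qed
  have HG: "\<sigma> \<in> G" if "\<sigma> \<in> H" for \<sigma>
    using that H_iff by blast
  have gal: "galois_group K f = BijGroup S \<lparr>carrier := (\<lambda>\<sigma>. restrict \<sigma> S) ` H\<rparr>"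
    by (simp add: galois_group_def split H_def S_def)
  have ip: "index_perm (restrict \<sigma> S) = index_perm \<sigma>" for \<sigma>
    using e_mem by (auto simp: index_perm_def fun_eq_iff)
  have bij: "restrict \<sigma> S \<in> Bij S" if "\<sigma> \<in> G" for \<sigma>
    using hom_image_S[OF G_hom[OF that]] inj_on_subset[OF G_inj[OF that] S_subset_L]
    by (auto simp: Bij_def bij_betw_def inj_on_def)
  have comp: "compose S (restrict \<sigma> S) (restrict \<tau> S) = restrict (compose L \<sigma> \<tau>) S"
    if "\<tau> \<in> G" for \<sigma> \<tau>
    using hom_root[OF G_hom[OF that]] S_subset_L by (auto simp: compose_def restrict_def fun_eq_iff)
  have "index_perm \<in> iso (galois_group K f) (alt_group n)"
    unfolding iso_def
  proof (intro CollectI conjI)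
    show "index_perm \<in> hom (galois_group K f) (alt_group n)"
    proof (rule homI)
      fix \<rho> assume "\<rho> \<in> carrier (galois_group K f)"
      then obtain \<sigma> where \<sigma>: "\<sigma> \<in> H" "\<rho> = restrict \<sigma> S"
        unfolding gal by auto
      then show "index_perm \<rho> \<in> carrier (alt_group n)"
        using H_iff index_perm_permutes by (simp add: ip alt_group_carrier)
      fix \<rho>' assume "\<rho>' \<in> carrier (galois_group K f)"
      then obtain \<sigma>' where \<sigma>': "\<sigma>' \<in> H" "\<rho>' = restrict \<sigma>' S"
        unfolding gal by auto
      have "\<rho> \<otimes>\<^bsub>galois_group K f\<^esub> \<rho>' = compose S \<rho> \<rho>'"
        unfolding gal using \<sigma> \<sigma>' bij HG by (simp add: BijGroup_def)
      also have "\<dots> = restrict (compose L \<sigma> \<sigma>') S"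
        unfolding \<sigma>(2) \<sigma>'(2) by (rule comp[OF HG[OF \<sigma>'(1)]])
      finally have eq: "\<rho> \<otimes>\<^bsub>galois_group K f\<^esub> \<rho>' = restrict (compose L \<sigma> \<sigma>') S" .
      show "index_perm (\<rho> \<otimes>\<^bsub>galois_group K f\<^esub> \<rho>') =
          index_perm \<rho> \<otimes>\<^bsub>alt_group n\<^esub> index_perm \<rho>'"
        unfolding eq unfolding \<sigma>(2) \<sigma>'(2) ip alt_group_mult
        by (rule index_perm_compose[OF HG[OF \<sigma>(1)] HG[OF \<sigma>'(1)]])
    qed
    show "bij_betw index_perm (carrier (galois_group K f)) (carrier (alt_group n))"
    proof (rule bij_betwI')
      fix \<rho> \<rho>' assume "\<rho> \<in> carrier (galois_group K f)" "\<rho>' \<in> carrier (galois_group K f)"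
      then obtain \<sigma> \<sigma>' where \<sigma>: "\<sigma> \<in> H" "\<rho> = restrict \<sigma> S" and \<sigma>': "\<sigma>' \<in> H" "\<rho>' = restrict \<sigma>' S"
        unfolding gal by auto
      show "index_perm \<rho> = index_perm \<rho>' \<longleftrightarrow> \<rho> = \<rho>'"
      proof
        assume eq: "index_perm \<rho> = index_perm \<rho>'"
        have "\<sigma> x = \<sigma>' x" if x: "x \<in> S" for x
        proof -
          obtain i where "i \<in> {1..n}" "e i = x"
            using e_surj[OF x] by blast
          then show ?thesis
            using index_perm_apply(2)[OF HG[OF \<sigma>(1)]] index_perm_apply(2)[OF HG[OF \<sigma>'(1)]] eq
            unfolding \<sigma>(2) \<sigma>'(2) ip by metis
        qed
        then show "\<rho> = \<rho>'"
          using \<sigma>(2) \<sigma>'(2) by (auto simp: restrict_def fun_eq_iff)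
      qed simp
    next
      fix \<rho> assume "\<rho> \<in> carrier (galois_group K f)"
      then obtain \<sigma> where \<sigma>: "\<sigma> \<in> H" "\<rho> = restrict \<sigma> S"
        unfolding gal by auto
      then show "index_perm \<rho> \<in> carrier (alt_group n)"
        using H_iff index_perm_permutes by (simp add: ip alt_group_carrier)
    next
      fix \<pi> assume \<pi>: "\<pi> \<in> carrier (alt_group n)"
      then obtain \<sigma> where \<sigma>: "\<sigma> \<in> G" "\<pi> = index_perm \<sigma>"
        using alt by (auto simp: \<Gamma>_def)
      then have "\<sigma> \<in> H"
        using \<pi> H_iff by (simp add: alt_group_carrier)
      then have "restrict \<sigma> S \<in> carrier (galois_group K f)"
        unfolding gal by simp
      then show "\<exists>\<rho>\<in>carrier (galois_group K f). \<pi> = index_perm \<rho>"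
        using \<sigma> ip by metis
    qed
  qed
  then show ?thesis
    by (auto simp: is_iso_def)
qed

end

section \<open>The family of polynomials\<close>

text \<open>Generic in the ring, so that one formula serves both the integer polynomials of the
  theorem and their complex images.\<close>

definition fam :: "nat \<Rightarrow> 'a::comm_ring_1 \<Rightarrow> 'a poly" where
  "fam k t = monom 1 (2 * k + 2) + monom ((of_nat k + 1)\<^sup>2) (2 * k + 1) - smult t [:(of_nat k)\<^sup>2, 1:]"

text \<open>The value of \<open>t\<close> at which \<open>fam k t\<close> has a triple root at \<open>- k * (k + 1)\<close>.\<close>

definition crit_value :: "nat \<Rightarrow> int" where
  "crit_value k = (int k + 1) ^ (2 * k + 2) * int k ^ (2 * k)"

lemma coeff_fam:
  "coeff (fam k t) j = (if j = 2 * k + 2 then 1 else 0) + (if j = 2 * k + 1 then (of_nat k + 1)\<^sup>2 else 0)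
     - (if j = 0 then t * (of_nat k)\<^sup>2 else if j = 1 then t else 0)"
  by (auto simp: fam_def coeff_pCons split: nat.splits)

lemma poly_fam: "poly (fam k t) y = y ^ (2 * k + 1) * (y + (of_nat k + 1)\<^sup>2) - t * (y + (of_nat k)\<^sup>2)"
  by (simp add: fam_def poly_monom algebra_simps)

lemma map_poly_fam: "map_poly of_int (fam k t) = fam k (of_int t)"
  by (rule poly_eqI) (simp add: coeff_map_poly coeff_fam)

lemma degree_fam:
  assumes "k \<ge> 1"
  shows "degree (fam k t) = 2 * k + 2" "lead_coeff (fam k t) = 1"
proof -
  show "degree (fam k t) = 2 * k + 2"
  proof (rule antisym)
    show "degree (fam k t) \<le> 2 * k + 2"
      by (rule degree_le) (auto simp: coeff_fam)
    show "2 * k + 2 \<le> degree (fam k t)"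
      by (rule le_degree) (simp add: coeff_fam)
  qed
  then show "lead_coeff (fam k t) = 1"
    by (simp add: coeff_fam)
qed

text \<open>The factor \<open>Q = Y + k^2\<close> has derivative \<open>1\<close>, so the left side
  is \<open>f' Q - f Q'\<close>, in which the terms \<open>t Q\<close> cancel. At a root of
  \<open>f\<close> it evaluates \<open>f'\<close>, and apart from the constant it is a
  square.\<close>

lemma fam_wronskian:
  fixes y t :: complex
  shows "poly (pderiv (fam k t)) y * (y + (of_nat k)\<^sup>2) - poly (fam k t) y =
    of_nat (2 * k + 1) * y ^ (2 * k) * (y + of_nat k * (of_nat k + 1))\<^sup>2"
proof -
  have "poly (pderiv (fam k t)) y = of_nat (2 * k + 2) * (y ^ (2 * k) * y)
      + of_nat (2 * k + 1) * (of_nat k + 1)\<^sup>2 * y ^ (2 * k) - t"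
    by (simp add: fam_def pderiv_add pderiv_diff pderiv_monom pderiv_smult pderiv_pCons poly_monom algebra_simps)
  then show ?thesis
    unfolding poly_fam by (simp add: power2_eq_square) (simp add: algebra_simps)
qed

lemma poly_fam_crit:
  fixes t :: complex
  shows "poly (fam k t) (- (of_nat k * (of_nat k + 1))) = (t - of_int (crit_value k)) * of_nat k"
proof -
  have p: "(- (of_nat k * (of_nat k + 1)) :: complex) ^ (2 * k + 1) =
      - ((of_nat k + 1) ^ (2 * k + 1) * of_nat k ^ (2 * k + 1))"
  proof -
    have "odd (2 * k + 1)"
      by simp
    show ?thesis
      unfolding power_minus_odd[OF \<open>odd (2 * k + 1)\<close>] power_mult_distrib by (simp only: mult.commute)
  qed
  have h1: "- (of_nat k * (of_nat k + 1)) + (of_nat k + 1)\<^sup>2 = (of_nat k + 1 :: complex)"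
    by (simp add: power2_eq_square algebra_simps)
  have h2: "- (of_nat k * (of_nat k + 1)) + (of_nat k)\<^sup>2 = (- of_nat k :: complex)"
    by (simp add: power2_eq_square algebra_simps)
  show ?thesis
    unfolding poly_fam p h1 h2 by (simp add: crit_value_def left_diff_distrib right_diff_distrib mult_ac)
qed

text \<open>At the zero of \<open>Q\<close> the parameter drops out. The factor
  \<open>2 * k + 1\<close> left beside a square is what ends up in
  \<open>disc_const\<close>.\<close>

lemma poly_fam_pole:
  fixes t :: complex
  shows "poly (fam k t) (- ((of_nat k)\<^sup>2)) = - ((of_nat k ^ (2 * k + 1))\<^sup>2 * of_nat (2 * k + 1))"
proof -
  have p: "(- ((of_nat k)\<^sup>2) :: complex) ^ (2 * k + 1) = - ((of_nat k ^ (2 * k + 1))\<^sup>2)"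
  proof -
    have "odd (2 * k + 1)"
      by simp
    show ?thesis
      unfolding power_minus_odd[OF \<open>odd (2 * k + 1)\<close>] power_mult[symmetric] by (simp only: mult.commute)
  qed
  have h: "- ((of_nat k)\<^sup>2) + (of_nat k + 1)\<^sup>2 = (of_nat (2 * k + 1) :: complex)"
    by (simp add: power2_eq_square algebra_simps)
  show ?thesis
    unfolding poly_fam p h by simp
qed

lemma poly_fam_0: "poly (fam k t) 0 = - (t * (of_nat k)\<^sup>2)"
  by (simp add: poly_fam)

text \<open>The Taylor coefficients at the critical point are read off from the shifted Wronskian
  identity \<open>g' (Y - k) - g = W\<close>, where \<open>W\<close> is divisible by
  \<open>Y^2\<close>. Comparing coefficients of degree \<open>0\<close>, \<open>1\<close> and
  \<open>2\<close> yields the last three claims one after the other.\<close>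

lemma coeff_fam_shift:
  fixes t :: complex
  assumes "k \<ge> 1"
  defines "g \<equiv> pcompose (fam k t) [:- (of_nat k * (of_nat k + 1)), 1:]"
  shows "coeff g 0 = (t - of_int (crit_value k)) * of_nat k" "coeff g 1 = - (t - of_int (crit_value k))"
    "coeff g 2 = 0"
    "3 * of_nat k * coeff g 3 = - (of_nat (2 * k + 1) * (of_nat k * (of_nat k + 1)) ^ (2 * k))"
proof -
  define \<rho> :: complex where "\<rho> = - (of_nat k * (of_nat k + 1))"
  have k0: "(of_nat k :: complex) \<noteq> 0"
    using assms(1) by simp
  have g: "g = pcompose (fam k t) [:\<rho>, 1:]"
    by (simp add: g_def \<rho>_def)
  show c0: "coeff g 0 = (t - of_int (crit_value k)) * of_nat k"
    using poly_fam_crit[of k t] by (simp add: g poly_pcompose \<rho>_def flip: poly_0_coeff_0)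
  define W where "W = smult (of_nat (2 * k + 1)) ([:\<rho>, 1:] ^ (2 * k) * [:0, 1:]\<^sup>2)"
  have W: "pderiv g * [:- of_nat k, 1:] - g = W"
  proof (rule poly_eq_poly_eq_iff[THEN iffD1], rule ext)
    fix y
    have "pderiv g = pcompose (pderiv (fam k t)) [:\<rho>, 1:]"
      unfolding g by (simp add: pderiv_pcompose pderiv_pCons)
    moreover have "\<rho> + (of_nat k)\<^sup>2 = - of_nat k"
      by (simp add: \<rho>_def power2_eq_square algebra_simps)
    ultimately show "poly (pderiv g * [:- of_nat k, 1:] - g) y = poly W y"
      using fam_wronskian[of k t "\<rho> + y"]
      by (simp add: W_def g poly_pcompose poly_power \<rho>_def algebra_simps)
  qed
  have Wc: "coeff W 0 = 0" "coeff W 1 = 0" "coeff W 2 = of_nat (2 * k + 1) * \<rho> ^ (2 * k)"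
  proof -
    have "W = smult (of_nat (2 * k + 1)) (pCons 0 (pCons 0 ([:\<rho>, 1:] ^ (2 * k))))"
      by (simp add: W_def power2_eq_square)
    moreover have "coeff ([:\<rho>, 1:] ^ (2 * k)) 0 = \<rho> ^ (2 * k)"
      by (simp add: coeff_0_power)
    ultimately show "coeff W 0 = 0" "coeff W 1 = 0" "coeff W 2 = of_nat (2 * k + 1) * \<rho> ^ (2 * k)"
      by (simp_all add: numeral_2_eq_2)
  qed
  have lhs: "pderiv g * [:- of_nat k, 1:] - g = pCons 0 (pderiv g) - smult (of_nat k) (pderiv g) - g"
    by simp
  have e0: "- of_nat k * coeff g 1 - coeff g 0 = 0"
    using Wc(1) W[symmetric] unfolding lhs by (simp add: coeff_pderiv)
  show "coeff g 1 = - (t - of_int (crit_value k))"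
  proof -
    have "of_nat k * coeff g 1 = - coeff g 0"
      using e0 by (metis eq_iff_diff_eq_0 minus_minus mult_minus_left)
    also have "\<dots> = of_nat k * - (t - of_int (crit_value k))"
      unfolding c0 by (simp only: mult.commute mult_minus_right)
    finally show ?thesis
      using mult_left_cancel[OF k0] by blast
  qed
  have "2 * of_nat k * coeff g 2 = 0"
    using Wc(2) W[symmetric] unfolding lhs by (simp add: coeff_pderiv numeral_2_eq_2)
  then show c2: "coeff g 2 = 0"
    using k0 by simp
  have "- (3 * of_nat k * coeff g 3) = of_nat (2 * k + 1) * \<rho> ^ (2 * k)"
  proof -
    have "coeff W 2 = 2 * coeff g 2 - of_nat k * (3 * coeff g 3) - coeff g 2"
      unfolding W[symmetric] lhs by (simp add: coeff_pderiv numeral_2_eq_2 numeral_3_eq_3)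
    then show ?thesis
      using Wc(3) c2 by (simp add: mult_ac)
  qed
  moreover have "\<rho> ^ (2 * k) = (of_nat k * (of_nat k + 1)) ^ (2 * k)"
    by (simp add: \<rho>_def)
  ultimately show "3 * of_nat k * coeff g 3 = - (of_nat (2 * k + 1) * (of_nat k * (of_nat k + 1)) ^ (2 * k))"
    by (metis minus_minus)
qed

lemma pderiv_prod_linear:
  fixes z :: complex
  assumes "finite S" "z \<in> S"
  shows "poly (pderiv (\<Prod>x\<in>S. [:- x, 1:])) z = (\<Prod>y\<in>S - {z}. z - y)"
proof -
  have "(\<Prod>x\<in>S. [:- x, 1:]) = [:- z, 1:] * (\<Prod>x\<in>S - {z}. [:- x, 1:])"
    by (rule prod.remove[OF assms])
  then show ?thesis
    by (simp only: pderiv_mult) (simp add: pderiv_pCons poly_prod)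
qed

section \<open>Quadratic fields\<close>

text \<open>\<open>w\<close> may be rational and \<open>K\<close> then equals the rationals. This
  does happen: \<open>disc_const 4 = 9\<close>, so for \<open>n = 10\<close> no extension is
  made.\<close>

lemma quadratic_field:
  fixes w :: complex
  assumes w: "w\<^sup>2 \<in> \<rat>"
  defines "K \<equiv> {a + b * w | a b. a \<in> \<rat> \<and> b \<in> \<rat>}"
  shows "number_field K" "degree_over_Rats K \<le> 2"
proof -
  interpret CR: field complex_ring by (rule field_complex_ring)
  have Q: "subfield \<rat> complex_ring"
    using is_subfield_Rats by (simp add: subfield_complex_ring_iff)
  have KI: "a + b * w \<in> K" if "a \<in> \<rat>" "b \<in> \<rat>" for a b
    unfolding K_def using that by blast
  have "is_subfield K \<and> (\<exists>d\<le>2. CR.dimension d \<rat> K)"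
  proof (cases "w \<in> \<rat>")
    case True
    have "K = \<rat>"
    proof (intro equalityI subsetI)
      fix x assume "x \<in> K"
      then show "x \<in> \<rat>"
        using True by (auto simp: K_def)
    next
      fix x :: complex assume "x \<in> \<rat>"
      then show "x \<in> K"
        unfolding K_def by (intro CollectI exI[of _ x] exI[of _ 0]) simp
    qed
    then show ?thesis
      using is_subfield_Rats CR.dimension_one[OF Q] by (intro conjI exI[of _ 1]) auto
  next
    case False
    have "is_subring K"
      unfolding is_subring_def
    proof (intro conjI ballI)
      show "1 \<in> K"
        unfolding K_def by (intro CollectI exI[of _ 1] exI[of _ 0]) simp
      fix x y assume "x \<in> K" "y \<in> K"
      then obtain a b c d where xy: "x = a + b * w" "y = c + d * w" and Q: "a \<in> \<rat>" "b \<in> \<rat>" "c \<in> \<rat>" "d \<in> \<rat>"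
        by (auto simp: K_def)
      have "x - y = (a - c) + (b - d) * w"
        by (simp add: xy algebra_simps)
      then show "x - y \<in> K"
        using KI[of "a - c" "b - d"] Q by simp
      have "x * y = (a * c + b * d * w\<^sup>2) + (a * d + b * c) * w"
        by (simp add: xy algebra_simps power2_eq_square)
      then show "x * y \<in> K"
        using KI[of "a * c + b * d * w\<^sup>2" "a * d + b * c"] Q w by simp
    qed
    moreover have "inverse x \<in> K" if x: "x \<in> K" for x
    proof -
      obtain a b where ab: "x = a + b * w" "a \<in> \<rat>" "b \<in> \<rat>"
        using x by (auto simp: K_def)
      define N where "N = a\<^sup>2 - b\<^sup>2 * w\<^sup>2"
      have prod: "(a + b * w) * (a - b * w) = N"
        by (simp add: N_def algebra_simps power2_eq_square)
      have NQ: "N \<in> \<rat>"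
        unfolding N_def using ab w by simp
      show ?thesis
      proof (cases "N = 0")
        case True
        \<comment> \<open>\<open>w\<close> is irrational in this case, so a vanishing norm forces
          \<open>b = 0\<close> and leaves a rational \<open>x\<close>.\<close>
        have "b = 0"
        proof (rule ccontr)
          assume "b \<noteq> 0"
          have "a + b * w = 0 \<or> a - b * w = 0"
            using prod True by simp
          then have "w = - a / b \<or> w = a / b"
            using \<open>b \<noteq> 0\<close> by (auto simp: field_simps add_eq_0_iff)
          then show False
            using False ab by auto
        qed
        then show ?thesis
          using ab unfolding K_def by (intro CollectI exI[of _ "inverse a"] exI[of _ 0]) simp
      next
        case N0: False
        then have "inverse x = a / N + (- b / N) * w"
          using prod ab by (intro inverse_unique) (simp add: field_simps)
        then show ?thesis
          using KI[of "a / N" "- b / N"] ab NQ by simp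
      qed
    qed
    moreover have "CR.dimension 2 \<rat> K"
    proof -
      have "CR.dimension (Suc 1) \<rat> (CR.line_extension \<rat> w \<rat>)"
        using False CR.dimension_one[OF Q] by (intro CR.Suc_dim) auto
      moreover have "CR.line_extension \<rat> w \<rat> = K"
      proof (intro equalityI subsetI)
        fix x assume "x \<in> CR.line_extension \<rat> w \<rat>"
        then obtain b a where "b \<in> \<rat>" "a \<in> \<rat>" "x = b * w + a"
          by (auto simp: CR.line_extension_mem_iff)
        then show "x \<in> K"
          unfolding K_def by (intro CollectI exI[of _ a] exI[of _ b]) simp
      next
        fix x assume "x \<in> K"
        then obtain a b where "a \<in> \<rat>" "b \<in> \<rat>" "x = a + b * w"
          by (auto simp: K_def)
        then show "x \<in> CR.line_extension \<rat> w \<rat>"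
          unfolding CR.line_extension_mem_iff by (intro bexI[of _ b] bexI[of _ a]) simp_all
      qed
      ultimately show ?thesis
        by (simp add: numeral_2_eq_2)
    qed
    ultimately show ?thesis
      by (auto simp: is_subfield_def)
  qed
  then obtain d where d: "is_subfield K" "d \<le> 2" "CR.dimension d \<rat> K"
    by blast
  show "number_field K"
    using d by (auto simp: number_field_def subfield_complex_ring_iff CR.finite_dimension_def)
  have "CR.dim \<rat> K = d"
    unfolding CR.dim_def using d(3)
    by (rule the_equality) (rule CR.dimension_is_inj[OF Q _ d(3)])
  then show "degree_over_Rats K \<le> 2"
    using d(2) by (simp add: degree_over_Rats_def)
qed

section \<open>Specialisations with Galois group containing the alternating group\<close>

text \<open>This equals \<open>(- 1) ^ k * (2 * k + 1)\<close>. The power of \<open>- 1\<close> is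
  the sign in \<open>prod_differences\<close> for \<open>2 * k + 2\<close> points, and the outer
  minus comes from \<open>poly_fam_pole\<close>.\<close>

definition disc_const :: "nat \<Rightarrow> int" where
  "disc_const k = - ((- 1) ^ (\<Sum>j\<in>{1..2 * k + 2}. j - 1) * int (2 * k + 1))"

text \<open>Both primes exceed \<open>fact n\<close> to be tame and coprime to \<open>k\<close>,
  \<open>k + 1\<close> and \<open>2 * k + 1\<close>. The further summands in \<open>p_large\<close>
  bound the candidates for a rational root.\<close>

locale specialisation =
  fixes k p q :: nat and t :: int
  assumes k: "k \<ge> 1"
    and prime_p: "prime p" and prime_q: "prime q"
    and p_large: "fact (2 * k + 2) + k ^ (4 * k + 2) * (2 * k + 1) + (2 * k + 1) < p"
    and q_large: "fact (2 * k + 2) < q"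
    and p_dvd: "int p dvd t" and p_exact: "\<not> (int p)\<^sup>2 dvd t"
    and q_dvd: "int q dvd t - crit_value k" and q_exact: "\<not> (int q)\<^sup>2 dvd t - crit_value k"
begin

abbreviation "n \<equiv> 2 * k + 2"
abbreviation "f \<equiv> fam k (of_int t) :: complex poly"

lemma not_dvd_small:
  assumes "fact n < r" "0 < a" "a \<le> n"
  shows "\<not> int r dvd int a"
proof -
  have "a < r"
    using assms fact_ge_self[of n] by linarith
  then show ?thesis
    using assms by (simp add: nat_dvd_not_less)
qed

lemma p_fact: "fact n < p"
  using p_large by linarith

lemma t_nonzero: "t \<noteq> 0" and t_noncrit: "t \<noteq> crit_value k"
  using p_exact q_exact by auto

lemma f_Ints: "f \<in> polys_over \<int>"
  by (auto simp: polys_over_def coeff_fam)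

lemma lead_f: "lead_coeff f = 1" and degree_f: "degree f = n"
  using degree_fam[OF k] by auto

sublocale rational_poly f
proof
  show "f \<in> polys_over \<rat>"
    using f_Ints Ints_subset_Rats by (auto simp: polys_over_def)
  show "f \<noteq> 0"
    using lead_f by auto
qed

lemma S_iff: "z \<in> S \<longleftrightarrow> poly f z = 0"
  by (simp add: S_def complex_roots_def)

lemma root_pderiv:
  assumes "z \<in> S"
  shows "poly (pderiv f) z * (z + (of_nat k)\<^sup>2) =
    of_nat (2 * k + 1) * z ^ (2 * k) * (z + of_nat k * (of_nat k + 1))\<^sup>2"
  using fam_wronskian[of k "of_int t" z] assms by (simp add: S_iff)

lemma zero_notin_S: "0 \<notin> S"
  using t_nonzero k by (simp add: S_iff poly_fam_0)

lemma crit_notin_S: "- (of_nat k * (of_nat k + 1)) \<notin> S"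
  unfolding S_iff poly_fam_crit using t_noncrit k by simp

text \<open>Separability: by the Wronskian a multiple root could only be \<open>0\<close> or the
  critical point, and these are excluded by \<open>t \<noteq> 0\<close> and
  \<open>t \<noteq> crit_value k\<close>.\<close>

lemma f_prod: "f = (\<Prod>z\<in>S. [:- z, 1:])"
proof -
  have "poly (pderiv f) z \<noteq> 0" if "z \<in> S" for z
  proof
    assume "poly (pderiv f) z = 0"
    then have "of_nat (2 * k + 1) * z ^ (2 * k) * (z + of_nat k * (of_nat k + 1))\<^sup>2 = 0"
      using root_pderiv[OF that] by simp
    then have "z = 0 \<or> z + of_nat k * (of_nat k + 1) = 0"
      by (auto simp del: of_nat_mult of_nat_add of_nat_Suc)
    then show False
      using that zero_notin_S crit_notin_S by (auto simp: add_eq_0_iff2)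
  qed
  then have "rsquarefree f"
    by (auto simp: rsquarefree_roots S_iff)
  from complex_poly_decompose_rsquarefree[OF this] show ?thesis
    using lead_f by (simp add: S_def complex_roots_def)
qed

lemma card_S: "card S = n"
proof -
  have "degree (\<Prod>z\<in>S. [:- z, 1:]) = (\<Sum>z\<in>S. degree [:- z, 1 :: complex:])"
    by (rule degree_prod_eq_sum_degree) auto
  then show ?thesis
    using degree_f f_prod by simp
qed

text \<open>A rational root is an integer \<open>y\<close> with
  \<open>y ^ (2 * k + 1) * b = t * a\<close>. Here \<open>a\<close> divides a constant independent
  of \<open>t\<close>, so \<open>b = a + (2 * k + 1)\<close> is smaller than \<open>p\<close> in
  absolute value. As \<open>p\<close> divides \<open>t\<close>, either it divides \<open>b\<close>,
  forcing \<open>b = 0\<close>, or it divides \<open>y\<close>, and then \<open>p\<close> squared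
  would divide \<open>t\<close>.\<close>

lemma no_rational_root:
  assumes x: "x \<in> S"
  shows "x \<notin> \<rat>"
proof
  assume "x \<in> \<rat>"
  moreover have "algebraic_int x"
    using x lead_f f_Ints by (intro algebraic_int.intros[of f]) (auto simp: S_iff polys_over_def)
  ultimately have "x \<in> \<int>"
    by (rule rational_algebraic_int_is_int[rotated])
  then obtain y where y: "x = of_int y"
    by (auto elim: Ints_cases)
  define a where "a = y + (int k)\<^sup>2"
  define b where "b = y + (int k + 1)\<^sup>2"
  have "(of_int (y ^ (2 * k + 1) * b - t * a) :: complex) = 0"
    using x unfolding S_iff poly_fam y a_def b_def by simp
  then have eq: "y ^ (2 * k + 1) * b = t * a"
    by (simp only: of_int_eq_0_iff)
  have ba: "b = a + (2 * int k + 1)"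
    by (simp add: a_def b_def power2_eq_square algebra_simps)
  \<comment> \<open>Up to sign this is the value of \<open>y ^ (2 * k + 1) * b\<close> at
    \<open>y = - k^2\<close>, the point where \<open>a\<close> vanishes.\<close>
  define C where "C = int k ^ (4 * k + 2) * (2 * int k + 1)"
  have aC: "a dvd C"
  proof -
    have "[y = - ((int k)\<^sup>2)] (mod a)"
      by (simp add: cong_iff_dvd_diff a_def)
    moreover have "[b = 2 * int k + 1] (mod a)"
      by (simp add: cong_iff_dvd_diff ba)
    ultimately have "[y ^ (2 * k + 1) * b = (- ((int k)\<^sup>2)) ^ (2 * k + 1) * (2 * int k + 1)] (mod a)"
      by (intro cong_mult cong_pow)
    moreover have "a dvd y ^ (2 * k + 1) * b"
      unfolding eq by simp
    ultimately have "a dvd (- ((int k)\<^sup>2)) ^ (2 * k + 1) * (2 * int k + 1)"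
      using cong_dvd_iff by blast
    moreover have "(- ((int k)\<^sup>2)) ^ (2 * k + 1) = - (int k ^ (4 * k + 2))"
      by (simp add: power_minus_odd power_mult[symmetric] flip: power_Suc)
    ultimately show ?thesis
      by (simp add: C_def)
  qed
  have C0: "C > 0"
    using k by (simp add: C_def)
  have aC_le: "\<bar>a\<bar> \<le> C"
    using dvd_imp_le_int[OF _ aC] C0 by simp
  have pC: "C + (2 * int k + 1) < int p"
  proof -
    have "int (k ^ (4 * k + 2) * (2 * k + 1) + (2 * k + 1)) < int p"
      using p_large by linarith
    then show ?thesis
      by (simp add: C_def algebra_simps)
  qed
  have pi: "prime (int p)"
    using prime_p by simp
  have pk: "\<not> int p dvd int k"
    using not_dvd_small[OF p_fact, of k] k by simp
  have "int p dvd y ^ (2 * k + 1) * b"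
    unfolding eq using p_dvd by simp
  then have "int p dvd y \<or> int p dvd b"
    using pi prime_dvd_mult_iff prime_dvd_power by blast
  then show False
  proof
    assume py: "int p dvd y"
    then have "(int p)\<^sup>2 dvd y\<^sup>2"
      by (rule dvd_power_same)
    moreover have "y\<^sup>2 dvd y ^ (2 * k + 1)"
      using k by (intro le_imp_power_dvd) simp
    ultimately have "(int p)\<^sup>2 dvd t * a"
      unfolding eq[symmetric] using dvd_trans dvd_mult2 by blast
    moreover have "\<not> int p dvd a"
    proof
      assume "int p dvd a"
      then have "int p dvd (int k)\<^sup>2"
        using py dvd_diff[of "int p" a y] by (simp add: a_def)
      then show False
        using pi prime_dvd_power pk by blast
    qed
    then have "coprime ((int p)\<^sup>2) a"
      using pi by (intro coprime_power_left_iff[THEN iffD2] disjI1 prime_imp_coprime)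
    ultimately show False
      using p_exact coprime_dvd_mult_left_iff by blast
  next
    assume pb: "int p dvd b"
    have "\<bar>b\<bar> < int p"
      using aC_le pC ba by linarith
    then have "b = 0"
      using pb dvd_imp_le_int[of b "int p"] by auto
    then show False
      using eq t_nonzero ba by auto
  qed
qed

lemma prod_neg_S: "(\<Prod>z\<in>S. x - z) = poly f x"
  by (subst f_prod) (simp add: poly_prod)

text \<open>Modulo \<open>p\<close> the polynomial is \<open>Y^(n-1) (Y + (k+1)^2)\<close> and its
  constant term \<open>- t k^2\<close> is divisible by \<open>p\<close> exactly once, so inertia is
  transitive on the \<open>n-1\<close> roots in \<open>M\<close>. It preserves the class of the one
  remaining root and hence fixes it; irrationality of that root supplies an automorphism moving
  it.\<close>

lemma stabiliser_transitive:
  obtains x0 where "x0 \<in> S" "\<And>x y. x \<in> S - {x0} \<Longrightarrow> y \<in> S - {x0} \<Longrightarrow> \<exists>\<tau>\<in>G. \<tau> x0 = x0 \<and> \<tau> x = y"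
    "\<exists>\<sigma>\<in>G. \<sigma> x0 \<noteq> x0"
proof -
  obtain A :: "complex set" where A: "is_subring A" "inverse (of_nat p) \<notin> A" "\<And>x. x \<in> A \<or> inverse x \<in> A"
    using exists_valuation_ring[of p] prime_gt_1_nat[OF prime_p] by blast
  interpret P: tame_prime f A p
    by unfold_locales (use A prime_p p_fact card_S in auto)
  have SR: "S \<subseteq> P.R"
    using P.S_subset_R lead_f f_Ints by blast
  have coeff_low: "coeff (\<Prod>x\<in>S. [:- x, 1:]) j \<in> P.M" if "j < 2 * k + 1" for j
  proof -
    have "coeff f j = of_int (- (if j = 0 then t * (int k)\<^sup>2 else if j = 1 then t else 0))"
      using that k by (simp add: coeff_fam)
    then show ?thesis
      unfolding f_prod[symmetric] using p_dvd by (simp only: P.of_int_in_M_iff) auto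
  qed
  have pk1: "\<not> int p dvd int (k + 1)"
    using not_dvd_small[OF p_fact, of "k + 1"] by simp
  have pk: "\<not> int p dvd int k"
    using not_dvd_small[OF p_fact, of k] k by simp
  have coeff_top: "coeff (\<Prod>x\<in>S. [:- x, 1:]) (2 * k + 1) \<notin> P.M"
  proof -
    have "coeff f (2 * k + 1) = of_int ((int (k + 1))\<^sup>2)"
      using k by (simp add: coeff_fam add.commute)
    moreover have "\<not> int p dvd (int (k + 1))\<^sup>2"
      using pk1 prime_p prime_dvd_power by (metis prime_nat_int_transfer)
    ultimately show ?thesis
      unfolding f_prod[symmetric] by (simp only: P.of_int_in_M_iff) simp
  qed
  have coeff_0: "coeff (\<Prod>x\<in>S. [:- x, 1:]) 0 / of_nat p \<notin> P.M"
  proof -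
    obtain u where u: "t = int p * u"
      using p_dvd by auto
    have "\<not> int p dvd u"
      using p_exact u by (auto simp: power2_eq_square)
    then have "\<not> int p dvd - (u * (int k)\<^sup>2)"
      using pk prime_p by (metis dvd_minus_iff prime_dvd_mult_iff prime_dvd_power prime_nat_int_transfer)
    moreover have "coeff f 0 / of_nat p = of_int (- (u * (int k)\<^sup>2))"
      using prime_p by (simp add: coeff_fam u prime_gt_0_nat)
    ultimately show ?thesis
      unfolding f_prod[symmetric] by (simp only: P.of_int_in_M_iff) simp
  qed
  have stable: "\<sigma> x \<in> S" if "\<sigma> \<in> G" "x \<in> S" for \<sigma> x
    using hom_root[OF G_hom] that by blast
  have cardM: "card (S \<inter> P.M) = 2 * k + 1"
    by (rule P.inertia_transitive(1)[OF finite_S SR])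
      (erule (1) stable, erule coeff_low, rule coeff_top, rule coeff_0)
  have trans: "\<exists>\<tau>\<in>P.I. \<tau> x = y" if "x \<in> S \<inter> P.M" "y \<in> S \<inter> P.M" for x y
    by (rule P.inertia_transitive(2)[where k = "2 * k + 1", OF finite_S SR])
      (erule (1) stable, erule coeff_low, rule coeff_top, rule coeff_0, rule that(1), rule that(2))
  have "card (S - P.M) = 1"
  proof -
    have "card S = card (S \<inter> P.M) + card (S - P.M)"
      using card_Int_Diff[OF finite_S] by blast
    then show ?thesis
      using cardM card_S by simp
  qed
  then obtain x0 where x0: "S - P.M = {x0}"
    by (auto simp: card_1_singleton_iff)
  have memM: "x \<in> S \<inter> P.M" if "x \<in> S - {x0}" for x
    using that x0 by blast
  show ?thesis
  proof (rule that)
    show "x0 \<in> S"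
      using x0 by blast
    fix x y assume "x \<in> S - {x0}" "y \<in> S - {x0}"
    then obtain \<tau> where \<tau>: "\<tau> \<in> P.I" "\<tau> x = y"
      using trans memM by blast
    have \<tau>G: "\<tau> \<in> G"
      using \<tau>(1) P.I_subset_G by blast
    have "\<tau> x0 - x0 \<in> P.M"
      using \<tau>(1) \<open>x0 \<in> S\<close> SR unfolding P.I_def by blast
    then have "\<tau> x0 \<notin> P.M"
      using P.M_diff_iff x0 by blast
    then have "\<tau> x0 = x0"
      using stable[OF \<tau>G \<open>x0 \<in> S\<close>] x0 by blast
    then show "\<exists>\<tau>\<in>G. \<tau> x0 = x0 \<and> \<tau> x = y"
      using \<tau> \<tau>G by blast
  next
    have "x0 \<in> S"
      using x0 by blast
    then show "\<exists>\<sigma>\<in>G. \<sigma> x0 \<noteq> x0"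
      using fixed_field[of x0] no_rational_root[of x0] S_subset_L by blast
  qed
qed

text \<open>After moving the critical point to \<open>0\<close>, exactly the first three
  coefficients lie in the maximal ideal, so inertia is transitive on the three roots congruent to
  \<open>\<rho>\<close>. The Wronskian shows that no other root is congruent to a second one, and
  inertia, which preserves congruence classes, must fix it.\<close>

lemma three_transitive_subgroup:
  obtains T where "T \<subseteq> S" "card T = 3"
    "\<And>x y. x \<in> T \<Longrightarrow> y \<in> T \<Longrightarrow> \<exists>\<tau>\<in>G. \<tau> x = y \<and> (\<forall>z\<in>S - T. \<tau> z = z)"
proof -
  obtain A :: "complex set" where A: "is_subring A" "inverse (of_nat q) \<notin> A" "\<And>x. x \<in> A \<or> inverse x \<in> A"
    using exists_valuation_ring[of q] prime_gt_1_nat[OF prime_q] by blast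
  interpret P: tame_prime f A q
    by unfold_locales (use A prime_q q_large card_S in auto)
  have SR: "S \<subseteq> P.R"
    using P.S_subset_R lead_f f_Ints by blast
  \<comment> \<open>The critical point is rational, so translating by it commutes with
    \<open>G\<close> and the shifted roots form a \<open>G\<close>-stable set again.\<close>
  define \<rho> :: complex where "\<rho> = - (of_nat k * (of_nat k + 1))"
  have \<rho>Q: "\<rho> \<in> \<rat>"
    by (simp add: \<rho>_def)
  have \<rho>R: "\<rho> \<in> P.R"
  proof -
    have "\<rho> = of_int (- (int k * (int k + 1)))"
      by (simp add: \<rho>_def)
    then show ?thesis
      using is_subring_of_int[OF P.subring_R] by metis
  qed
  define Z where "Z = (\<lambda>x. x - \<rho>) ` S"
  have inj: "inj_on (\<lambda>x. x - \<rho>) S"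
    by (auto intro: inj_onI)
  have finZ: "finite Z" and ZR: "Z \<subseteq> P.R"
    unfolding Z_def using finite_S SR \<rho>R is_subring_diff[OF P.subring_R] by auto
  have shift: "\<sigma> (x - \<rho>) = \<sigma> x - \<rho>" if "\<sigma> \<in> G" "x \<in> S" for \<sigma> x
  proof -
    have "x \<in> L" "\<rho> \<in> L"
      using that(2) S_subset_L \<rho>R P.R_subset_L by auto
    then show ?thesis
      using hom_on_diff[OF subring_L G_hom[OF that(1)]] G_Rats[OF that(1) \<rho>Q] by simp
  qed
  have stable: "\<sigma> z \<in> Z" if "\<sigma> \<in> G" "z \<in> Z" for \<sigma> z
    using that shift hom_root[OF G_hom[OF that(1)]] by (auto simp: Z_def)
  define g where "g = pcompose f [:\<rho>, 1:]"
  have g: "(\<Prod>z\<in>Z. [:- z, 1:]) = g"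
  proof -
    have "(\<Prod>z\<in>Z. [:- z, 1:]) = (\<Prod>x\<in>S. [:- (x - \<rho>), 1:])"
      unfolding Z_def using inj by (simp add: prod.reindex)
    also have "\<dots> = (\<Prod>x\<in>S. pcompose [:- x, 1:] [:\<rho>, 1:])"
      by (simp add: pcompose_pCons)
    also have "\<dots> = pcompose (\<Prod>x\<in>S. [:- x, 1:]) [:\<rho>, 1:]"
      by (simp add: pcompose_prod)
    finally show ?thesis
      using f_prod by (simp add: g_def)
  qed
  note co = coeff_fam_shift[OF k, of "of_int t", folded \<rho>_def, folded g_def]
  have qi: "prime (int q)"
    using prime_q by simp
  have qk: "\<not> int q dvd int k"
    using not_dvd_small[OF q_large, of k] k by simp
  have qk1: "\<not> int q dvd int (k + 1)"
    using not_dvd_small[OF q_large, of "k + 1"] by simp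
  have q2k1: "\<not> int q dvd int (2 * k + 1)"
    using not_dvd_small[OF q_large, of "2 * k + 1"] by simp
  define c where "c = t - crit_value k"
  have tc: "of_int t - of_int (crit_value k) = (of_int c :: complex)"
    by (simp add: c_def)
  have low: "coeff (\<Prod>z\<in>Z. [:- z, 1:]) j \<in> P.M" if j: "j < 3" for j
  proof -
    consider "j = 0" | "j = 1" | "j = 2"
      using j by linarith
    then show ?thesis
    proof cases
      case 1
      have "coeff g 0 = of_int (c * int k)"
        unfolding co(1) tc by simp
      then show ?thesis
        unfolding g 1 using q_dvd by (simp only: P.of_int_in_M_iff c_def) simp
    next
      case 2
      have "coeff g 1 = of_int (- c)"
        unfolding co(2) tc by simp
      then show ?thesis
        unfolding g 2 using q_dvd by (simp only: P.of_int_in_M_iff c_def) (simp only: dvd_minus_iff)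
    next
      case 3
      then show ?thesis
        unfolding g using co(3) P.zero_in_M by simp
    qed
  qed
  have ZA: "Z \<subseteq> A"
    using ZR P.R_subset_A by blast
  have top: "coeff (\<Prod>z\<in>Z. [:- z, 1:]) 3 \<notin> P.M"
  proof
    assume "coeff (\<Prod>z\<in>Z. [:- z, 1:]) 3 \<in> P.M"
    \<comment> \<open>The third coefficient is known only up to the factor \<open>3 k\<close>;
      multiplying by it stays inside the ideal, so the contradiction can be sought there.\<close>
    then have "3 * of_nat k * coeff g 3 \<in> P.M"
      unfolding g using P.M_mult_left[of "of_nat (3 * k)" "coeff g 3"] is_subring_of_nat[OF P.subring, of "3 * k"] by simp
    moreover have "3 * of_nat k * coeff g 3 = of_int (- (int (2 * k + 1) * (int k * int (k + 1)) ^ (2 * k)))"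
      unfolding co(4) by (simp add: add.commute)
    ultimately have "int q dvd int (2 * k + 1) * (int k * int (k + 1)) ^ (2 * k)"
      by (simp only: P.of_int_in_M_iff dvd_minus_iff)
    then show False
      using qi qk qk1 q2k1 prime_dvd_mult_iff prime_dvd_power by metis
  qed
  have c0: "coeff (\<Prod>z\<in>Z. [:- z, 1:]) 0 / of_nat q \<notin> P.M"
  proof -
    obtain u where u: "c = int q * u"
      using q_dvd unfolding c_def by auto
    have "\<not> int q dvd u"
      using q_exact u unfolding c_def by (auto simp: power2_eq_square)
    then have "\<not> int q dvd u * int k"
      using qk qi prime_dvd_mult_iff by blast
    moreover have "coeff g 0 / of_nat q = of_int (u * int k)"
      unfolding co(1) tc using prime_q by (simp add: u prime_gt_0_nat)
    ultimately show ?thesis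
      unfolding g by (simp only: P.of_int_in_M_iff) simp
  qed
  have cardM: "card (Z \<inter> P.M) = 3"
    by (rule P.inertia_transitive(1)[OF finZ ZR])
      (erule (1) stable, erule low, rule top, rule c0)
  have trans: "\<exists>\<tau>\<in>P.I. \<tau> x = y" if "x \<in> Z \<inter> P.M" "y \<in> Z \<inter> P.M" for x y
    by (rule P.inertia_transitive(2)[where k = 3, OF finZ ZR])
      (erule (1) stable, erule low, rule top, rule c0, rule that(1), rule that(2))
  define T where "T = {x \<in> S. x - \<rho> \<in> P.M}"
  have TZ: "(\<lambda>x. x - \<rho>) ` T = Z \<inter> P.M"
    by (auto simp: T_def Z_def)
  have TS: "T \<subseteq> S"
    by (auto simp: T_def)
  have cardT: "card T = 3"
    using card_image[OF inj_on_subset[OF inj TS]] TZ cardM by simp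
  have SA: "x \<in> A" if "x \<in> S" for x
    using that SR P.R_subset_A by blast
  have fixed: "\<tau> z = z" if \<tau>: "\<tau> \<in> P.I" and z: "z \<in> S - T" for \<tau> z
  proof (rule ccontr)
    assume neq: "\<tau> z \<noteq> z"
    have zS: "z \<in> S"
      using z by blast
    have \<tau>zS: "\<tau> z \<in> S"
      using hom_root[OF G_hom] \<tau> P.I_subset_G zS by blast
    have "\<tau> z - z \<in> P.M"
      using \<tau> zS SR unfolding P.I_def by blast
    then have "z - \<tau> z \<in> P.M"
      using P.M_minus[of "\<tau> z - z"] by simp
    \<comment> \<open>One factor is \<open>z - \<tau> z\<close>, so the derivative at
      \<open>z\<close> lies in the ideal. As \<open>z\<close> is not congruent to
      \<open>\<rho>\<close>, the Wronskian leaves only \<open>z\<close> congruent to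
      \<open>0\<close>; then \<open>q\<close> divides \<open>t\<close> and with it
      \<open>crit_value k\<close>, which is impossible.\<close>
    then have "(\<Prod>y\<in>S - {z}. z - y) \<in> P.M"
      using P.M_prod_iff[of "S - {z}" "\<lambda>y. z - y"] finite_S \<tau>zS neq SA zS
        is_subring_diff[OF P.subring] by auto
    moreover have "poly (pderiv f) z = (\<Prod>y\<in>S - {z}. z - y)"
      by (subst f_prod) (rule pderiv_prod_linear[OF finite_S zS])
    moreover have "z + (of_nat k)\<^sup>2 \<in> A"
      using SA[OF zS] P.subring by (intro is_subring_closed)
    ultimately have "poly (pderiv f) z * (z + (of_nat k)\<^sup>2) \<in> P.M"
      using P.M_mult_right by simp
    then have W: "of_nat (2 * k + 1) * (z ^ (2 * k) * (z - \<rho>)\<^sup>2) \<in> P.M"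
      using root_pderiv[OF zS] by (simp add: \<rho>_def mult.assoc)
    have zrA: "z - \<rho> \<in> A"
      using SA[OF zS] \<rho>R P.R_subset_A is_subring_diff[OF P.subring] by blast
    have "of_nat (2 * k + 1) \<notin> P.M"
      using q2k1 P.of_int_in_M_iff[of "int (2 * k + 1)"] by simp
    moreover have "z ^ (2 * k) \<in> A" "(z - \<rho>)\<^sup>2 \<in> A" "of_nat (2 * k + 1) \<in> A"
      using SA[OF zS] zrA is_subring_of_nat[OF P.subring, of "2 * k + 1"]
      by (auto intro: is_subring_power[OF P.subring])
    ultimately have "z ^ (2 * k) \<in> P.M \<or> (z - \<rho>)\<^sup>2 \<in> P.M"
      using P.M_prime[OF _ _ W] P.M_prime is_subring_mult[OF P.subring] by blast
    moreover have "(z - \<rho>)\<^sup>2 \<notin> P.M"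
      using P.M_power[OF zrA] z by (auto simp: T_def)
    ultimately have "z \<in> P.M"
      using P.M_power[OF SA[OF zS]] by blast
    then have "0 - z \<in> P.M"
      using P.M_minus by simp
    then have "(\<Prod>x\<in>S. 0 - x) \<in> P.M"
      using P.M_prod_iff[of S "\<lambda>x. 0 - x"] finite_S zS SA is_subring_minus[OF P.subring] by auto
    then have "of_int (- (t * (int k)\<^sup>2)) \<in> P.M"
      unfolding prod_neg_S poly_fam_0 by simp
    then have "int q dvd t * (int k)\<^sup>2"
      by (simp only: P.of_int_in_M_iff dvd_minus_iff)
    then have "int q dvd t"
      using qi qk prime_dvd_mult_iff prime_dvd_power by metis
    then have "int q dvd crit_value k"
      using q_dvd dvd_diff[of "int q" t "t - crit_value k"] by simp
    then have "int q dvd int (k + 1) ^ (2 * k + 2) * int k ^ (2 * k)"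
      by (simp add: crit_value_def add.commute)
    then show False
      using qi qk qk1 prime_dvd_mult_iff prime_dvd_power by metis
  qed
  show ?thesis
  proof (rule that[OF TS cardT])
    fix x y assume xy: "x \<in> T" "y \<in> T"
    then obtain \<tau> where \<tau>: "\<tau> \<in> P.I" "\<tau> (x - \<rho>) = y - \<rho>"
      using trans[of "x - \<rho>" "y - \<rho>"] TZ by blast
    have \<tau>G: "\<tau> \<in> G"
      using \<tau>(1) P.I_subset_G by blast
    have "\<tau> x = y"
      using shift[OF \<tau>G, of x] xy TS \<tau>(2) by auto
    then show "\<exists>\<tau>\<in>G. \<tau> x = y \<and> (\<forall>z\<in>S - T. \<tau> z = z)"
      using \<tau>G fixed[OF \<tau>(1)] by blast
  qed
qed


lemma alt_subset:
  assumes e: "bij_betw e {1..n} S"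
  shows "carrier (alt_group n) \<subseteq> enumerated_roots.\<Gamma> f n e"
proof -
  interpret E: enumerated_roots f n e
    by unfold_locales (rule e)
  have mem: "E.index_perm \<sigma> \<in> E.\<Gamma>" if "\<sigma> \<in> G" for \<sigma>
    unfolding E.\<Gamma>_def using that by (rule imageI)
  have index_eq: "E.index_perm \<sigma> i = j \<longleftrightarrow> \<sigma> (e i) = e j"
    if "\<sigma> \<in> G" "i \<in> {1..n}" "j \<in> {1..n}" for \<sigma> i j
    using E.index_perm_apply[OF that(1,2)] E.e_eq_iff[OF _ that(3)] by metis
  obtain x0 where x0: "x0 \<in> S"
    "\<And>x y. x \<in> S - {x0} \<Longrightarrow> y \<in> S - {x0} \<Longrightarrow> \<exists>\<tau>\<in>G. \<tau> x0 = x0 \<and> \<tau> x = y"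
    "\<exists>\<sigma>\<in>G. \<sigma> x0 \<noteq> x0"
    by (rule stabiliser_transitive) blast
  obtain T where T: "T \<subseteq> S" "card T = 3"
    "\<And>x y. x \<in> T \<Longrightarrow> y \<in> T \<Longrightarrow> \<exists>\<tau>\<in>G. \<tau> x = y \<and> (\<forall>z\<in>S - T. \<tau> z = z)"
    by (rule three_transitive_subgroup) blast
  obtain i0 where i0: "i0 \<in> {1..n}" "e i0 = x0"
    using E.e_surj[OF x0(1)] by blast
  define J where "J = {i \<in> {1..n}. e i \<in> T}"
  have eJ: "e ` J = T"
  proof (intro equalityI subsetI)
    fix x assume "x \<in> T"
    then obtain i where "i \<in> {1..n}" "e i = x"
      using E.e_surj T(1) by blast
    then show "x \<in> e ` J"
      using \<open>x \<in> T\<close> by (auto simp: J_def)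
  qed (auto simp: J_def)
  have J: "J \<subseteq> {1..n}"
    by (auto simp: J_def)
  have "inj_on e J"
    using inj_on_subset[OF bij_betw_imp_inj_on[OF e] J] .
  then have cardJ: "card J = 3"
    using card_image[of e J] eJ T(2) by simp
  show ?thesis
  proof (rule alt_group_subset[OF E.permutation_group_\<Gamma> i0(1) _ _ J cardJ])
    fix i j assume ij: "i \<in> {1..n} - {i0}" "j \<in> {1..n} - {i0}"
    have "e i \<in> S - {x0}" "e j \<in> S - {x0}"
      using ij E.e_mem E.e_eq_iff i0 by auto
    then obtain \<tau> where \<tau>: "\<tau> \<in> G" "\<tau> x0 = x0" "\<tau> (e i) = e j"
      using x0(2) by blast
    then have "E.index_perm \<tau> i0 = i0" "E.index_perm \<tau> i = j"
      using index_eq[OF \<tau>(1)] i0 ij by auto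
    then show "\<exists>\<pi>\<in>E.\<Gamma>. \<pi> i0 = i0 \<and> \<pi> i = j"
      using mem[OF \<tau>(1)] by blast
  next
    obtain \<sigma> where \<sigma>: "\<sigma> \<in> G" "\<sigma> x0 \<noteq> x0"
      using x0(3) by blast
    then have "E.index_perm \<sigma> i0 \<noteq> i0"
      using index_eq[OF \<sigma>(1) i0(1) i0(1)] i0(2) by simp
    then show "\<exists>\<pi>\<in>E.\<Gamma>. \<pi> i0 \<noteq> i0"
      using mem[OF \<sigma>(1)] by blast
  next
    fix i j assume ij: "i \<in> J" "j \<in> J"
    then obtain \<tau> where \<tau>: "\<tau> \<in> G" "\<tau> (e i) = e j" "\<forall>z\<in>S - T. \<tau> z = z"
      using T(3)[of "e i" "e j"] by (auto simp: J_def)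
    have "E.index_perm \<tau> i = j"
      using index_eq[OF \<tau>(1)] \<tau>(2) ij J by blast
    moreover have "E.index_perm \<tau> l = l" if l: "l \<notin> J" for l
    proof (cases "l \<in> {1..n}")
      case True
      then have "e l \<in> S - T"
        using l E.e_mem by (auto simp: J_def)
      then show ?thesis
        using index_eq[OF \<tau>(1) True True] \<tau>(3) by blast
    next
      case False
      then show ?thesis
        by (rule E.index_perm_outside)
    qed
    ultimately show "\<exists>\<pi>\<in>E.\<Gamma>. \<pi> i = j \<and> (\<forall>l. l \<notin> J \<longrightarrow> \<pi> l = l)"
      using mem[OF \<tau>(1)] by blast
  qed
qed

text \<open>The product of \<open>f'\<close> over the roots is computed after multiplication by the
  product of the \<open>z + k^2\<close>, which is \<open>poly f (- k^2)\<close> because the number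
  of roots is even. Root by root the Wronskian then applies, and its product consists of values of
  \<open>f\<close> at \<open>0\<close> and at the critical point.\<close>

lemma vandermonde_square:
  assumes e: "bij_betw e {1..n} S"
  shows "\<exists>r\<in>\<rat>. r \<noteq> 0 \<and> (vandermonde n e)\<^sup>2 = r\<^sup>2 * of_int (disc_const k)"
proof -
  define \<epsilon> :: complex where "\<epsilon> = (- 1) ^ (\<Sum>j\<in>{1..n}. j - 1)"
  define V where "V = vandermonde n e"
  define c where "c = (of_nat (2 * k + 1) :: complex)"
  define u where "u = (of_nat k ^ (2 * k + 1) :: complex)"
  \<comment> \<open>A square root of the product of the Wronskian values, namely of
    \<open>c ^ n\<close> times the \<open>2 k\<close>-th power of \<open>poly f 0\<close> times the
    square of the value at the critical point.\<close>
  define N :: complex where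
    "N = c ^ (k + 1) * (of_int t * (of_nat k)\<^sup>2) ^ k * ((of_int t - of_int (crit_value k)) * of_nat k)"
  have kc: "c \<noteq> 0" "u \<noteq> 0"
    unfolding c_def u_def of_nat_power[symmetric] of_nat_eq_0_iff using k by auto
  have N0: "N \<noteq> 0"
    using kc k t_nonzero t_noncrit by (simp add: N_def)
  have rat: "N \<in> \<rat>" "c \<in> \<rat>" "u \<in> \<rat>"
    by (auto simp: N_def c_def u_def)
  have even_n: "even (card S)"
    by (simp add: card_S)
  have prod_plus: "(\<Prod>z\<in>S. z + x) = poly f (- x)" for x
  proof -
    have "(\<Prod>z\<in>S. z + x) = (\<Prod>z\<in>S. - (- x - z))"
      by (simp add: add.commute)
    also have "\<dots> = (- 1) ^ card S * (\<Prod>z\<in>S. - x - z)"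
      by (rule prod_uminus)
    finally show ?thesis
      using even_n by (simp add: prod_neg_S)
  qed
  have diff: "(\<Prod>i\<in>{1..n}. \<Prod>j\<in>{1..n} - {i}. e i - e j) = (\<Prod>z\<in>S. poly (pderiv f) z)"
  proof -
    have "(\<Prod>j\<in>{1..n} - {i}. e i - e j) = poly (pderiv f) (e i)" if i: "i \<in> {1..n}" for i
    proof -
      have "e i \<in> S"
        using bij_betw_apply[OF e i] .
      have inj: "inj_on e {1..n}"
        using bij_betw_imp_inj_on[OF e] .
      have "e ` ({1..n} - {i}) = S - {e i}"
        using inj_on_image_set_diff[OF inj, of "{1..n}" "{i}"] i bij_betw_imp_surj_on[OF e] by auto
      then have "(\<Prod>j\<in>{1..n} - {i}. e i - e j) = (\<Prod>y\<in>S - {e i}. e i - y)"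
        using prod.reindex[OF inj_on_subset[OF inj], of "{1..n} - {i}" "\<lambda>y. e i - y"] by auto
      also have "\<dots> = poly (pderiv f) (e i)"
        by (subst f_prod) (rule pderiv_prod_linear[OF finite_S \<open>e i \<in> S\<close>, symmetric])
      finally show ?thesis .
    qed
    then have "(\<Prod>i\<in>{1..n}. \<Prod>j\<in>{1..n} - {i}. e i - e j) = (\<Prod>i\<in>{1..n}. poly (pderiv f) (e i))"
      by (intro prod.cong) auto
    also have "\<dots> = (\<Prod>z\<in>S. poly (pderiv f) z)"
      by (rule prod.reindex_bij_betw[OF e])
    finally show ?thesis .
  qed
  have "(\<epsilon> * V\<^sup>2) * - (u\<^sup>2 * c) = (\<Prod>z\<in>S. poly (pderiv f) z) * (\<Prod>z\<in>S. z + (of_nat k)\<^sup>2)"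
    using diff prod_differences[where n = n and x = e]
    unfolding prod_plus poly_fam_pole by (simp only: \<epsilon>_def V_def u_def c_def)
  also have "\<dots> = (\<Prod>z\<in>S. c * z ^ (2 * k) * (z + of_nat k * (of_nat k + 1))\<^sup>2)"
    unfolding prod.distrib[symmetric] c_def by (intro prod.cong refl root_pderiv)
  also have "\<dots> = c ^ n * (\<Prod>z\<in>S. z + 0) ^ (2 * k) * (\<Prod>z\<in>S. z + of_nat k * (of_nat k + 1))\<^sup>2"
    by (simp add: prod.distrib prod_power_distrib card_S)
  also have "\<dots> = N\<^sup>2"
  proof -
    have "c ^ n = (c ^ (k + 1))\<^sup>2"
      unfolding power_mult[symmetric] by (simp add: mult.commute)
    moreover have "(- (of_int t * (of_nat k)\<^sup>2) :: complex) ^ (2 * k) = ((of_int t * (of_nat k)\<^sup>2) ^ k)\<^sup>2"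
    proof -
      have "((of_int t * (of_nat k)\<^sup>2 :: complex) ^ k)\<^sup>2 = (of_int t * (of_nat k)\<^sup>2) ^ (2 * k)"
        unfolding power_mult[symmetric] by (simp only: mult.commute)
      then show ?thesis
        by (simp only: power_minus_even even_mult_iff even_numeral simp_thms)
    qed
    ultimately show ?thesis
      unfolding prod_plus minus_zero poly_fam_0 poly_fam_crit N_def by (simp only: power_mult_distrib)
  qed
  finally have main: "(\<epsilon> * V\<^sup>2) * - (u\<^sup>2 * c) = N\<^sup>2" .
  have \<epsilon>: "\<epsilon> * \<epsilon> = 1"
    by (simp add: \<epsilon>_def flip: power_add)
  have d: "of_int (disc_const k) = - (\<epsilon> * c)"
    by (simp add: disc_const_def \<epsilon>_def c_def)
  \<comment> \<open>Only one factor \<open>c\<close> stands beside the squares, so dividing by all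
    of \<open>c\<close> leaves \<open>- \<epsilon> * c\<close>, which is
    \<open>disc_const k\<close>.\<close>
  define r where "r = N / (u * c)"
  have "V\<^sup>2 * (u\<^sup>2 * c) = N\<^sup>2 * - \<epsilon>"
    unfolding main[symmetric] using \<epsilon> by (simp add: mult_ac)
  then have "V\<^sup>2 = r\<^sup>2 * of_int (disc_const k)"
    unfolding d r_def using kc by (simp add: field_simps power2_eq_square)
  moreover have "r \<in> \<rat>" "r \<noteq> 0"
    using rat N0 kc by (auto simp: r_def)
  ultimately show ?thesis
    unfolding V_def by blast
qed

theorem galois_group_fam:
  assumes w: "w\<^sup>2 = of_int (disc_const k)" and K: "K = {a + b * w | a b. a \<in> \<rat> \<and> b \<in> \<rat>}"
  shows "galois_group K f \<cong> alt_group n"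
proof -
  obtain e where e: "bij_betw e {1..n} S"
    using ex_bij_betw_nat_finite_1[OF finite_S] card_S by auto
  interpret E: enumerated_roots f n e
    by unfold_locales (rule e)
  obtain r where r: "r \<in> \<rat>" "r \<noteq> 0" "(vandermonde n e)\<^sup>2 = r\<^sup>2 * of_int (disc_const k)"
    using vandermonde_square[OF e] by blast
  have "(vandermonde n e)\<^sup>2 = (r * w)\<^sup>2"
    using r(3) w by (simp add: power_mult_distrib)
  then have "vandermonde n e = r * w \<or> vandermonde n e = - r * w"
    by (simp add: power2_eq_iff)
  then obtain c where c: "c \<in> \<rat>" "c \<noteq> 0" "vandermonde n e = c * w"
  proof
    assume "vandermonde n e = r * w"
    then show ?thesis
      using r by (intro that[of r])
  next
    assume "vandermonde n e = - r * w"
    then show ?thesis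
      using r by (intro that[of "- r"]) auto
  qed
  have "disc_const k \<noteq> 0"
    by (simp add: disc_const_def)
  then have "w \<noteq> 0"
    using w by auto
  then show ?thesis
    using E.galois_group_alt[OF _ alt_subset[OF e] c _ _ K] w by simp
qed

end

theorem theorem1p3:
  fixes n :: nat
  assumes "n \<ge> 3" and "even n"
  shows "\<exists>(K :: complex set) (P :: int poly) (Q :: int poly).
           number_field K \<and> degree_over_Rats K \<le> 2 \<and>
           Polynomial.lead_coeff P = 1 \<and> Polynomial.degree P = n \<and>
           Q \<noteq> 0 \<and> Polynomial.degree Q \<le> n - 1 \<and>
           (\<forall>t :: int.
              galois_group K (map_poly of_int (P - Polynomial.smult t Q)) \<cong> alt_group n)"
proof -
  obtain k where k: "k \<ge> 1" and n: "n = 2 * k + 2"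
  proof -
    obtain m where "n = 2 * m"
      using assms(2) by (auto elim: evenE)
    then show ?thesis
      using assms(1) by (intro that[of "m - 1"]) auto
  qed
  obtain p where p: "prime p" "fact (2 * k + 2) + k ^ (4 * k + 2) * (2 * k + 1) + (2 * k + 1) < p"
    using bigger_prime by blast
  \<comment> \<open>A prime above \<open>p\<close> is distinct from it and inherits the bound by the
    factorial.\<close>
  obtain q where q: "prime q" "p < q"
    using bigger_prime by blast
  have "coprime p q"
    using p q by (intro primes_coprime) auto
  then have "coprime ((int p)\<^sup>2) ((int q)\<^sup>2)"
    by simp
  \<comment> \<open>Residues modulo the squares make the divisibility exact: \<open>b\<close> is
    divisible by \<open>p\<close> once, and \<open>b - crit_value k\<close> by \<open>q\<close>
    once.\<close>
  then obtain b where b: "[b = int p] (mod (int p)\<^sup>2)" "[b = crit_value k + int q] (mod (int q)\<^sup>2)"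
    using binary_chinese_remainder_int by blast
  \<comment> \<open>With \<open>N\<close> absorbed into \<open>Q\<close>, the parameter of the
    family becomes \<open>b + t * N\<close>, which satisfies the same congruences for every integer
    \<open>t\<close>. The field \<open>K\<close> depends on \<open>k\<close> alone.\<close>
  define N where "N = (int p)\<^sup>2 * (int q)\<^sup>2"
  define w where "w = csqrt (of_int (disc_const k))"
  define K where "K = {a + b * w | a b. a \<in> \<rat> \<and> b \<in> \<rat>}"
  define P where "P = (fam k b :: int poly)"
  define Q where "Q = smult N [:(int k)\<^sup>2, 1:]"
  have w: "w\<^sup>2 = of_int (disc_const k)"
    by (simp add: w_def)
  have not_square: "\<not> (int r)\<^sup>2 dvd int r" if "prime r" for r :: nat
  proof
    assume "(int r)\<^sup>2 dvd int r"
    then have "(int r)\<^sup>2 \<le> int r"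
      using prime_gt_0_nat[OF that] by (intro zdvd_imp_le) auto
    then show False
      using prime_gt_1_nat[OF that] by (simp add: power2_eq_square)
  qed
  have "galois_group K (map_poly of_int (P - smult t Q)) \<cong> alt_group n" for t :: int
  proof -
    define s where "s = b + t * N"
    have "P - smult t Q = fam k s"
      by (simp add: P_def Q_def fam_def s_def algebra_simps flip: smult_add_left)
    then have f: "map_poly of_int (P - smult t Q) = (fam k (of_int s) :: complex poly)"
      by (simp add: map_poly_fam)
    have sp: "(int p)\<^sup>2 dvd s - int p"
    proof -
      have "(int p)\<^sup>2 dvd (b - int p) + (int p)\<^sup>2 * ((int q)\<^sup>2 * t)"
        using b(1) by (intro dvd_add dvd_triv_left) (simp add: cong_iff_dvd_diff)
      then show ?thesis
        by (simp add: s_def N_def algebra_simps)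
    qed
    have sq: "(int q)\<^sup>2 dvd (s - crit_value k) - int q"
    proof -
      have "(int q)\<^sup>2 dvd (b - (crit_value k + int q)) + (int q)\<^sup>2 * ((int p)\<^sup>2 * t)"
        using b(2) by (intro dvd_add dvd_triv_left) (simp add: cong_iff_dvd_diff)
      then show ?thesis
        by (simp add: s_def N_def algebra_simps)
    qed
    have exact: "int r dvd x \<and> \<not> (int r)\<^sup>2 dvd x" if "prime r" "(int r)\<^sup>2 dvd x - int r" for r :: nat and x
    proof
      have "int r dvd x - int r"
        using that(2) by (metis dvd_mult_left power2_eq_square)
      then show "int r dvd x"
        by (metis diff_add_cancel dvd_add dvd_refl)
      show "\<not> (int r)\<^sup>2 dvd x"
        using not_square[OF that(1)] dvd_diff[of "(int r)\<^sup>2" x "x - int r"] that(2) by auto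
    qed
    interpret specialisation k p q s
      using k p q exact[OF p(1) sp] exact[OF q(1) sq] by unfold_locales auto
    show ?thesis
      unfolding f n by (rule galois_group_fam[OF w K_def])
  qed
  moreover have "number_field K" "degree_over_Rats K \<le> 2"
    unfolding K_def by (rule quadratic_field; simp add: w)+
  moreover have "N \<noteq> 0"
    using p q by (simp add: N_def prime_gt_0_nat)
  then have "Q \<noteq> 0" "degree Q \<le> n - 1"
    using n k by (auto simp: Q_def)
  moreover have "lead_coeff P = 1" "degree P = n"
    using degree_fam[OF k] by (simp_all add: P_def n)
  ultimately show ?thesis
    by blast
qed

end
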